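(* Let $p\in[1,\infty]$, $\eta=\min(\alpha-1,\beta,\gamma)$, $\mu\in(0,\eta)$ and $C_{\rm i}>0$. Fix a solution $a\in L^\infty(\mathbb R^+,\ell_p(\mathbb Z,\mathbb C))$ of the amplitude equation $i\,\partial_\tau a=\delta^+f(\delta^-a)$ with $\|a\|_{L^\infty(\mathbb R^+,\ell_p)}=N$, and consider $$X_a^\varepsilon(t)=\frac{\varepsilon}{\sqrt2}\,a(\varepsilon^{\alpha-1}t)\,e^{it}\begin{pmatrix}1\\ i\end{pmatrix}+\mathrm{c.c.}$$ There exist positive constants $\varepsilon_0=\varepsilon_0(\mu,C_{\rm i},N)$, $C_{\rm l}=C_{\rm l}(C_{\rm i},N)$ and $\nu=\nu(N)$ (each depending on $\mu$, $C_{\rm i}$ and $a$ only through the indicated arguments), where $\nu$ is a continuous non-increasing function of $N$, such that for all $\varepsilon\in(0,\varepsilon_0]$: if $X^0\in\ell_p^2$ satisfies $\|X^0-X_a^\varepsilon(0)\|_p\le C_{\rm i}\,|\ln\varepsilon|\,\varepsilon^{1+\eta}$, then the solution $X(t)\in\ell_p^2$ of $\dot X=JX+G(X)$ with $X(0)=X^0$ is defined for $t\in[0,\mu\,\nu\,|\ln\varepsilon|\,\varepsilon^{1-\alpha}]$ and satisfies $$\|X(t)-X_a^\varepsilon(t)\|_p\le C_{\rm l}\,|\ln\varepsilon|\,\varepsilon^{1+\eta-\mu},\qquad t\in[0,\mu\,\nu\,|\ln\varepsilon|\,\varepsilon^{1-\alpha}].$$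
   Context: **Lattice model.** Fix $\alpha>1$, real $(k_-,k_+)\ne(0,0)$ and $\beta,\gamma>0$. Let $V\in C^2(\mathbb R,\mathbb R)$, $V=V_\alpha+W$, where $V_\alpha(r)=\frac{k_-}{1+\alpha}|r|^{\alpha+1}$ for $r\le0$, $V_\alpha(r)=\frac{k_+}{1+\alpha}r^{\alpha+1}$ for $r\ge0$, and $W'(0)=0$, $W''(r)=O(|r|^{\alpha-1+\beta})$ as $r\to0$. Let $\phi\in C^2(\mathbb R,\mathbb R)$ with $\phi'(0)=0$, $\phi''(x)=O(|x|^{\alpha-1+\gamma})$ as $x\to0$. For sequences, $(\delta^+x)_n=x_{n+1}-x_n$, $(\delta^-x)_n=x_n-x_{n-1}$, and scalar functions act componentwise. Set $F(x)=\delta^+V'(\delta^-x)-\phi'(x)$. The lattice $\ddot x_n+x_n=F(x)_n$, $n\in\mathbb Z$, is written for $X=(x,\dot x)^T\in\ell_p^2=\ell_p(\mathbb Z,\mathbb R)^2$ as $\dot X=JX+G(X)$, with $J=\begin{pmatrix}0&\mathrm{Id}\\-\mathrm{Id}&0\end{pmatrix}$ and $G(X_1,X_2)=(0,F(X_1))^T$. Norms on $\ell_p^2$: for $X=(x,y)^T$, $\|X\|_p=\big(\sum_n(x_n^2+y_n^2)^{p/2}\big)^{1/p}$ if $p<\infty$, and $\|X\|_\infty=\sup_n(x_n^2+y_n^2)^{1/2}$. **Amplitude equation.** For $a\in\ell_p(\mathbb Z,\mathbb C)$, $(f(a))_n=\omega_0\,a_n|a_n|^{\alpha-1}$ with $$\omega_0=(k_-+k_+)\,2^{\frac{\alpha-3}{2}}\,\frac{\alpha\,\Gamma(\alpha/2)}{\sqrt\pi\,(\alpha+1)\,\Gamma((\alpha+1)/2)}.$$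 A solution $a$ on $\mathbb R^+=[0,\infty)$ is a classical ($C^2$ in time) $\ell_p(\mathbb Z,\mathbb C)$-valued solution. **Notation.** "c.c." is the complex conjugate of the preceding term; for $a\in\ell_p(\mathbb Z,\mathbb C)$ and $(z_1,z_2)^T\in\mathbb C^2$, $a\,(z_1,z_2)^T$ is the pair of sequences $(z_1a,z_2a)^T$. The constants may in addition depend on $p$ and on the model data $(\alpha,k_\pm,W,\phi,\beta,\gamma)$. *)

theory Defs
  imports
    "HOL-Probability.Essential_Supremum"
    "HOL-Library.Landau_Symbols"
    "HOL-Library.Function_Algebras"
begin

section \<open>The spaces of p-summable sequences\<close>

text \<open>
  The exponent p is an extended real in [1, \<infinity>]. The pairs of real sequences (x, y) are encoded as
  sequences of pairs, of type \<^typ>\<open>int \<Rightarrow> real \<times> real\<close>. The norm of \<^typ>\<open>real \<times> real\<close> is Euclidean,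
  so that \<open>lp_norm p\<close> is then exactly the sum (or supremum) over n of the (x n^2 + y n^2)^(p/2),
  raised to the power 1/p.
\<close>

definition lp :: "ereal \<Rightarrow> (int \<Rightarrow> 'a::real_normed_vector) set" where
  "lp p = {u. if p = \<infinity> then bdd_above (range (\<lambda>n. norm (u n)))
              else (\<lambda>n. norm (u n) powr real_of_ereal p) summable_on UNIV}"

text \<open>Only meaningful on \<open>lp p\<close>: elsewhere the sum is 0 and the supremum unspecified.\<close>

definition lp_norm :: "ereal \<Rightarrow> (int \<Rightarrow> 'a::real_normed_vector) \<Rightarrow> real" where
  "lp_norm p u = (if p = \<infinity> then (SUP n. norm (u n))
                  else (\<Sum>\<^sub>\<infinity>n. norm (u n) powr real_of_ereal p) powr (1 / real_of_ereal p))"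

text \<open>
  Derivative, in norm, of a curve in \<open>lp p\<close> defined on a set S of times; one-sided at the end
  points of an interval. Values of the curve outside of S are irrelevant.
\<close>

definition has_lp_derivative ::
  "ereal \<Rightarrow> real set \<Rightarrow> (real \<Rightarrow> int \<Rightarrow> 'a::real_normed_vector) \<Rightarrow> (real \<Rightarrow> int \<Rightarrow> 'a) \<Rightarrow> bool" where
  "has_lp_derivative p S u u' \<longleftrightarrow>
     (\<forall>t\<in>S. u t \<in> lp p \<and> u' t \<in> lp p \<and>
       ((\<lambda>s. lp_norm p (\<lambda>n. (u s n - u t n) /\<^sub>R (s - t) - u' t n)) \<longlongrightarrow> 0) (at t within S))"

definition lp_continuous_on ::
  "ereal \<Rightarrow> real set \<Rightarrow> (real \<Rightarrow> int \<Rightarrow> 'a::real_normed_vector) \<Rightarrow> bool" where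
  "lp_continuous_on p S u \<longleftrightarrow>
     (\<forall>t\<in>S. u t \<in> lp p \<and> ((\<lambda>s. lp_norm p (u s - u t)) \<longlongrightarrow> 0) (at t within S))"

definition Linfty_norm_lp :: "ereal \<Rightarrow> (real \<Rightarrow> int \<Rightarrow> 'a::real_normed_vector) \<Rightarrow> ereal" where
  "Linfty_norm_lp p u = esssup (lebesgue_on {0..}) (\<lambda>t. ereal (lp_norm p (u t)))"

section \<open>The lattice\<close>

definition C2 :: "(real \<Rightarrow> real) \<Rightarrow> bool" where
  "C2 f \<longleftrightarrow> (\<forall>x. f field_differentiable at x) \<and> (\<forall>x. deriv f field_differentiable at x) \<and>
     continuous_on UNIV (deriv (deriv f))"

definition delta_plus :: "(int \<Rightarrow> 'a::ab_group_add) \<Rightarrow> int \<Rightarrow> 'a" where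
  "delta_plus x = (\<lambda>n. x (n + 1) - x n)"

definition delta_minus :: "(int \<Rightarrow> 'a::ab_group_add) \<Rightarrow> int \<Rightarrow> 'a" where
  "delta_minus x = (\<lambda>n. x n - x (n - 1))"

definition V_hom :: "real \<Rightarrow> real \<Rightarrow> real \<Rightarrow> real \<Rightarrow> real" where
  "V_hom \<alpha> km kp r = (if r \<le> 0 then km else kp) / (1 + \<alpha>) * \<bar>r\<bar> powr (\<alpha> + 1)"

definition lattice_F :: "(real \<Rightarrow> real) \<Rightarrow> (real \<Rightarrow> real) \<Rightarrow> (int \<Rightarrow> real) \<Rightarrow> int \<Rightarrow> real" where
  "lattice_F V \<phi> x = delta_plus (deriv V \<circ> delta_minus x) - (deriv \<phi> \<circ> x)"

definition lattice_J :: "(int \<Rightarrow> real \<times> real) \<Rightarrow> int \<Rightarrow> real \<times> real" where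
  "lattice_J X = (\<lambda>n. (snd (X n), - fst (X n)))"

definition lattice_G :: "(real \<Rightarrow> real) \<Rightarrow> (real \<Rightarrow> real) \<Rightarrow> (int \<Rightarrow> real \<times> real) \<Rightarrow> int \<Rightarrow> real \<times> real" where
  "lattice_G V \<phi> X = (\<lambda>n. (0, lattice_F V \<phi> (fst \<circ> X) n))"

definition lattice_solution ::
  "(real \<Rightarrow> real) \<Rightarrow> (real \<Rightarrow> real) \<Rightarrow> ereal \<Rightarrow> real \<Rightarrow> (int \<Rightarrow> real \<times> real)
    \<Rightarrow> (real \<Rightarrow> int \<Rightarrow> real \<times> real) \<Rightarrow> bool" where
  "lattice_solution V \<phi> p T X0 X \<longleftrightarrow>
     X 0 = X0 \<and> has_lp_derivative p {0..T} X (\<lambda>t. lattice_J (X t) + lattice_G V \<phi> (X t))"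

section \<open>The amplitude equation\<close>

definition omega0 :: "real \<Rightarrow> real \<Rightarrow> real \<Rightarrow> real" where
  "omega0 \<alpha> km kp = (km + kp) * 2 powr ((\<alpha> - 3) / 2) *
     (\<alpha> * Gamma (\<alpha> / 2) / (sqrt pi * (\<alpha> + 1) * Gamma ((\<alpha> + 1) / 2)))"

definition amp_f :: "real \<Rightarrow> real \<Rightarrow> real \<Rightarrow> (int \<Rightarrow> complex) \<Rightarrow> int \<Rightarrow> complex" where
  "amp_f \<alpha> km kp a =
     (\<lambda>n. complex_of_real (omega0 \<alpha> km kp) * a n * complex_of_real (cmod (a n) powr (\<alpha> - 1)))"

definition amplitude_solution ::
  "real \<Rightarrow> real \<Rightarrow> real \<Rightarrow> ereal \<Rightarrow> (real \<Rightarrow> int \<Rightarrow> complex) \<Rightarrow> bool" where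
  "amplitude_solution \<alpha> km kp p a \<longleftrightarrow>
     (\<exists>a' a''. has_lp_derivative p {0..} a a' \<and> has_lp_derivative p {0..} a' a'' \<and>
        lp_continuous_on p {0..} a'' \<and>
        (\<forall>\<tau>\<ge>0. \<forall>n. \<i> * a' \<tau> n = delta_plus (amp_f \<alpha> km kp (delta_minus (a \<tau>))) n))"

text \<open>The sum with the complex conjugate is real; \<open>Re\<close> only changes its type.\<close>

definition X_approx ::
  "real \<Rightarrow> (real \<Rightarrow> int \<Rightarrow> complex) \<Rightarrow> real \<Rightarrow> real \<Rightarrow> int \<Rightarrow> real \<times> real" where
  "X_approx \<alpha> a \<epsilon> t =
     (\<lambda>n. let A = complex_of_real (\<epsilon> / sqrt 2) * a (\<epsilon> powr (\<alpha> - 1) * t) n * exp (\<i> * complex_of_real t)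
          in (Re (A + cnj A), Re (A * \<i> + cnj (A * \<i>))))"

end

theory Submission
  imports Defs
begin

text \<open>
In the coordinate \<open>z = x - \<i> y\<close> the harmonic part of the lattice is the rotation
\<open>z' = \<i> z\<close>, so \<open>w = cis (- t) * z\<close> moves only because of the nonlinear forces:
\<open>w' = - \<i> cis (- t) F (Re (cis t * w))\<close>, which is of order \<open>\<epsilon> powr \<alpha>\<close> when w is of order
\<open>\<epsilon>\<close>. The mean over one period of \<open>cis (- s) * h (Re (cis s * z))\<close>, for h the derivative of the
homogeneous potential, is a multiple of \<open>cmod z powr (\<alpha> - 1) * z\<close> (\<open>mean_hom_force\<close>); the multiple
is a Beta integral, and it is exactly \<open>omega0\<close> up to the power of \<open>sqrt 2\<close> that comes from
\<open>u t = sqrt 2 * \<epsilon> * a (\<epsilon> powr (\<alpha> - 1) * t)\<close> (\<open>omega0_mean_coeff\<close>). The amplitude equation is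
therefore the averaged equation for w, and \<open>X_approx\<close> is \<open>cis t * u t\<close> in real coordinates.

The difference \<open>w - u\<close> has three sources. The initial error is given. The forces that are not
homogeneous of degree \<open>\<alpha>\<close> are smaller by \<open>\<epsilon> powr \<beta>\<close> and \<open>\<epsilon> powr \<gamma>\<close>, hence contribute
\<open>\<bar>ln \<epsilon>\<bar> * \<epsilon> powr (1 + \<eta>)\<close> on times of order \<open>\<bar>ln \<epsilon>\<bar> * \<epsilon> powr (1 - \<alpha>)\<close>. The oscillating part of
the homogeneous force has mean zero, and u hardly moves during one period, so its time integral
is again of this order (\<open>lp_averaging\<close>). Gronwall's inequality with a Lipschitz constant
\<open>C * \<epsilon> powr (\<alpha> - 1)\<close> multiplies the sum by at most \<open>\<epsilon> powr (- \<mu>)\<close>, because \<open>\<nu>\<close> is chosen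
inversely proportional to C (\<open>averaged_dynamics_estimate\<close>, \<open>error_budget\<close>).

Truncation takes the place of a continuation argument for X. The forces are first truncated at an
amplitude R of order \<open>\<epsilon>\<close>, which makes the nonlinear part of the vector field globally Lipschitz with
the small constant above. Picard iteration gives a solution on the whole time interval (\<open>lp_picard\<close>), the estimate
shows that it stays below the truncation level, and there it solves the original equation
(\<open>lattice_follows_amplitude\<close>). Uniqueness follows in the same way from a truncation at the size of
the two solutions (\<open>lattice_solution_unique\<close>).

The spaces of p-summable sequences are handled through a single fact: a bound on the norm means the
same bound on all weighted finite sums with weights in the unit ball of the dual (\<open>lp_le_dual\<close>). The
triangle inequality, Minkowski's inequality for integrals and the lower semicontinuity of the norm
are thereby reduced to the same statements for numbers, for all p at once.
\<close>

section \<open>Bounds on the norm of a sequence, and duality\<close>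

text \<open>
The function \<open>lp_norm\<close> says nothing about a sequence outside of the space. Every estimate therefore
carries the membership along with the bound.
\<close>

definition lp_le :: "ereal \<Rightarrow> (int \<Rightarrow> 'a::real_normed_vector) \<Rightarrow> real \<Rightarrow> bool" where
  "lp_le p u M \<longleftrightarrow> u \<in> lp p \<and> lp_norm p u \<le> M"

lemma lp_le_infty: "lp_le \<infinity> u M \<longleftrightarrow> (\<forall>n. norm (u n) \<le> M)"
proof
  assume "lp_le \<infinity> u M"
  then have b: "bdd_above (range (\<lambda>n. norm (u n)))" and s: "(SUP n. norm (u n)) \<le> M"
    by (auto simp: lp_le_def lp_def lp_norm_def)
  show "\<forall>n. norm (u n) \<le> M"
    using cSUP_upper[OF _ b] s by (meson UNIV_I order_trans)
next
  assume *: "\<forall>n. norm (u n) \<le> M"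
  then have "bdd_above (range (\<lambda>n. norm (u n)))" by (auto intro!: bdd_aboveI[of _ M])
  moreover have "(SUP n. norm (u n)) \<le> M" using * by (auto intro!: cSUP_least)
  ultimately show "lp_le \<infinity> u M" by (simp add: lp_le_def lp_def lp_norm_def)
qed

lemma lp_le_finite:
  assumes q: "1 \<le> q"
  shows "lp_le (ereal q) u M \<longleftrightarrow>
    0 \<le> M \<and> (\<forall>J. finite J \<longrightarrow> (\<Sum>n\<in>J. norm (u n) powr q) \<le> M powr q)"
proof
  assume "lp_le (ereal q) u M"
  then have s: "(\<lambda>n. norm (u n) powr q) summable_on UNIV"
    and b: "(\<Sum>\<^sub>\<infinity>n. norm (u n) powr q) powr (1 / q) \<le> M"
    by (auto simp: lp_le_def lp_def lp_norm_def)
  have M: "0 \<le> M" using b by (meson order_trans powr_ge_zero)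
  have nn: "0 \<le> (\<Sum>\<^sub>\<infinity>n. norm (u n) powr q)" by (intro infsum_nonneg) auto
  have "(\<Sum>\<^sub>\<infinity>n. norm (u n) powr q) = ((\<Sum>\<^sub>\<infinity>n. norm (u n) powr q) powr (1 / q)) powr q"
    using q nn by (simp add: powr_powr)
  also have "\<dots> \<le> M powr q" using b q by (intro powr_mono2) auto
  finally have "(\<Sum>n\<in>J. norm (u n) powr q) \<le> M powr q" if "finite J" for J
    using finite_sum_le_infsum[OF s that] by fastforce
  with M show "0 \<le> M \<and> (\<forall>J. finite J \<longrightarrow> (\<Sum>n\<in>J. norm (u n) powr q) \<le> M powr q)" by blast
next
  assume *: "0 \<le> M \<and> (\<forall>J. finite J \<longrightarrow> (\<Sum>n\<in>J. norm (u n) powr q) \<le> M powr q)"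
  then have s: "(\<lambda>n. norm (u n) powr q) summable_on UNIV"
    by (intro nonneg_bdd_above_summable_on) (auto intro!: bdd_aboveI[of _ "M powr q"])
  have "(\<Sum>\<^sub>\<infinity>n. norm (u n) powr q) \<le> M powr q"
    using * by (intro infsum_le_finite_sums[OF s]) auto
  then have "(\<Sum>\<^sub>\<infinity>n. norm (u n) powr q) powr (1 / q) \<le> (M powr q) powr (1 / q)"
    using q by (intro powr_mono2 infsum_nonneg) auto
  also have "\<dots> = M" using q * by (simp add: powr_powr)
  finally show "lp_le (ereal q) u M" using s by (simp add: lp_le_def lp_def lp_norm_def)
qed

lemma exponent_cases:
  fixes p :: ereal
  assumes "1 \<le> p"
  obtains "p = \<infinity>" | q where "p = ereal q" "1 \<le> q"
  using assms by (cases p) auto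

text \<open>
Young's inequality for the exponents \<open>q / (q - 1)\<close> and q, in a form that includes q = 1: it says
that the graph of \<open>x powr q\<close> lies above its tangent at a.
\<close>

lemma young_powr:
  fixes a b q :: real
  assumes q: "1 \<le> q" and "0 \<le> a" "0 \<le> b"
  shows "a powr (q - 1) * b \<le> (1 - 1 / q) * a powr q + b powr q / q"
proof (cases "a = 0 \<or> b = 0")
  case True
  then show ?thesis using assms by auto
next
  case False
  then have ab: "0 < a" "0 < b" using assms by auto
  have d: "((\<lambda>x. x powr q) has_real_derivative q * a powr (q - 1)) (at a within {0<..})"
    using ab by (auto intro!: derivative_eq_intros)
  have "q * a powr (q - 1) * (b - a) \<le> b powr q - a powr q"
    by (rule convex_on_imp_above_tangent[OF powr_convex[OF q] _ _ _ d])
      (use ab in \<open>auto simp: interior_open\<close>)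
  moreover have "a powr q = a powr (q - 1) * a"
    using ab by (simp add: powr_diff)
  ultimately have "q * (a powr (q - 1) * b) \<le> (q - 1) * a powr q + b powr q"
    by (simp add: algebra_simps)
  then show ?thesis using q by (simp add: field_simps)
qed

text \<open>
Hoelder's inequality for the weights that attain the norm of x; Young's inequality is summed after
both sequences have been normalised.
\<close>

lemma holder_power_weights:
  fixes x y :: "int \<Rightarrow> real"
  assumes q: "1 \<le> q" and x: "\<And>n. 0 \<le> x n" and y: "\<And>n. 0 \<le> y n" and M: "0 \<le> M"
    and S: "S > 0" "(\<Sum>n\<in>J. x n powr q) = S powr q"
    and le: "(\<Sum>n\<in>J. y n powr q) \<le> M powr q"
  shows "(\<Sum>n\<in>J. x n powr (q - 1) * y n) \<le> S powr (q - 1) * M"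
proof (cases "M = 0")
  case True
  show ?thesis
  proof (cases "finite J")
    case fin: True
    have "(\<Sum>n\<in>J. y n powr q) = 0" using le True by (simp add: order_antisym sum_nonneg)
    then have "\<And>n. n \<in> J \<Longrightarrow> y n = 0" using fin by (simp add: sum_nonneg_eq_0_iff)
    then show ?thesis using True by simp
  qed (use True in simp)
next
  case False
  with M have M: "0 < M" by simp
  have *: "x n powr (q - 1) * y n \<le> S powr (q - 1) * M * ((1 - 1/q) * (x n powr q / S powr q) + y n powr q / M powr q / q)" for n
  proof -
    have "(x n / S) powr (q - 1) * (y n / M) \<le> (1 - 1/q) * (x n / S) powr q + (y n / M) powr q / q"
      using young_powr[OF q, of "x n / S" "y n / M"] x y S M by simp
    then have "S powr (q - 1) * M * ((x n / S) powr (q - 1) * (y n / M)) \<le> S powr (q - 1) * M * ((1 - 1/q) * (x n / S) powr q + (y n / M) powr q / q)"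
      using M by (intro mult_left_mono) auto
    then show ?thesis using M S x y by (simp add: powr_divide)
  qed
  have "(\<Sum>n\<in>J. x n powr (q - 1) * y n)
    \<le> (\<Sum>n\<in>J. S powr (q - 1) * M * ((1 - 1/q) * (x n powr q / S powr q) + y n powr q / M powr q / q))"
    by (intro sum_mono *)
  also have "\<dots> = S powr (q - 1) * M * ((1 - 1/q) * ((\<Sum>n\<in>J. x n powr q) / S powr q) + (\<Sum>n\<in>J. y n powr q) / M powr q / q)"
    by (simp only: sum_distrib_left sum.distrib sum_divide_distrib distrib_left)
  also have "\<dots> \<le> S powr (q - 1) * M * ((1 - 1/q) * 1 + 1 / q)"
    using M S le q by (intro mult_left_mono add_mono divide_right_mono) auto
  finally show ?thesis by simp
qed

text \<open>
The nonnegative, finitely supported elements of the unit ball of the dual space. They are described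
by their effect and not by the conjugate exponent, so that one definition covers p = 1 and \<open>p = \<infinity>\<close> as well.
\<close>

definition lp_dual :: "ereal \<Rightarrow> int set \<Rightarrow> (int \<Rightarrow> real) \<Rightarrow> bool" where
  "lp_dual p J c \<longleftrightarrow> finite J \<and> (\<forall>n. 0 \<le> c n) \<and>
     (\<forall>y::int \<Rightarrow> real. \<forall>M. lp_le p y M \<longrightarrow> (\<Sum>n\<in>J. c n * \<bar>y n\<bar>) \<le> M)"

lemma lp_le_norm_iff:
  fixes u :: "int \<Rightarrow> 'a::real_normed_vector"
  shows "lp_le p (\<lambda>n. norm (u n)) M \<longleftrightarrow> lp_le p u M"
  by (simp add: lp_le_def lp_def lp_norm_def)

lemma lp_le_nonneg: "lp_le p u M \<Longrightarrow> 1 \<le> p \<Longrightarrow> 0 \<le> M"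
  by (erule exponent_cases) (auto simp: lp_le_infty lp_le_finite intro: order_trans[OF norm_ge_zero])

text \<open>
From right to left, the bound is tested with point masses if \<open>p = \<infinity>\<close>, and otherwise, on each finite
set, with multiples of \<open>norm (u n) powr (q - 1)\<close>, which are admissible by Hoelder's inequality and
give back the norm of the restriction of u to the set.
\<close>

theorem lp_le_dual:
  fixes u :: "int \<Rightarrow> 'a::real_normed_vector"
  assumes p: "1 \<le> p"
  shows "lp_le p u M \<longleftrightarrow> (\<forall>J c. lp_dual p J c \<longrightarrow> (\<Sum>n\<in>J. c n * norm (u n)) \<le> M)"
proof
  assume "lp_le p u M"
  then have "lp_le p (\<lambda>n. norm (u n)) M" by (simp add: lp_le_norm_iff)
  then show "\<forall>J c. lp_dual p J c \<longrightarrow> (\<Sum>n\<in>J. c n * norm (u n)) \<le> M"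
    unfolding lp_dual_def by fastforce
next
  assume *: "\<forall>J c. lp_dual p J c \<longrightarrow> (\<Sum>n\<in>J. c n * norm (u n)) \<le> M"
  have "lp_dual p {} (\<lambda>_. 0)" using lp_le_nonneg[OF _ p] by (auto simp: lp_dual_def)
  with * have M: "0 \<le> M" by force
  from p show "lp_le p u M"
  proof (cases rule: exponent_cases)
    case 1
    have "lp_dual p {n} (\<lambda>_. 1)" for n unfolding 1 by (auto simp: lp_dual_def lp_le_infty)
    then have "norm (u n) \<le> M" for n using * by fastforce
    then show ?thesis by (simp add: 1 lp_le_infty)
  next
    case (2 q)
    have "(\<Sum>n\<in>J. norm (u n) powr q) \<le> M powr q" if J: "finite J" for J
    proof (cases "(\<Sum>n\<in>J. norm (u n) powr q) = 0")
      case True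
      then show ?thesis by simp
    next
      case False
      define S where "S = (\<Sum>n\<in>J. norm (u n) powr q) powr (1 / q)"
      have pos: "(\<Sum>n\<in>J. norm (u n) powr q) > 0" using False by (simp add: order_less_le sum_nonneg)
      have S: "S > 0" and Sq: "(\<Sum>n\<in>J. norm (u n) powr q) = S powr q"
        using pos 2 by (simp_all add: S_def powr_powr)
      define c where "c n = norm (u n) powr (q - 1) / S powr (q - 1)" for n
      have "(\<Sum>n\<in>J. c n * \<bar>y n\<bar>) \<le> m" if y: "lp_le p y m" for y :: "int \<Rightarrow> real" and m
      proof -
        have "(\<Sum>n\<in>J. norm (u n) powr (q - 1) * \<bar>y n\<bar>) \<le> S powr (q - 1) * m"
          using y J 2 by (intro holder_power_weights[OF 2(2) _ _ _ S Sq]) (auto simp: lp_le_finite)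
        then show ?thesis using S
          by (simp add: c_def field_simps flip: sum_divide_distrib)
      qed
      then have "lp_dual p J c" using J by (auto simp: lp_dual_def c_def)
      with * have "(\<Sum>n\<in>J. c n * norm (u n)) \<le> M" by blast
      moreover have "c n * norm (u n) = norm (u n) powr q / S powr (q - 1)" for n
        by (simp add: c_def powr_diff)
      ultimately have "S powr q / S powr (q - 1) \<le> M"
        by (simp add: Sq flip: sum_divide_distrib)
      then have "S \<le> M" using S by (simp add: powr_diff)
      then show ?thesis using Sq S 2 by (simp add: powr_mono2)
    qed
    then show ?thesis using M 2 by (simp add: lp_le_finite)
  qed
qed

lemma lp_leI: "1 \<le> p \<Longrightarrow> (\<And>J c. lp_dual p J c \<Longrightarrow> (\<Sum>n\<in>J. c n * norm (u n)) \<le> M) \<Longrightarrow> lp_le p u M"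
  by (simp add: lp_le_dual)

lemma lp_leD: "1 \<le> p \<Longrightarrow> lp_le p u M \<Longrightarrow> lp_dual p J c \<Longrightarrow> (\<Sum>n\<in>J. c n * norm (u n)) \<le> M"
  by (simp add: lp_le_dual)

lemma lp_dual_nonneg: "lp_dual p J c \<Longrightarrow> 0 \<le> c n"
  by (simp add: lp_dual_def)

lemma lp_le_zero: "1 \<le> p \<Longrightarrow> 0 \<le> M \<Longrightarrow> lp_le p (\<lambda>n. 0) M"
  by (rule lp_leI) simp_all

lemma lp_le_mono: "lp_le p u M \<Longrightarrow> M \<le> M' \<Longrightarrow> lp_le p u M'"
  by (auto simp: lp_le_def)

lemma lp_le_add:
  assumes "1 \<le> p" "lp_le p u M" "lp_le p v M'" "\<And>n. norm (w n) \<le> norm (u n) + norm (v n)"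
  shows "lp_le p w (M + M')"
proof (rule lp_leI[OF assms(1)])
  fix J c assume d: "lp_dual p J c"
  have "(\<Sum>n\<in>J. c n * norm (w n)) \<le> (\<Sum>n\<in>J. c n * norm (u n) + c n * norm (v n))"
    unfolding distrib_left[symmetric] by (intro sum_mono mult_left_mono assms lp_dual_nonneg[OF d])
  also have "\<dots> \<le> M + M'" unfolding sum.distrib
    by (intro add_mono lp_leD[OF assms(1) _ d] assms)
  finally show "(\<Sum>n\<in>J. c n * norm (w n)) \<le> M + M'" .
qed

lemma lp_le_dominated:
  assumes "1 \<le> p" "lp_le p u M" "0 \<le> k" "\<And>n. norm (w n) \<le> k * norm (u n)"
  shows "lp_le p w (k * M)"
proof (rule lp_leI[OF assms(1)])
  fix J c assume d: "lp_dual p J c"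
  have "(\<Sum>n\<in>J. c n * norm (w n)) \<le> (\<Sum>n\<in>J. c n * (k * norm (u n)))"
    by (intro sum_mono mult_left_mono assms lp_dual_nonneg[OF d])
  also have "\<dots> = k * (\<Sum>n\<in>J. c n * norm (u n))" by (simp add: sum_distrib_left mult_ac)
  also have "\<dots> \<le> k * M"
    by (intro mult_left_mono lp_leD[OF assms(1) _ d] assms)
  finally show "(\<Sum>n\<in>J. c n * norm (w n)) \<le> k * M" .
qed

lemma lp_le_cong: "lp_le p u M \<Longrightarrow> 1 \<le> p \<Longrightarrow> (\<And>n. norm (w n) \<le> norm (u n)) \<Longrightarrow> lp_le p w M"
  using lp_le_dominated[of p u M 1 w] by simp

lemma lp_le_pointwise:
  assumes "1 \<le> p" "lp_le p u M" shows "norm (u n) \<le> M"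
  using assms(1)
proof (cases rule: exponent_cases)
  case 1
  then show ?thesis using assms by (simp add: lp_le_infty)
next
  case (2 q)
  then have M: "0 \<le> M" and "(\<Sum>n\<in>{n}. norm (u n) powr q) \<le> M powr q"
    using assms by (auto simp only: lp_le_finite finite.intros)
  then show ?thesis using powr_less_mono2[of q M "norm (u n)"] 2 by fastforce
qed

lemma lp_le_shift:
  fixes u :: "int \<Rightarrow> 'a::real_normed_vector"
  assumes "lp_le p u M" shows "lp_le p (\<lambda>n. u (n + k)) M"
proof -
  have b: "bij_betw (\<lambda>n::int. n + k) UNIV UNIV" by (rule bij_betw_byWitness[of _ "\<lambda>n. n - k"]) auto
  have "range (\<lambda>n. norm (u (n + k))) = (\<lambda>n. norm (u n)) ` range (\<lambda>n. n + k)"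
    by (simp only: image_image)
  also have "\<dots> = range (\<lambda>n. norm (u n))" by (simp only: bij_betw_imp_surj_on[OF b])
  finally show ?thesis using assms
    using summable_on_reindex_bij_betw[OF b, of "\<lambda>n. norm (u n) powr real_of_ereal p"]
      infsum_reindex_bij_betw[OF b, of "\<lambda>n. norm (u n) powr real_of_ereal p"]
    by (auto simp: lp_le_def lp_def lp_norm_def split: if_splits)
qed

text \<open>
The Fatou property of the norm. Together with pointwise convergence it takes the place of the
completeness of the space.
\<close>

lemma lp_le_limit:
  fixes u :: "nat \<Rightarrow> int \<Rightarrow> 'a::real_normed_vector"
  assumes p: "1 \<le> p" and le: "eventually (\<lambda>k. lp_le p (u k) (M k)) sequentially"
    and lim: "\<And>n. (\<lambda>k. u k n) \<longlonglongrightarrow> v n" and M: "M \<longlonglongrightarrow> m"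
  shows "lp_le p v m"
proof (rule lp_leI[OF p])
  fix J c assume d: "lp_dual p J c"
  show "(\<Sum>n\<in>J. c n * norm (v n)) \<le> m"
  proof (rule tendsto_le[OF sequentially_bot M])
    show "(\<lambda>k. \<Sum>n\<in>J. c n * norm (u k n)) \<longlonglongrightarrow> (\<Sum>n\<in>J. c n * norm (v n))"
      by (intro tendsto_intros lim)
    show "\<forall>\<^sub>F k in sequentially. (\<Sum>n\<in>J. c n * norm (u k n)) \<le> M k"
      using le by eventually_elim (rule lp_leD[OF p _ d])
  qed
qed

text \<open>
Minkowski's inequality for integrals. After pairing with an element of the dual unit ball only
integrals of real functions remain.
\<close>

lemma lp_le_integral:
  fixes f :: "real \<Rightarrow> int \<Rightarrow> 'a::banach"
  assumes p: "1 \<le> p" and f: "\<And>n. continuous_on {a..b} (\<lambda>s. f s n)"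
    and le: "\<And>s. s \<in> {a..b} \<Longrightarrow> lp_le p (f s) (m s)" and m: "m integrable_on {a..b}"
  shows "lp_le p (\<lambda>n. integral {a..b} (\<lambda>s. f s n)) (integral {a..b} m)"
proof (rule lp_leI[OF p])
  fix J c assume d: "lp_dual p J c"
  then have J: "finite J" by (simp add: lp_dual_def)
  have i: "(\<lambda>s. norm (f s n)) integrable_on {a..b}" for n
    by (intro integrable_continuous_real continuous_intros f)
  have "(\<Sum>n\<in>J. c n * norm (integral {a..b} (\<lambda>s. f s n)))
      \<le> (\<Sum>n\<in>J. c n * integral {a..b} (\<lambda>s. norm (f s n)))"
    by (intro sum_mono mult_left_mono lp_dual_nonneg[OF d] integral_norm_bound_integral
        integrable_continuous_real f i) auto
  also have "\<dots> = integral {a..b} (\<lambda>s. \<Sum>n\<in>J. c n * norm (f s n))"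
    by (subst integral_sum[OF J]) (auto intro!: integrable_continuous_real continuous_intros f)
  also have "\<dots> \<le> integral {a..b} m"
    by (intro integral_le m integrable_continuous_real continuous_intros f lp_leD[OF p _ d] le)
  finally show "(\<Sum>n\<in>J. c n * norm (integral {a..b} (\<lambda>s. f s n))) \<le> integral {a..b} m" .
qed

lemma lp_le_integral_const:
  fixes f :: "real \<Rightarrow> int \<Rightarrow> 'a::banach"
  assumes p: "1 \<le> p" and ab: "a \<le> b" and f: "\<And>n. continuous_on {a..b} (\<lambda>s. f s n)"
    and le: "\<And>s. s \<in> {a..b} \<Longrightarrow> lp_le p (f s) M"
  shows "lp_le p (\<lambda>n. integral {a..b} (\<lambda>s. f s n)) ((b - a) * M)"
proof -
  have i: "((\<lambda>_. M) has_integral (b - a) * M) {a..b}"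
    using has_integral_const_real[of M a b] ab by (simp only: content_real real_scaleR_def)
  show ?thesis
    unfolding integral_unique[OF i, symmetric]
    by (rule lp_le_integral[OF p f le has_integral_integrable[OF i]])
qed

lemma lp_norm_nonneg: "1 \<le> p \<Longrightarrow> u \<in> lp p \<Longrightarrow> 0 \<le> lp_norm p u"
  using lp_le_nonneg[of p u "lp_norm p u"] by (simp add: lp_le_def)

lemma lp_le_self: "u \<in> lp p \<Longrightarrow> lp_le p u (lp_norm p u)"
  by (simp add: lp_le_def)

lemma lp_le_diff:
  assumes "1 \<le> p" "lp_le p u M" "lp_le p v M'"
  shows "lp_le p (\<lambda>n. u n - v n) (M + M')"
  by (rule lp_le_add[OF assms]) (rule norm_triangle_ineq4)

lemma lp_le_sum:
  assumes "1 \<le> p" "lp_le p u M" "lp_le p v M'"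
  shows "lp_le p (\<lambda>n. u n + v n) (M + M')"
  by (rule lp_le_add[OF assms]) (rule norm_triangle_ineq)

section \<open>Differential calculus of curves of sequences\<close>

lemma lp_mem: "u \<in> lp p \<longleftrightarrow> (\<exists>M. lp_le p u M)"
  by (auto simp: lp_le_def)

lemma lp_norm_le: "lp_le p u M \<Longrightarrow> lp_norm p u \<le> M"
  by (simp add: lp_le_def)

lemma lp_diff_mem: "1 \<le> p \<Longrightarrow> u \<in> lp p \<Longrightarrow> v \<in> lp p \<Longrightarrow> (\<lambda>n. u n - v n) \<in> lp p"
  unfolding lp_mem using lp_le_diff by blast

lemma lp_scaleR_mem: "1 \<le> p \<Longrightarrow> u \<in> lp p \<Longrightarrow> (\<lambda>n. c *\<^sub>R u n) \<in> lp p"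
  unfolding lp_mem using lp_le_dominated[of p u _ "\<bar>c\<bar>" "\<lambda>n. c *\<^sub>R u n"] by auto

text \<open>
Each component is dominated by the norm, so the difference quotients converge componentwise. This
opens the way to the fundamental theorem of calculus, which is only ever used componentwise.
\<close>

lemma lp_derivative_component:
  assumes p: "1 \<le> p" and D: "has_lp_derivative p S u u'" and t: "t \<in> S"
  shows "((\<lambda>t. u t n) has_vector_derivative u' t n) (at t within S)"
proof -
  let ?q = "\<lambda>s n. (u s n - u t n) /\<^sub>R (s - t) - u' t n"
  have lim: "((\<lambda>s. lp_norm p (?q s)) \<longlongrightarrow> 0) (at t within S)"
    and mem: "\<And>s. s \<in> S \<Longrightarrow> u s \<in> lp p" "u' t \<in> lp p"
    using D t by (auto simp: has_lp_derivative_def)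
  have "norm ((1 / norm (s - t)) *\<^sub>R (u s n - (u t n + (s - t) *\<^sub>R u' t n))) \<le> lp_norm p (?q s)"
    if s: "s \<in> S" "s \<noteq> t" for s
  proof -
    have "u s n - (u t n + (s - t) *\<^sub>R u' t n) = (s - t) *\<^sub>R ?q s n"
      using s by (simp add: scaleR_diff_right)
    then have "norm ((1 / norm (s - t)) *\<^sub>R (u s n - (u t n + (s - t) *\<^sub>R u' t n))) = norm (?q s n)"
      using s by simp
    also have "\<dots> \<le> lp_norm p (?q s)"
      using s t by (intro lp_le_pointwise[OF p] lp_le_self lp_diff_mem lp_scaleR_mem mem p) auto
    finally show ?thesis .
  qed
  then have "\<forall>\<^sub>F s in at t within S. norm ((1 / norm (s - t)) *\<^sub>R (u s n - (u t n + (s - t) *\<^sub>R u' t n))) \<le> lp_norm p (?q s)"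
    by (auto simp: eventually_at_filter)
  from Lim_null_comparison[OF this lim] show ?thesis
    unfolding has_vector_derivative_def has_derivative_within
    by (auto intro!: bounded_linear_intros)
qed

lemma lp_derivative_continuous:
  assumes p: "1 \<le> p" and D: "has_lp_derivative p S u u'" and t: "t \<in> S"
  shows "((\<lambda>s. lp_norm p (\<lambda>n. u s n - u t n)) \<longlongrightarrow> 0) (at t within S)"
proof -
  let ?q = "\<lambda>s n. (u s n - u t n) /\<^sub>R (s - t) - u' t n"
  have lim: "((\<lambda>s. lp_norm p (?q s)) \<longlongrightarrow> 0) (at t within S)"
    and mem: "\<And>s. s \<in> S \<Longrightarrow> u s \<in> lp p" "u' t \<in> lp p"
    using D t by (auto simp: has_lp_derivative_def)
  have "norm (lp_norm p (\<lambda>n. u s n - u t n)) \<le> \<bar>s - t\<bar> * (lp_norm p (?q s) + lp_norm p (u' t))"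
    if s: "s \<in> S" "s \<noteq> t" for s
  proof -
    have "lp_le p (\<lambda>n. ?q s n + u' t n) (lp_norm p (?q s) + lp_norm p (u' t))"
      using s t by (intro lp_le_sum p lp_le_self lp_diff_mem lp_scaleR_mem mem) auto
    from lp_le_dominated[OF p this, of "\<bar>s - t\<bar>" "\<lambda>n. u s n - u t n"]
    have "lp_le p (\<lambda>n. u s n - u t n) (\<bar>s - t\<bar> * (lp_norm p (?q s) + lp_norm p (u' t)))"
      using s by (simp flip: mult.assoc)
    then show ?thesis using lp_norm_nonneg[OF p, of "\<lambda>n. u s n - u t n"] by (simp add: lp_le_def)
  qed
  then have ev: "\<forall>\<^sub>F s in at t within S. norm (lp_norm p (\<lambda>n. u s n - u t n)) \<le> \<bar>s - t\<bar> * (lp_norm p (?q s) + lp_norm p (u' t))"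
    by (auto simp: eventually_at_filter)
  have "((\<lambda>s. \<bar>s - t\<bar> * (lp_norm p (?q s) + lp_norm p (u' t))) \<longlongrightarrow> \<bar>t - t\<bar> * (0 + lp_norm p (u' t))) (at t within S)"
    by (intro tendsto_intros lim)
  then show ?thesis using Lim_null_comparison[OF ev] by simp
qed

lemma lp_derivative_norm_continuous:
  assumes p: "1 \<le> p" and D: "has_lp_derivative p S u u'"
  shows "continuous_on S (\<lambda>t. lp_norm p (u t))"
  unfolding continuous_on_def
proof
  fix t assume t: "t \<in> S"
  have mem: "\<And>s. s \<in> S \<Longrightarrow> u s \<in> lp p"
    using D by (auto simp: has_lp_derivative_def)
  have "norm (lp_norm p (u s) - lp_norm p (u t)) \<le> lp_norm p (\<lambda>n. u s n - u t n)" if s: "s \<in> S" for s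
  proof -
    have d: "lp_le p (\<lambda>n. u s n - u t n) (lp_norm p (\<lambda>n. u s n - u t n))"
      using s t by (intro lp_le_self lp_diff_mem p mem)
    have "lp_le p (u s) (lp_norm p (\<lambda>n. u s n - u t n) + lp_norm p (u t))"
      by (rule lp_le_add[OF p d lp_le_self[OF mem[OF t]]]) (metis diff_add_cancel norm_triangle_ineq)
    moreover have "lp_le p (u t) (lp_norm p (\<lambda>n. u s n - u t n) + lp_norm p (u s))"
      by (rule lp_le_add[OF p d lp_le_self[OF mem[OF s]]])
        (metis norm_minus_commute diff_add_cancel norm_triangle_ineq)
    ultimately show ?thesis by (auto dest!: lp_norm_le)
  qed
  then have "\<forall>\<^sub>F s in at t within S. norm (lp_norm p (u s) - lp_norm p (u t)) \<le> lp_norm p (\<lambda>n. u s n - u t n)"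
    by (auto simp: eventually_at_filter)
  from Lim_null_comparison[OF this lp_derivative_continuous[OF p D t]]
  show "((\<lambda>t. lp_norm p (u t)) \<longlongrightarrow> lp_norm p (u t)) (at t within S)"
    by (simp add: Lim_null[symmetric])
qed

lemma lp_derivative_bounded:
  assumes p: "1 \<le> p" and D: "has_lp_derivative p {0..T} u u'"
  shows "\<exists>B. \<forall>t\<in>{0..T}. lp_le p (u t) B"
proof -
  have "compact ((\<lambda>t. lp_norm p (u t)) ` {0..T})"
    by (intro compact_continuous_image lp_derivative_norm_continuous[OF p D]) auto
  then obtain B where "\<forall>x\<in>(\<lambda>t. lp_norm p (u t)) ` {0..T}. norm x \<le> B"
    using compact_imp_bounded bounded_iff by blast
  then show ?thesis using D
    by (intro exI[of _ B]) (auto simp: lp_le_def has_lp_derivative_def)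
qed

lemma lp_lipschitz_component_continuous:
  assumes p: "1 \<le> p" and K: "0 \<le> K"
    and lip: "\<And>s t. s \<in> S \<Longrightarrow> t \<in> S \<Longrightarrow> lp_le p (\<lambda>n. g s n - g t n) (K * \<bar>s - t\<bar>)"
  shows "continuous_on S (\<lambda>t. g t n)"
proof -
  have "((\<lambda>s. g s n) \<longlongrightarrow> g t n) (at t within S)" if t: "t \<in> S" for t
  proof -
    have "\<forall>\<^sub>F s in at t within S. norm (g s n - g t n) \<le> K * \<bar>s - t\<bar>"
      using lp_le_pointwise[OF p lip] t by (auto simp: eventually_at_filter)
    moreover have "((\<lambda>s. K * \<bar>s - t\<bar>) \<longlongrightarrow> K * \<bar>t - t\<bar>) (at t within S)"
      by (intro tendsto_intros)
    ultimately show ?thesis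
      unfolding Lim_null[of "\<lambda>s. g s n"] by (auto intro: Lim_null_comparison)
  qed
  then show ?thesis by (simp add: continuous_on_def)
qed

text \<open>
The converse of the preceding passage to components: an integral taken componentwise is an
antiderivative in norm if the integrand is Lipschitz in norm, because the mean of \<open>g - g t\<close> over an
interval of length h ending or beginning at t has norm at most \<open>K * h\<close>.
\<close>

lemma lp_derivative_integral:
  fixes g :: "real \<Rightarrow> int \<Rightarrow> 'a::euclidean_space"
  assumes p: "1 \<le> p" and K: "0 \<le> K"
    and lip: "\<And>s t. s \<in> {0..T} \<Longrightarrow> t \<in> {0..T} \<Longrightarrow> lp_le p (\<lambda>n. g s n - g t n) (K * \<bar>s - t\<bar>)"
    and mem: "\<And>t. t \<in> {0..T} \<Longrightarrow> g t \<in> lp p" "\<And>t. t \<in> {0..T} \<Longrightarrow> X t \<in> lp p"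
    and X: "\<And>t n. t \<in> {0..T} \<Longrightarrow> X t n = x0 n + integral {0..t} (\<lambda>s. g s n)"
  shows "has_lp_derivative p {0..T} X g"
  unfolding has_lp_derivative_def
proof (intro ballI conjI mem)
  fix t assume t: "t \<in> {0..T}"
  let ?q = "\<lambda>s n. (X s n - X t n) /\<^sub>R (s - t) - g t n"
  have cont: "continuous_on {0..T} (\<lambda>t. g t n)" for n
    by (rule lp_lipschitz_component_continuous[OF p K lip])
  have int: "(\<lambda>s. g s n) integrable_on {a..b}" if "0 \<le> a" "b \<le> T" for a b n
    using that by (intro integrable_continuous_real continuous_on_subset[OF cont]) auto
  have inc: "X s n - X r n = integral {r..s} (\<lambda>\<sigma>. g \<sigma> n)" if "0 \<le> r" "r \<le> s" "s \<le> T" for r s n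
    using that Henstock_Kurzweil_Integration.integral_combine[where a=0 and c=r and b=s and f="\<lambda>\<sigma>. g \<sigma> n"] int[of 0 s n] X[of s n] X[of r n] by (auto simp: algebra_simps)
  have mean: "lp_le p (\<lambda>n. X s n - X r n - (s - r) *\<^sub>R g t n) (K * (s - r)\<^sup>2)"
    if rs: "0 \<le> r" "r \<le> s" "s \<le> T" "t \<in> {r..s}" for r s
  proof -
    have "lp_le p (\<lambda>n. integral {r..s} (\<lambda>\<sigma>. g \<sigma> n - g t n)) ((s - r) * (K * (s - r)))"
    proof (rule lp_le_integral_const[OF p])
      show "continuous_on {r..s} (\<lambda>\<sigma>. g \<sigma> n - g t n)" for n
        using rs by (intro continuous_intros continuous_on_subset[OF cont]) auto
      show "lp_le p (\<lambda>n. g \<sigma> n - g t n) (K * (s - r))" if "\<sigma> \<in> {r..s}" for \<sigma>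
        using that rs K by (intro lp_le_mono[OF lip] mult_left_mono) auto
    qed (rule rs)
    moreover have "integral {r..s} (\<lambda>\<sigma>. g \<sigma> n - g t n) = X s n - X r n - (s - r) *\<^sub>R g t n" for n
      using rs by (subst integral_diff) (auto simp: int inc)
    ultimately show ?thesis using rs by (simp add: power2_eq_square mult_ac)
  qed
  have "norm (lp_norm p (?q s)) \<le> K * \<bar>s - t\<bar>" if s: "s \<in> {0..T}" "s \<noteq> t" for s
  proof -
    have "lp_le p (\<lambda>n. X s n - X t n - (s - t) *\<^sub>R g t n) (K * (s - t)\<^sup>2)"
    proof (cases "t \<le> s")
      case True
      then show ?thesis using mean[of t s] s t by auto
    next
      case False
      then have "lp_le p (\<lambda>n. X t n - X s n - (t - s) *\<^sub>R g t n) (K * (t - s)\<^sup>2)"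
        using mean[of s t] s t by auto
      then have "lp_le p (\<lambda>n. - (X t n - X s n - (t - s) *\<^sub>R g t n)) (K * (t - s)\<^sup>2)"
        by (rule lp_le_cong[OF _ p]) (simp only: norm_minus_cancel)
      then show ?thesis by (simp add: power2_commute[of t s] algebra_simps)
    qed
    then have "lp_le p (?q s) (inverse \<bar>s - t\<bar> * (K * (s - t)\<^sup>2))"
    proof (rule lp_le_dominated[OF p])
      fix n
      have "?q s n = (1 / (s - t)) *\<^sub>R (X s n - X t n - (s - t) *\<^sub>R g t n)"
        using s by (simp add: scaleR_diff_right divide_inverse)
      then show "norm (?q s n) \<le> inverse \<bar>s - t\<bar> * norm (X s n - X t n - (s - t) *\<^sub>R g t n)"
        by (simp add: divide_inverse)
    qed auto
    also have "inverse \<bar>s - t\<bar> * (K * (s - t)\<^sup>2) = K * \<bar>s - t\<bar>"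
    proof -
      have "(s - t)\<^sup>2 = \<bar>s - t\<bar> * \<bar>s - t\<bar>" by (simp add: power2_eq_square)
      then show ?thesis using s by (simp only: field_simps) simp
    qed
    finally show ?thesis using lp_norm_nonneg[OF p, of "?q s"] by (simp add: lp_le_def)
  qed
  then have "\<forall>\<^sub>F s in at t within {0..T}. norm (lp_norm p (?q s)) \<le> K * \<bar>s - t\<bar>"
    by (auto simp: eventually_at_filter)
  moreover have "((\<lambda>s. K * \<bar>s - t\<bar>) \<longlongrightarrow> K * \<bar>t - t\<bar>) (at t within {0..T})"
    by (intro tendsto_intros)
  ultimately show "((\<lambda>s. lp_norm p (?q s)) \<longlongrightarrow> 0) (at t within {0..T})"
    by (auto intro: Lim_null_comparison)
qed

lemma integral_exp_growth:
  fixes L t :: real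
  assumes "0 < L" "0 \<le> t"
  shows "((\<lambda>s. exp (2 * L * s)) has_integral (exp (2 * L * t) - 1) / (2 * L)) {0..t}"
proof -
  have "((\<lambda>s. exp (2 * L * s)) has_integral exp (2 * L * t) / (2 * L) - exp (2 * L * 0) / (2 * L)) {0..t}"
    using assms by (intro fundamental_theorem_of_calculus)
      (auto intro!: derivative_eq_intros simp: has_real_derivative_iff_has_vector_derivative[symmetric])
  then show ?thesis by (simp add: diff_divide_distrib)
qed

text \<open>
The integral inequality is iterated, starting from the a priori bound B. As the integral of
\<open>L * exp (2 * L * s)\<close> up to t is less than half of \<open>exp (2 * L * t)\<close>, each step halves the part of
the bound that stems from B. Only the explicit majorants are integrated in this way, never the
norm of e itself; the price is the factor 2 in the exponent.
\<close>

lemma lp_gronwall: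
  fixes e :: "real \<Rightarrow> int \<Rightarrow> 'a::euclidean_space"
  assumes p: "1 \<le> p" and L: "0 < L"
    and e: "\<And>t n. t \<in> {0..T} \<Longrightarrow> e t n = d t n + integral {0..t} (\<lambda>s. k s n)"
    and d: "\<And>t. t \<in> {0..T} \<Longrightarrow> lp_le p (d t) A"
    and k: "\<And>n. continuous_on {0..T} (\<lambda>s. k s n)"
    and le: "\<And>s M. s \<in> {0..T} \<Longrightarrow> lp_le p (e s) M \<Longrightarrow> lp_le p (k s) (L * M)"
    and B: "\<And>t. t \<in> {0..T} \<Longrightarrow> lp_le p (e t) B"
    and t: "t \<in> {0..T}"
  shows "lp_le p (e t) (A * exp (2 * L * t))"
proof -
  have *: "\<forall>t\<in>{0..T}. lp_le p (e t) ((A + B * (1/2)^i) * exp (2 * L * t))" for i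
  proof (induction i)
    case 0
    show ?case
    proof
      fix t assume t: "t \<in> {0..T}"
      have AB: "0 \<le> A" "0 \<le> B" using d[OF t] B[OF t] lp_le_nonneg p by auto
      have "B * 1 \<le> (A + B) * exp (2 * L * t)" using AB t L by (intro mult_mono) auto
      then show "lp_le p (e t) ((A + B * (1/2)^0) * exp (2 * L * t))"
        using lp_le_mono[OF B[OF t]] by simp
    qed
  next
    case (Suc i)
    show ?case
    proof
      fix t assume t: "t \<in> {0..T}"
      have AB: "0 \<le> A" "0 \<le> B" using d[OF t] B[OF t] lp_le_nonneg p by auto
      let ?C = "A + B * (1/2)^i"
      have C: "0 \<le> ?C" using AB by simp
      have i: "((\<lambda>s. L * (?C * exp (2 * L * s))) has_integral L * (?C * ((exp (2 * L * t) - 1) / (2 * L)))) {0..t}"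
        using t by (intro has_integral_mult_right integral_exp_growth L) auto
      have "lp_le p (\<lambda>n. integral {0..t} (\<lambda>s. k s n)) (integral {0..t} (\<lambda>s. L * (?C * exp (2 * L * s))))"
        using t Suc by (intro lp_le_integral p le has_integral_integrable[OF i] continuous_on_subset[OF k]) auto
      with integral_unique[OF i]
      have "lp_le p (\<lambda>n. integral {0..t} (\<lambda>s. k s n)) (L * (?C * ((exp (2 * L * t) - 1) / (2 * L))))"
        by simp
      from lp_le_sum[OF p d[OF t] this]
      have "lp_le p (e t) (A + L * (?C * ((exp (2 * L * t) - 1) / (2 * L))))"
        unfolding e[OF t, symmetric] .
      moreover have "A + L * (?C * ((exp (2 * L * t) - 1) / (2 * L))) \<le> (A + B * (1/2)^Suc i) * exp (2 * L * t)"
      proof -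
        have "A \<le> A * exp (2 * L * t)" using AB t L by (simp add: mult_le_cancel_left1)
        moreover have "0 \<le> B * (1/2)^i" using AB by simp
        moreover have "A + (A + h) * (E - 1) / 2 \<le> (A + h / 2) * E"
          if "A \<le> A * E" "0 \<le> h" for h E :: real
          using that by (simp add: field_simps)
        ultimately have "A + ?C * (exp (2 * L * t) - 1) / 2
            \<le> (A + B * (1/2)^i / 2) * exp (2 * L * t)" by blast
        also have "B * (1/2)^i / 2 = B * (1/2)^Suc i" by simp
        finally have "A + ?C * (exp (2 * L * t) - 1) / 2 \<le> (A + B * (1/2)^Suc i) * exp (2 * L * t)" .
        then show ?thesis using L by simp
      qed
      ultimately show "lp_le p (e t) ((A + B * (1/2)^Suc i) * exp (2 * L * t))"
        by (rule lp_le_mono)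
    qed
  qed
  have "(\<lambda>i. (A + B * (1/2)^i) * exp (2 * L * t)) \<longlonglongrightarrow> (A + B * 0) * exp (2 * L * t)"
    by (intro tendsto_intros LIMSEQ_power_zero) auto
  then show ?thesis
    using lp_le_limit[OF p, of "\<lambda>_. e t" "\<lambda>i. (A + B * (1/2)^i) * exp (2 * L * t)"] * t by simp
qed

section \<open>Globally Lipschitz vector fields\<close>

definition lp_lipschitz :: "ereal \<Rightarrow> real \<Rightarrow> ((int \<Rightarrow> 'a::real_normed_vector) \<Rightarrow> int \<Rightarrow> 'a) \<Rightarrow> bool" where
  "lp_lipschitz p L \<Psi> \<longleftrightarrow>
     (\<forall>u v M. lp_le p (\<lambda>n. u n - v n) M \<longrightarrow> lp_le p (\<lambda>n. \<Psi> u n - \<Psi> v n) (L * M))"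

lemma lp_lipschitzD:
  "lp_lipschitz p L \<Psi> \<Longrightarrow> lp_le p (\<lambda>n. u n - v n) M \<Longrightarrow> lp_le p (\<lambda>n. \<Psi> u n - \<Psi> v n) (L * M)"
  by (simp add: lp_lipschitz_def)

lemma lp_lipschitz_zero:
  "lp_lipschitz p L \<Psi> \<Longrightarrow> (\<And>n. \<Psi> (\<lambda>_. 0) n = 0) \<Longrightarrow> lp_le p u M \<Longrightarrow> lp_le p (\<Psi> u) (L * M)"
  using lp_lipschitzD[of p L \<Psi> u "\<lambda>_. 0" M] by simp

lemma lp_integral_lipschitz:
  fixes g :: "real \<Rightarrow> int \<Rightarrow> 'a::euclidean_space"
  assumes p: "1 \<le> p"
    and cont: "\<And>n. continuous_on {0..T} (\<lambda>t. g t n)"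
    and le: "\<And>t. t \<in> {0..T} \<Longrightarrow> lp_le p (g t) K"
    and X: "\<And>t n. t \<in> {0..T} \<Longrightarrow> X t n = x0 n + integral {0..t} (\<lambda>s. g s n)"
    and s: "s \<in> {0..T}" and t: "t \<in> {0..T}"
  shows "lp_le p (\<lambda>n. X s n - X t n) (K * \<bar>s - t\<bar>)"
proof -
  have *: "lp_le p (\<lambda>n. X s n - X t n) (K * (s - t))"
    if ts: "0 \<le> t" "t \<le> s" "s \<le> T" for s t
  proof -
    have int: "(\<lambda>s. g s n) integrable_on {0..s}" for n
      using ts by (intro integrable_continuous_real continuous_on_subset[OF cont]) auto
    have "X s n - X t n = integral {t..s} (\<lambda>\<sigma>. g \<sigma> n)" for n
      using ts X[of s n] X[of t n] int[of n]
        Henstock_Kurzweil_Integration.integral_combine[where a=0 and c=t and b=s and f="\<lambda>\<sigma>. g \<sigma> n"]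
      by (auto simp: algebra_simps)
    moreover have "lp_le p (\<lambda>n. integral {t..s} (\<lambda>\<sigma>. g \<sigma> n)) ((s - t) * K)"
      using ts by (intro lp_le_integral_const p continuous_on_subset[OF cont] le) auto
    ultimately show ?thesis using ts by (simp add: mult.commute)
  qed
  show ?thesis
  proof (cases "t \<le> s")
    case True
    then show ?thesis using *[of t s] s t by simp
  next
    case False
    then have "lp_le p (\<lambda>n. X t n - X s n) (K * \<bar>s - t\<bar>)"
      using *[of s t] s t by (simp add: abs_minus_commute)
    then show ?thesis by (rule lp_le_cong[OF _ p]) (simp add: norm_minus_commute)
  qed
qed

text \<open>
Picard iteration. With the weight \<open>exp (2 * L * t)\<close> each step contracts by 1/2, so the distances
between the iterates are summable geometrically, uniformly on [0, T]. The iterates converge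
componentwise, and the Fatou property turns the bounds for them into bounds for the limit.
\<close>

theorem lp_picard:
  fixes \<Psi> :: "(int \<Rightarrow> 'a::euclidean_space) \<Rightarrow> int \<Rightarrow> 'a"
  assumes p: "1 \<le> p" and L: "0 < L" and lip: "lp_lipschitz p L \<Psi>"
    and zero: "\<And>n. \<Psi> (\<lambda>_. 0) n = 0" and x0: "x0 \<in> lp p" and T: "0 \<le> T"
  shows "\<exists>X. X 0 = x0 \<and> has_lp_derivative p {0..T} X (\<lambda>t. \<Psi> (X t))"
proof -
  define P :: "nat \<Rightarrow> real \<Rightarrow> int \<Rightarrow> 'a" where "P = rec_nat (\<lambda>t. x0) (\<lambda>k Y t n. x0 n + integral {0..t} (\<lambda>s. \<Psi> (Y s) n))"
  have P0: "P 0 t = x0" and PS: "P (Suc k) t n = x0 n + integral {0..t} (\<lambda>s. \<Psi> (P k s) n)" for k t n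
    by (simp_all add: P_def)
  define M where "M = lp_norm p x0"
  have M: "lp_le p x0 M" using x0 by (simp add: M_def lp_le_self)
  have M0: "0 \<le> M" using lp_le_nonneg[OF M p] .
  \<comment> \<open>At this stage the Lipschitz constant in time may depend on k; it only serves to integrate the
    next iterate. The constant K below is uniform.\<close>
  have reg: "(\<exists>K\<ge>0. \<forall>s\<in>{0..T}. \<forall>t\<in>{0..T}. lp_le p (\<lambda>n. P k s n - P k t n) (K * \<bar>s - t\<bar>))" for k
  proof (induction k)
    case 0
    show ?case by (intro exI[of _ 0]) (auto simp: P0 lp_le_zero[OF p])
  next
    case (Suc k)
    then obtain K where K: "0 \<le> K" "\<And>s t. s \<in> {0..T} \<Longrightarrow> t \<in> {0..T} \<Longrightarrow> lp_le p (\<lambda>n. P k s n - P k t n) (K * \<bar>s - t\<bar>)"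
      by blast
    have P0k: "P k 0 n = x0 n" for n by (cases k) (simp_all add: P0 PS)
    have b: "lp_le p (P k t) (K * T + M)" if t: "t \<in> {0..T}" for t
    proof -
      have "lp_le p (P k t) (K * \<bar>t - 0\<bar> + M)"
        by (rule lp_le_add[OF p K(2)[OF t] M]) (use T P0k norm_triangle_sub[of "P k t _" "x0 _"] in \<open>auto simp: add.commute\<close>)
      then show ?thesis by (rule lp_le_mono) (use t K in \<open>auto intro: mult_left_mono\<close>)
    qed
    have lipk: "lp_le p (\<lambda>n. \<Psi> (P k s) n - \<Psi> (P k t) n) ((L * K) * \<bar>s - t\<bar>)"
      if "s \<in> {0..T}" "t \<in> {0..T}" for s t
      using lp_lipschitzD[OF lip K(2)[OF that]] by (simp add: mult.assoc)
    show ?case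
    proof (intro exI[of _ "L * (K * T + M)"] conjI ballI)
      show "0 \<le> L * (K * T + M)" using L K M0 T by auto
      show "lp_le p (\<lambda>n. P (Suc k) s n - P (Suc k) t n) (L * (K * T + M) * \<bar>s - t\<bar>)"
        if "s \<in> {0..T}" "t \<in> {0..T}" for s t
        by (rule lp_integral_lipschitz[OF p _ _ PS that])
          (use L K in \<open>auto intro!: lp_lipschitz_component_continuous[OF p _ lipk] lp_lipschitz_zero[OF lip zero b]\<close>)
    qed
  qed
  have contP: "continuous_on {0..T} (\<lambda>s. \<Psi> (P k s) n)" for k n
  proof -
    from reg[of k] obtain K where K: "0 \<le> K" "\<And>s t. s \<in> {0..T} \<Longrightarrow> t \<in> {0..T} \<Longrightarrow> lp_le p (\<lambda>n. P k s n - P k t n) (K * \<bar>s - t\<bar>)"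
      by blast
    have lipk: "lp_le p (\<lambda>n. \<Psi> (P k s) n - \<Psi> (P k t) n) ((L * K) * \<bar>s - t\<bar>)"
      if "s \<in> {0..T}" "t \<in> {0..T}" for s t
      using lp_lipschitzD[OF lip K(2)[OF that]] by (simp add: mult.assoc)
    show ?thesis by (rule lp_lipschitz_component_continuous[OF p _ lipk]) (use L K in auto)
  qed
  have step: "\<forall>t\<in>{0..T}. lp_le p (\<lambda>n. P (Suc k) t n - P k t n) (M * (1/2)^k * exp (2 * L * t))" for k
  proof (induction k)
    case 0
    show ?case
    proof
      fix t assume t: "t \<in> {0..T}"
      have "lp_le p (\<lambda>n. integral {0..t} (\<lambda>s. \<Psi> (P 0 s) n)) ((t - 0) * (L * M))"
        using t by (intro lp_le_integral_const p continuous_on_subset[OF contP])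
          (auto simp: P0 intro: lp_lipschitz_zero[OF lip zero M])
      then have le: "lp_le p (\<lambda>n. P (Suc 0) t n - P 0 t n) (t * (L * M))"
        by (simp add: PS P0)
      have "0 \<le> L * t" using L t by simp
      then have "L * t \<le> exp (2 * L * t)" using exp_ge_add_one_self[of "2 * L * t"] by linarith
      then have "M * (L * t) \<le> M * exp (2 * L * t)" using M0 by (intro mult_left_mono) auto
      then show "lp_le p (\<lambda>n. P (Suc 0) t n - P 0 t n) (M * (1/2)^0 * exp (2 * L * t))"
        by (intro lp_le_mono[OF le]) (simp add: mult_ac)
    qed
  next
    case (Suc k)
    show ?case
    proof
      fix t assume t: "t \<in> {0..T}"
      let ?C = "M * (1/2)^k"
      have i: "((\<lambda>s. L * (?C * exp (2 * L * s))) has_integral L * (?C * ((exp (2 * L * t) - 1) / (2 * L)))) {0..t}"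
        using t by (intro has_integral_mult_right integral_exp_growth L) auto
      have "lp_le p (\<lambda>n. integral {0..t} (\<lambda>s. \<Psi> (P (Suc k) s) n - \<Psi> (P k s) n)) (integral {0..t} (\<lambda>s. L * (?C * exp (2 * L * s))))"
      proof (rule lp_le_integral[OF p])
        show "continuous_on {0..t} (\<lambda>s. \<Psi> (P (Suc k) s) n - \<Psi> (P k s) n)" for n
          using t by (intro continuous_on_diff continuous_on_subset[OF contP]) auto
        show "lp_le p (\<lambda>n. \<Psi> (P (Suc k) s) n - \<Psi> (P k s) n) (L * (?C * exp (2 * L * s)))" if "s \<in> {0..t}" for s
          using Suc that t by (intro lp_lipschitzD[OF lip]) auto
      qed (rule has_integral_integrable[OF i])
      moreover have "integral {0..t} (\<lambda>s. \<Psi> (P (Suc k) s) n - \<Psi> (P k s) n) = P (Suc (Suc k)) t n - P (Suc k) t n" for n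
        unfolding PS[of "Suc k"] PS[of k t] using t
        by (subst integral_diff) (auto intro!: integrable_continuous_real continuous_on_subset[OF contP])
      ultimately have le: "lp_le p (\<lambda>n. P (Suc (Suc k)) t n - P (Suc k) t n) (L * (?C * ((exp (2 * L * t) - 1) / (2 * L))))"
        by (simp only: integral_unique[OF i])
      have "L * (?C * ((exp (2 * L * t) - 1) / (2 * L))) \<le> M * (1/2)^Suc k * exp (2 * L * t)"
        using L M0 by (simp add: field_simps)
      then show "lp_le p (\<lambda>n. P (Suc (Suc k)) t n - P (Suc k) t n) (M * (1/2)^Suc k * exp (2 * L * t))"
        by (rule lp_le_mono[OF le])
    qed
  qed
  define E where "E = 2 * M * exp (2 * L * T)"
  have E0: "0 \<le> E" using M0 by (simp add: E_def)
  have cauchy: "lp_le p (\<lambda>n. P (k + j) t n - P k t n) (E * (1/2)^k * (1 - (1/2)^j))" if t: "t \<in> {0..T}" for k j t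
  proof (induction j)
    case 0
    show ?case by (simp add: lp_le_zero[OF p])
  next
    case (Suc j)
    have "M * (1/2)^(k+j) * exp (2 * L * t) \<le> M * (1/2)^(k+j) * exp (2 * L * T)"
      using t M0 L by (intro mult_left_mono) auto
    then have "lp_le p (\<lambda>n. P (Suc (k + j)) t n - P (k + j) t n) (M * (1/2)^(k+j) * exp (2 * L * T))"
      using step t lp_le_mono by blast
    from lp_le_sum[OF p Suc this]
    have "lp_le p (\<lambda>n. P (k + Suc j) t n - P k t n) (E * (1/2)^k * (1 - (1/2)^j) + M * (1/2)^(k+j) * exp (2 * L * T))"
      by simp
    moreover have "E * (1/2)^k * (1 - (1/2)^j) + M * (1/2)^(k+j) * exp (2 * L * T) = E * (1/2)^k * (1 - (1/2)^Suc j)"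
      by (simp add: E_def power_add field_simps)
    ultimately show ?case by metis
  qed
  have cauchy': "lp_le p (\<lambda>n. P (k + j) t n - P k t n) (E * (1/2)^k)" if t: "t \<in> {0..T}" for k j t
    by (rule lp_le_mono[OF cauchy[OF t]]) (use E0 in \<open>simp add: mult_left_le\<close>)
  have small: "(\<lambda>k. c * (1/2)^k) \<longlonglongrightarrow> 0" for c :: real
    by (intro tendsto_mult_right_zero LIMSEQ_power_zero) auto
  have conv: "convergent (\<lambda>k. P k t n)" if t: "t \<in> {0..T}" for t n
  proof -
    have "Cauchy (\<lambda>k. P k t n)"
    proof (rule CauchyI)
      fix e :: real assume e: "0 < e"
      obtain N where N: "\<And>k. k \<ge> N \<Longrightarrow> norm (2 * E * (1/2)^k) < e"
        using LIMSEQ_D[OF small[of "2 * E"] e] by auto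
      have "norm (P k t n - P N t n) \<le> E * (1/2)^N" if "k \<ge> N" for k
        using lp_le_pointwise[OF p cauchy'[OF t, of N "k - N"], of n] that by simp
      then have "norm (P k t n - P l t n) \<le> E * (1/2)^N + E * (1/2)^N" if "k \<ge> N" "l \<ge> N" for k l
        using that norm_triangle_ineq4[of "P k t n - P N t n" "P l t n - P N t n"]
        by (smt (verit, best) diff_diff_eq2 diff_add_cancel)
      then show "\<exists>N. \<forall>k\<ge>N. \<forall>l\<ge>N. norm (P k t n - P l t n) < e"
        using N[of N] E0 by (intro exI[of _ N]) (smt (verit) le_refl norm_ge_zero real_norm_def mult_2 distrib_right)
    qed
    then show ?thesis by (simp add: Cauchy_convergent_iff)
  qed
  define X where "X t n = lim (\<lambda>k. P k t n)" for t n
  have lim: "(\<lambda>k. P k t n) \<longlonglongrightarrow> X t n" if t: "t \<in> {0..T}" for t n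
    using conv[OF t] by (simp add: X_def convergent_LIMSEQ_iff)
  have close: "lp_le p (\<lambda>n. X t n - P k t n) (E * (1/2)^k)" if t: "t \<in> {0..T}" for t k
  proof (rule lp_le_limit[OF p _ _ tendsto_const])
    show "\<forall>\<^sub>F j in sequentially. lp_le p (\<lambda>n. P (j + k) t n - P k t n) (E * (1/2)^k)"
      using cauchy'[OF t, of k] by (simp add: add.commute)
    show "(\<lambda>j. P (j + k) t n - P k t n) \<longlonglongrightarrow> X t n - P k t n" for n
      by (intro tendsto_intros LIMSEQ_ignore_initial_segment lim t)
  qed
  have bP: "lp_le p (P k t) (E + M)" if t: "t \<in> {0..T}" for k t
    by (rule lp_le_add[OF p cauchy'[OF t, of 0 k, simplified] M])
      (use norm_triangle_sub[of "P k t _" "x0 _"] in \<open>auto simp: P0 add.commute\<close>)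
  have bX: "lp_le p (X t) (E + M)" if t: "t \<in> {0..T}" for t
    by (rule lp_le_add[OF p close[OF t, of 0, simplified] M])
      (use norm_triangle_sub[of "X t _" "x0 _"] in \<open>auto simp: P0 add.commute\<close>)
  define K where "K = L * (E + M)"
  have K0: "0 \<le> K" using L E0 M0 by (simp add: K_def)
  have lipP: "lp_le p (\<lambda>n. P (Suc k) s n - P (Suc k) t n) (K * \<bar>s - t\<bar>)"
    if "s \<in> {0..T}" "t \<in> {0..T}" for s t k
    by (rule lp_integral_lipschitz[OF p contP _ PS that]) (auto simp: K_def intro!: lp_lipschitz_zero[OF lip zero bP])
  have lipX: "lp_le p (\<lambda>n. X s n - X t n) (K * \<bar>s - t\<bar>)" if "s \<in> {0..T}" "t \<in> {0..T}" for s t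
  proof (rule lp_le_limit[OF p _ _ tendsto_const])
    show "\<forall>\<^sub>F k in sequentially. lp_le p (\<lambda>n. P (Suc k) s n - P (Suc k) t n) (K * \<bar>s - t\<bar>)"
      using lipP[OF that] by simp
    show "(\<lambda>k. P (Suc k) s n - P (Suc k) t n) \<longlonglongrightarrow> X s n - X t n" for n
      by (intro tendsto_intros LIMSEQ_Suc lim that)
  qed
  have lipPsi: "lp_le p (\<lambda>n. \<Psi> (X s) n - \<Psi> (X t) n) ((L * K) * \<bar>s - t\<bar>)" if "s \<in> {0..T}" "t \<in> {0..T}" for s t
    using lp_lipschitzD[OF lip lipX[OF that]] by (simp add: mult.assoc)
  have contX: "continuous_on {0..T} (\<lambda>s. \<Psi> (X s) n)" for n
    by (rule lp_lipschitz_component_continuous[OF p _ lipPsi]) (use L K0 in auto)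
  have eq: "X t n = x0 n + integral {0..t} (\<lambda>s. \<Psi> (X s) n)" if t: "t \<in> {0..T}" for t n
  proof (rule LIMSEQ_unique)
    show "(\<lambda>k. P (Suc k) t n) \<longlonglongrightarrow> X t n" by (intro LIMSEQ_Suc lim t)
    have "norm (P (Suc k) t n - (x0 n + integral {0..t} (\<lambda>s. \<Psi> (X s) n))) \<le> (t * L * E) * (1/2)^k" for k
    proof -
      have "lp_le p (\<lambda>n. integral {0..t} (\<lambda>s. \<Psi> (X s) n - \<Psi> (P k s) n)) ((t - 0) * (L * (E * (1/2)^k)))"
        using t by (intro lp_le_integral_const p continuous_on_diff continuous_on_subset[OF contP] continuous_on_subset[OF contX] lp_lipschitzD[OF lip close]) auto
      from lp_le_pointwise[OF p this, of n]
      have "norm (integral {0..t} (\<lambda>s. \<Psi> (X s) n - \<Psi> (P k s) n)) \<le> (t * L * E) * (1/2)^k"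
        by (simp add: mult.assoc)
      moreover have "integral {0..t} (\<lambda>s. \<Psi> (X s) n - \<Psi> (P k s) n) = - (P (Suc k) t n - (x0 n + integral {0..t} (\<lambda>s. \<Psi> (X s) n)))"
        unfolding PS using t by (subst integral_diff)
          (auto intro!: integrable_continuous_real continuous_on_subset[OF contP] continuous_on_subset[OF contX])
      ultimately show ?thesis by (simp only: norm_minus_cancel)
    qed
    then show "(\<lambda>k. P (Suc k) t n) \<longlonglongrightarrow> x0 n + integral {0..t} (\<lambda>s. \<Psi> (X s) n)"
      unfolding Lim_null[of "\<lambda>k. P (Suc k) t n"] by (intro Lim_null_comparison[OF _ small] always_eventually allI)
  qed
  have "has_lp_derivative p {0..T} X (\<lambda>t. \<Psi> (X t))"
  proof (rule lp_derivative_integral[OF p _ lipPsi])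
    show "0 \<le> L * K" using L K0 by simp
    show "X t \<in> lp p" if "t \<in> {0..T}" for t using bX[OF that] by (auto simp: lp_mem)
    show "\<Psi> (X t) \<in> lp p" if "t \<in> {0..T}" for t
      using lp_lipschitz_zero[OF lip zero bX[OF that]] by (auto simp: lp_mem)
  qed (auto intro: eq)
  moreover have "X 0 = x0" using eq[of 0] T by auto
  ultimately show ?thesis by blast
qed

lemma lp_flow_component_continuous:
  fixes \<Psi> :: "(int \<Rightarrow> 'a::real_normed_vector) \<Rightarrow> int \<Rightarrow> 'a"
  assumes p: "1 \<le> p" and lip: "lp_lipschitz p L \<Psi>"
    and X: "has_lp_derivative p S X X'"
  shows "continuous_on S (\<lambda>s. \<Psi> (X s) n)"
  unfolding continuous_on_def
proof
  fix t assume t: "t \<in> S"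
  have mem: "\<And>s. s \<in> S \<Longrightarrow> X s \<in> lp p" using X by (auto simp: has_lp_derivative_def)
  have "norm (\<Psi> (X s) n - \<Psi> (X t) n) \<le> L * lp_norm p (\<lambda>n. X s n - X t n)" if s: "s \<in> S" for s
    using s t by (intro lp_le_pointwise[OF p lp_lipschitzD[OF lip lp_le_self]] lp_diff_mem p mem)
  then have "\<forall>\<^sub>F s in at t within S. norm (\<Psi> (X s) n - \<Psi> (X t) n) \<le> L * lp_norm p (\<lambda>n. X s n - X t n)"
    by (auto simp: eventually_at_filter)
  moreover have "((\<lambda>s. L * lp_norm p (\<lambda>n. X s n - X t n)) \<longlongrightarrow> 0) (at t within S)"
    by (intro tendsto_mult_right_zero lp_derivative_continuous[OF p X t])
  ultimately show "((\<lambda>s. \<Psi> (X s) n) \<longlongrightarrow> \<Psi> (X t) n) (at t within S)"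
    unfolding Lim_null[of "\<lambda>s. \<Psi> (X s) n"] by (rule Lim_null_comparison)
qed

lemma lp_flow_integral:
  fixes X :: "real \<Rightarrow> int \<Rightarrow> 'a::euclidean_space"
  assumes p: "1 \<le> p" and X: "has_lp_derivative p {0..T} X X'" and t: "t \<in> {0..T}"
  shows "((\<lambda>s. X' s n) has_integral X t n - X 0 n) {0..t}"
  using t by (intro fundamental_theorem_of_calculus)
    (auto intro: has_vector_derivative_within_subset[OF lp_derivative_component[OF p X]])

theorem lp_flow_unique:
  fixes \<Psi> :: "(int \<Rightarrow> 'a::euclidean_space) \<Rightarrow> int \<Rightarrow> 'a"
  assumes p: "1 \<le> p" and L: "0 < L" and lip: "lp_lipschitz p L \<Psi>"
    and X: "has_lp_derivative p {0..T} X (\<lambda>t. \<Psi> (X t))"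
    and Y: "has_lp_derivative p {0..T} Y (\<lambda>t. \<Psi> (Y t))"
    and eq: "X 0 = Y 0" and t: "t \<in> {0..T}"
  shows "X t = Y t"
proof -
  obtain B C where B: "\<And>t. t \<in> {0..T} \<Longrightarrow> lp_le p (X t) B" and C: "\<And>t. t \<in> {0..T} \<Longrightarrow> lp_le p (Y t) C"
    using lp_derivative_bounded[OF p X] lp_derivative_bounded[OF p Y] by blast
  have "lp_le p (\<lambda>n. X t n - Y t n) (0 * exp (2 * L * t))"
  proof (rule lp_gronwall[OF p L, where e = "\<lambda>t n. X t n - Y t n" and d = "\<lambda>_ _. 0"
        and k = "\<lambda>s n. \<Psi> (X s) n - \<Psi> (Y s) n" and B = "B + C" and T = T])
    show "X t n - Y t n = 0 + integral {0..t} (\<lambda>s. \<Psi> (X s) n - \<Psi> (Y s) n)" if t: "t \<in> {0..T}" for t n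
    proof -
      have "((\<lambda>s. \<Psi> (X s) n - \<Psi> (Y s) n) has_integral (X t n - X 0 n) - (Y t n - Y 0 n)) {0..t}"
        by (intro has_integral_diff lp_flow_integral[OF p X t] lp_flow_integral[OF p Y t])
      from integral_unique[OF this] show ?thesis using eq by simp
    qed
    show "continuous_on {0..T} (\<lambda>s. \<Psi> (X s) n - \<Psi> (Y s) n)" for n
      by (intro continuous_on_diff lp_flow_component_continuous[OF p lip X] lp_flow_component_continuous[OF p lip Y])
  qed (use p lip B C t in \<open>auto intro: lp_le_zero lp_lipschitzD lp_le_diff\<close>)
  then have "norm (X t n - Y t n) \<le> 0" for n using lp_le_pointwise[OF p] by fastforce
  then show ?thesis by (intro ext) simp
qed

section \<open>Bounds for the forces\<close>

text \<open>
The homogeneous potential is a combination of powers of the positive parts of r and of -r, which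
removes all distinctions of signs from the calculation of its first two derivatives.
\<close>

lemma pos_power_deriv:
  assumes q: "1 < q"
  shows "((\<lambda>r. (max 0 r) powr q) has_real_derivative q * (max 0 r) powr (q - 1)) (at r)"
proof -
  consider "r > 0" | "r < 0" | "r = 0" by linarith
  then show ?thesis
  proof cases
    case 1
    have "((\<lambda>r. r powr q) has_real_derivative q * (max 0 r) powr (q - 1)) (at r)"
      using 1 by (auto intro!: derivative_eq_intros)
    then show ?thesis
      by (rule has_field_derivative_transform_within_open[of _ _ _ "{0<..}"]) (use 1 in auto)
  next
    case 2
    have "((\<lambda>r. 0) has_real_derivative q * (max 0 r) powr (q - 1)) (at r)"
      using 2 by (auto intro!: derivative_eq_intros)
    then show ?thesis
      by (rule has_field_derivative_transform_within_open[of _ _ _ "{..<0}"]) (use 2 in auto)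
  next
    case 3
    have lim: "((\<lambda>h::real. \<bar>h\<bar> powr (q - 1)) \<longlongrightarrow> 0) (at 0)"
      by (rule tendsto_zero_powrI[where b = "q - 1"]) (use q in \<open>auto intro!: tendsto_eq_intros\<close>)
    have le: "norm (max 0 h powr q / h) \<le> \<bar>h\<bar> powr (q - 1)" for h :: real
    proof (cases "h > 0")
      case True
      then show ?thesis by (simp add: powr_diff max_def)
    next
      case False
      then have "max 0 h = 0" by simp
      then show ?thesis by simp
    qed
    have "((\<lambda>h. max 0 h powr q / h) \<longlongrightarrow> 0) (at 0)"
      by (rule Lim_null_comparison[OF always_eventually lim]) (use le in blast)
    then show ?thesis using q by (simp add: 3 DERIV_def)
  qed
qed

lemma pos_power_continuous:
  fixes q :: real and f :: "'a::topological_space \<Rightarrow> real"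
  assumes q: "0 < q" and f: "continuous_on S f"
  shows "continuous_on S (\<lambda>x. (max 0 (f x)) powr q)"
proof (rule continuous_on_powr')
  show "continuous_on S (\<lambda>x. max 0 (f x))"
    by (rule continuous_on_max[OF continuous_on_const f])
  show "continuous_on S (\<lambda>x. q)" by (rule continuous_on_const)
  show "\<forall>x\<in>S. 0 \<le> max 0 (f x) \<and> (max 0 (f x) = 0 \<longrightarrow> 0 < q)" using q by simp
qed

text \<open>
The derivative of \<open>V_hom\<close>.
\<close>

definition hom_force :: "real \<Rightarrow> real \<Rightarrow> real \<Rightarrow> real \<Rightarrow> real" where
  "hom_force \<alpha> km kp r = kp * (max 0 r) powr \<alpha> - km * (max 0 (- r)) powr \<alpha>"

lemma V_hom_deriv:
  assumes "1 < \<alpha>"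
  shows "(V_hom \<alpha> km kp has_real_derivative hom_force \<alpha> km kp r) (at r)"
proof -
  have e: "V_hom \<alpha> km kp = (\<lambda>r. kp / (1 + \<alpha>) * (max 0 r) powr (\<alpha> + 1) + km / (1 + \<alpha>) * (max 0 (- r)) powr (\<alpha> + 1))"
    by (rule ext) (auto simp: V_hom_def max_def abs_if)
  have "((\<lambda>r. (max 0 (- r)) powr (\<alpha> + 1)) has_real_derivative ((\<alpha> + 1) * (max 0 (- r)) powr (\<alpha> + 1 - 1)) * (- 1)) (at r)"
    by (rule DERIV_chain2[OF pos_power_deriv]) (use assms in \<open>auto intro!: derivative_eq_intros\<close>)
  then have "(V_hom \<alpha> km kp has_real_derivative
      kp / (1 + \<alpha>) * ((\<alpha> + 1) * (max 0 r) powr (\<alpha> + 1 - 1))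
      + km / (1 + \<alpha>) * (((\<alpha> + 1) * (max 0 (- r)) powr (\<alpha> + 1 - 1)) * (- 1))) (at r)"
    unfolding e using assms by (intro DERIV_add DERIV_cmult pos_power_deriv) auto
  moreover have "x / (1 + \<alpha>) * ((\<alpha> + 1) * y) = x * y" for x y
    using assms by (simp add: field_simps)
  ultimately show ?thesis by (simp add: hom_force_def)
qed

lemma hom_force_deriv:
  assumes "1 < \<alpha>"
  shows "(hom_force \<alpha> km kp has_real_derivative
    \<alpha> * (kp * (max 0 r) powr (\<alpha> - 1) + km * (max 0 (- r)) powr (\<alpha> - 1))) (at r)"
proof -
  have e: "hom_force \<alpha> km kp = (\<lambda>r. kp * (max 0 r) powr \<alpha> - km * (max 0 (- r)) powr \<alpha>)"
    by (rule ext) (simp add: hom_force_def)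
  have "((\<lambda>r. (max 0 (- r)) powr \<alpha>) has_real_derivative (\<alpha> * (max 0 (- r)) powr (\<alpha> - 1)) * (- 1)) (at r)"
    by (rule DERIV_chain2[OF pos_power_deriv]) (use assms in \<open>auto intro!: derivative_eq_intros\<close>)
  then have "(hom_force \<alpha> km kp has_real_derivative
      kp * (\<alpha> * (max 0 r) powr (\<alpha> - 1)) - km * ((\<alpha> * (max 0 (- r)) powr (\<alpha> - 1)) * (- 1))) (at r)"
    unfolding e by (intro DERIV_diff DERIV_cmult pos_power_deriv assms)
  then show ?thesis by (simp add: algebra_simps)
qed

lemma hom_force_continuous: "1 < \<alpha> \<Longrightarrow> continuous_on S f \<Longrightarrow> continuous_on S (\<lambda>x. hom_force \<alpha> km kp (f x))"
  unfolding hom_force_def by (intro continuous_intros pos_power_continuous) auto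

lemma hom_force_scale: "0 \<le> c \<Longrightarrow> hom_force \<alpha> km kp (c * r) = c powr \<alpha> * hom_force \<alpha> km kp r"
proof -
  assume c: "0 \<le> c"
  have "max 0 (c * r) = c * max 0 r" "max 0 (- (c * r)) = c * max 0 (- r)" for r
    using c by (auto simp: max_def mult_le_0_iff zero_le_mult_iff)
  then have "hom_force \<alpha> km kp (c * r) = kp * (c * max 0 r) powr \<alpha> - km * (c * max 0 (- r)) powr \<alpha>"
    by (simp only: hom_force_def)
  then show ?thesis using c by (simp add: hom_force_def powr_mult right_diff_distrib)
qed

lemma hom_force_0 [simp]: "hom_force \<alpha> km kp 0 = 0"
  by (simp add: hom_force_def)

lemma lipschitz_of_power_bounded_derivative:
  fixes f f' :: "real \<Rightarrow> real"
  assumes d: "\<And>r. (f has_real_derivative f' r) (at r)"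
    and b: "\<And>r. \<bar>r\<bar> \<le> R \<Longrightarrow> \<bar>f' r\<bar> \<le> C * \<bar>r\<bar> powr s"
    and C: "0 \<le> C" and s: "0 \<le> s" and r: "\<bar>r\<bar> \<le> R" "\<bar>r'\<bar> \<le> R"
  shows "\<bar>f r - f r'\<bar> \<le> C * R powr s * \<bar>r - r'\<bar>"
proof -
  have "norm (f r - f r') \<le> C * R powr s * norm (r - r')"
  proof (rule field_differentiable_bound[of "{-R..R}"])
    show "(f has_field_derivative f' z) (at z within {-R..R})" for z
      using d has_field_derivative_at_within by blast
    show "norm (f' z) \<le> C * R powr s" if "z \<in> {-R..R}" for z
    proof -
      have "\<bar>f' z\<bar> \<le> C * \<bar>z\<bar> powr s" using b that by auto
      also have "\<dots> \<le> C * R powr s" using that C s by (intro mult_left_mono powr_mono2) auto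
      finally show ?thesis by simp
    qed
  qed (use r in auto)
  then show ?thesis by simp
qed

text \<open>
The Landau symbol ignores the point 0, but the mean value theorem on an interval around 0 needs the
bound there too; continuity supplies it.
\<close>

lemma bigo_powr_bound_near_0:
  fixes f :: "real \<Rightarrow> real"
  assumes f: "f \<in> O[at 0](\<lambda>r. \<bar>r\<bar> powr s)" and s: "0 < s" and c: "isCont f 0"
  shows "\<exists>C\<ge>0. \<exists>\<delta>>0. \<forall>r. \<bar>r\<bar> \<le> \<delta> \<longrightarrow> \<bar>f r\<bar> \<le> C * \<bar>r\<bar> powr s"
proof -
  from landau_o.bigE[OF f] obtain C where C: "C > 0" "\<forall>\<^sub>F r in at 0. norm (f r) \<le> C * norm (\<bar>r\<bar> powr s)" by auto
  then obtain d where d: "d > 0" "\<And>r. r \<noteq> 0 \<Longrightarrow> \<bar>r\<bar> < d \<Longrightarrow> \<bar>f r\<bar> \<le> C * \<bar>r\<bar> powr s"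
    unfolding eventually_at by (auto simp: dist_real_def)
  have "((\<lambda>r. C * \<bar>r\<bar> powr s) \<longlongrightarrow> 0) (at 0)"
    by (intro tendsto_mult_right_zero tendsto_zero_powrI[where b = s]) (use s in \<open>auto intro!: tendsto_eq_intros\<close>)
  with C(2) have "(f \<longlongrightarrow> 0) (at 0)" by (intro Lim_null_comparison[of f]) (auto simp: eventually_mono)
  with c have "f 0 = 0" by (meson LIM_unique isCont_def)
  with d have "\<bar>f r\<bar> \<le> C * \<bar>r\<bar> powr s" if "\<bar>r\<bar> \<le> d / 2" for r
    using that d(1) by (cases "r = 0") auto
  then show ?thesis using C(1) d(1) by (intro exI[of _ C] exI[of _ "d/2"] conjI) auto
qed

lemma C2_derivs:
  assumes "C2 f"
  shows "(f has_real_derivative deriv f r) (at r)" "(deriv f has_real_derivative deriv (deriv f) r) (at r)"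
    "isCont (deriv (deriv f)) r"
  using assms by (auto simp: C2_def field_differentiable_derivI continuous_on_eq_continuous_at)

text \<open>
Serves the proof of uniqueness, where R is the size of two given solutions and not a small number.
\<close>

lemma C2_locally_lipschitz:
  assumes "C2 f"
  shows "\<exists>L\<ge>0. \<forall>r r'. \<bar>r\<bar> \<le> R \<longrightarrow> \<bar>r'\<bar> \<le> R \<longrightarrow> \<bar>deriv f r - deriv f r'\<bar> \<le> L * \<bar>r - r'\<bar>"
proof -
  have "compact (deriv (deriv f) ` {-R..R})"
    using C2_derivs(3)[OF assms] by (intro compact_continuous_image continuous_at_imp_continuous_on) auto
  then obtain B where B: "\<forall>x\<in>deriv (deriv f) ` {-R..R}. norm x \<le> B"
    using compact_imp_bounded bounded_iff by blast
  have "\<bar>deriv f r - deriv f r'\<bar> \<le> \<bar>B\<bar> * \<bar>r - r'\<bar>" if "\<bar>r\<bar> \<le> R" "\<bar>r'\<bar> \<le> R" for r r'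
  proof -
    have "norm (deriv f r - deriv f r') \<le> \<bar>B\<bar> * norm (r - r')"
    proof (rule field_differentiable_bound[of "{-R..R}"])
      show "(deriv f has_field_derivative deriv (deriv f) z) (at z within {-R..R})" for z
        using C2_derivs(2)[OF assms] has_field_derivative_at_within by blast
      show "norm (deriv (deriv f) z) \<le> \<bar>B\<bar>" if "z \<in> {-R..R}" for z using B that by force
    qed (use that in auto)
    then show ?thesis by simp
  qed
  then show ?thesis by (intro exI[of _ "\<bar>B\<bar>"]) auto
qed

text \<open>
The size of the forces for small states. The Lipschitz constants on [-R, R] come
from the bounds on second derivatives near 0 and the mean value theorem. For the derivative of V
the contribution of W is absorbed into that of the homogeneous part since \<open>R \<le> 1\<close>.
\<close>

lemma lattice_force_bounds:
  fixes \<alpha> km kp \<beta> \<gamma> :: real and V W \<phi> :: "real \<Rightarrow> real"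
  assumes \<alpha>: "\<alpha> > 1" and \<beta>: "\<beta> > 0" and \<gamma>: "\<gamma> > 0"
    and V: "C2 V" and VW: "\<And>r. V r = V_hom \<alpha> km kp r + W r"
    and W0: "deriv W 0 = 0" and W: "deriv (deriv W) \<in> O[at 0](\<lambda>r. \<bar>r\<bar> powr (\<alpha> - 1 + \<beta>))"
    and \<phi>: "C2 \<phi>" and \<phi>2: "deriv (deriv \<phi>) \<in> O[at 0](\<lambda>x. \<bar>x\<bar> powr (\<alpha> - 1 + \<gamma>))"
  obtains K r0 where "K > 0" "0 < r0" "r0 \<le> 1"
    "\<And>R r r'. R \<le> r0 \<Longrightarrow> \<bar>r\<bar> \<le> R \<Longrightarrow> \<bar>r'\<bar> \<le> R \<Longrightarrow> \<bar>deriv V r - deriv V r'\<bar> \<le> K * R powr (\<alpha> - 1) * \<bar>r - r'\<bar>"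
    "\<And>R r r'. R \<le> r0 \<Longrightarrow> \<bar>r\<bar> \<le> R \<Longrightarrow> \<bar>r'\<bar> \<le> R \<Longrightarrow> \<bar>deriv \<phi> r - deriv \<phi> r'\<bar> \<le> K * R powr (\<alpha> - 1 + \<gamma>) * \<bar>r - r'\<bar>"
    "\<And>R r. R \<le> r0 \<Longrightarrow> \<bar>r\<bar> \<le> R \<Longrightarrow> \<bar>deriv V r - hom_force \<alpha> km kp r\<bar> \<le> K * R powr (\<alpha> - 1 + \<beta>) * \<bar>r\<bar>"
    "\<And>R r r'. \<bar>r\<bar> \<le> R \<Longrightarrow> \<bar>r'\<bar> \<le> R \<Longrightarrow> \<bar>hom_force \<alpha> km kp r - hom_force \<alpha> km kp r'\<bar> \<le> K * R powr (\<alpha> - 1) * \<bar>r - r'\<bar>"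
    "deriv V 0 = 0"
proof -
  let ?h = "hom_force \<alpha> km kp"
  let ?h' = "\<lambda>r. \<alpha> * (kp * (max 0 r) powr (\<alpha> - 1) + km * (max 0 (- r)) powr (\<alpha> - 1))"
  have Weq: "W = (\<lambda>r. V r - V_hom \<alpha> km kp r)" using VW by auto
  have dW: "(W has_real_derivative deriv V r - ?h r) (at r)" for r
    unfolding Weq by (intro DERIV_diff C2_derivs[OF V] V_hom_deriv \<alpha>)
  then have dW': "deriv W = (\<lambda>r. deriv V r - ?h r)" using DERIV_imp_deriv by blast
  have ddW: "(deriv W has_real_derivative deriv (deriv V) r - ?h' r) (at r)" for r
    unfolding dW' by (intro DERIV_diff C2_derivs[OF V] hom_force_deriv \<alpha>)
  then have ddW': "deriv (deriv W) = (\<lambda>r. deriv (deriv V) r - ?h' r)" using DERIV_imp_deriv by blast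
  have "continuous_on UNIV ?h'" using \<alpha> by (intro continuous_intros pos_power_continuous) auto
  then have h'_cont: "isCont ?h' 0" 
    unfolding continuous_on_eq_continuous_at[OF open_UNIV] by (rule bspec) (rule UNIV_I)
  have "isCont (deriv (deriv W)) 0"
    unfolding ddW' by (rule continuous_diff[OF C2_derivs(3)[OF V] h'_cont])
  then obtain Cw dw where Cw: "Cw \<ge> 0" "dw > 0" "\<And>r. \<bar>r\<bar> \<le> dw \<Longrightarrow> \<bar>deriv (deriv W) r\<bar> \<le> Cw * \<bar>r\<bar> powr (\<alpha> - 1 + \<beta>)"
    using bigo_powr_bound_near_0[OF W] \<alpha> \<beta> by auto
  obtain Cf df where Cf: "Cf \<ge> 0" "df > 0" "\<And>r. \<bar>r\<bar> \<le> df \<Longrightarrow> \<bar>deriv (deriv \<phi>) r\<bar> \<le> Cf * \<bar>r\<bar> powr (\<alpha> - 1 + \<gamma>)"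
    using bigo_powr_bound_near_0[OF \<phi>2 _ C2_derivs(3)[OF \<phi>]] \<alpha> \<gamma> by auto
  define Ch where "Ch = \<alpha> * (\<bar>kp\<bar> + \<bar>km\<bar>)"
  have Ch0: "Ch \<ge> 0" using \<alpha> by (simp add: Ch_def)
  have Ch: "\<bar>?h' r\<bar> \<le> Ch * \<bar>r\<bar> powr (\<alpha> - 1)" for r
    using \<alpha> by (auto simp: Ch_def max_def abs_mult algebra_simps)
  define r0 where "r0 = Min {1, dw, df}"
  define K where "K = 1 + Cw + Cf + Ch"
  have r0: "0 < r0" "r0 \<le> 1" "r0 \<le> dw" "r0 \<le> df" using Cw Cf by (auto simp: r0_def)
  have K: "K > 0" "Cf \<le> K" "Cw \<le> K" "Ch \<le> K" "Cw + Ch \<le> K" using Cw Cf Ch0 by (auto simp: K_def)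
  have H: "\<bar>?h r - ?h r'\<bar> \<le> Ch * R powr (\<alpha> - 1) * \<bar>r - r'\<bar>" if "\<bar>r\<bar> \<le> R" "\<bar>r'\<bar> \<le> R" for R r r'
    by (rule lipschitz_of_power_bounded_derivative[OF hom_force_deriv[OF \<alpha>]]) (use that \<alpha> Ch Ch0 in auto)
  have Wb: "\<bar>deriv W r - deriv W r'\<bar> \<le> Cw * R powr (\<alpha> - 1 + \<beta>) * \<bar>r - r'\<bar>" if "R \<le> r0" "\<bar>r\<bar> \<le> R" "\<bar>r'\<bar> \<le> R" for R r r'
    by (rule lipschitz_of_power_bounded_derivative[OF ddW]) (use that \<alpha> \<beta> Cw(1) r0 Cw(3)[unfolded ddW'] in auto)
  have Fb: "\<bar>deriv \<phi> r - deriv \<phi> r'\<bar> \<le> Cf * R powr (\<alpha> - 1 + \<gamma>) * \<bar>r - r'\<bar>" if "R \<le> r0" "\<bar>r\<bar> \<le> R" "\<bar>r'\<bar> \<le> R" for R r r'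
    by (rule lipschitz_of_power_bounded_derivative[OF C2_derivs(2)[OF \<phi>]]) (use that \<alpha> \<gamma> Cf r0 in auto)
  have up: "C * x * y \<le> K * x * y" if "C \<le> K" "0 \<le> x" "0 \<le> y" for C x y
    using that by (intro mult_right_mono) auto
  show ?thesis
  proof
    show "K > 0" "0 < r0" "r0 \<le> 1" using K r0 by auto
    show "\<bar>deriv \<phi> r - deriv \<phi> r'\<bar> \<le> K * R powr (\<alpha> - 1 + \<gamma>) * \<bar>r - r'\<bar>" if "R \<le> r0" "\<bar>r\<bar> \<le> R" "\<bar>r'\<bar> \<le> R" for R r r'
      using Fb[OF that] up[OF K(2)] by (meson order_trans powr_ge_zero abs_ge_zero)
    show "\<bar>?h r - ?h r'\<bar> \<le> K * R powr (\<alpha> - 1) * \<bar>r - r'\<bar>" if "\<bar>r\<bar> \<le> R" "\<bar>r'\<bar> \<le> R" for R r r'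
      using H[OF that] up[OF K(4)] by (meson order_trans powr_ge_zero abs_ge_zero)
    show "\<bar>deriv V r - ?h r\<bar> \<le> K * R powr (\<alpha> - 1 + \<beta>) * \<bar>r\<bar>" if "R \<le> r0" "\<bar>r\<bar> \<le> R" for R r
    proof -
      have "\<bar>deriv W r - deriv W 0\<bar> \<le> Cw * R powr (\<alpha> - 1 + \<beta>) * \<bar>r - 0\<bar>"
        using that by (intro Wb) auto
      also have "\<dots> \<le> K * R powr (\<alpha> - 1 + \<beta>) * \<bar>r - 0\<bar>" by (rule up[OF K(3)]) auto
      finally show ?thesis using W0 by (simp add: dW')
    qed
    show "\<bar>deriv V r - deriv V r'\<bar> \<le> K * R powr (\<alpha> - 1) * \<bar>r - r'\<bar>" if R: "R \<le> r0" "\<bar>r\<bar> \<le> R" "\<bar>r'\<bar> \<le> R" for R r r'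
    proof -
      have "R powr (\<alpha> - 1 + \<beta>) \<le> R powr (\<alpha> - 1)"
        using R r0 \<beta> by (intro powr_mono') auto
      then have "Cw * R powr (\<alpha> - 1 + \<beta>) * \<bar>r - r'\<bar> \<le> Cw * R powr (\<alpha> - 1) * \<bar>r - r'\<bar>"
        using Cw by (intro mult_right_mono mult_left_mono) auto
      then have "\<bar>deriv W r - deriv W r'\<bar> + \<bar>?h r - ?h r'\<bar> \<le> (Cw + Ch) * R powr (\<alpha> - 1) * \<bar>r - r'\<bar>"
        using Wb[OF R] H[OF R(2,3)] by (simp add: algebra_simps)
      also have "\<dots> \<le> K * R powr (\<alpha> - 1) * \<bar>r - r'\<bar>" by (rule up[OF K(5)]) auto
      finally have le: "\<bar>deriv W r - deriv W r'\<bar> + \<bar>?h r - ?h r'\<bar> \<le> K * R powr (\<alpha> - 1) * \<bar>r - r'\<bar>" .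
      have "deriv V r - deriv V r' = (deriv W r - deriv W r') + (?h r - ?h r')" by (simp add: dW')
      then show ?thesis using abs_triangle_ineq le order_trans by metis
    qed
    show "deriv V 0 = 0" using W0 by (simp add: dW')
  qed
qed

section \<open>The mean of the homogeneous force\<close>

lemma integral_period:
  fixes g :: "real \<Rightarrow> 'a::euclidean_space"
  assumes P: "0 < P" and g: "continuous_on UNIV g" and per: "\<And>s. g (s + P) = g s"
  shows "integral {a..a + P} g = integral {0..P} g"
proof -
  have *: "integral {a..a + P} h = integral {0..P} h"
    if a: "0 \<le> a" and h: "continuous_on UNIV h" "\<And>s. h (s + P) = h s" for a and h :: "real \<Rightarrow> 'a"
  proof -
    have i: "h integrable_on {x..y}" for x y
      by (intro integrable_continuous_real continuous_on_subset[OF h(1)]) auto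
    note comb = Henstock_Kurzweil_Integration.integral_combine[where f = h and a = 0 and b = "a + P", OF _ _ i]
    have "integral {0..a} h = integral {0..a} (h \<circ> (\<lambda>s. s + P))" using h(2) by (simp add: o_def)
    also have "\<dots> = integral {0 + P..a + P} h"
      by (rule integral_shift) (rule continuous_on_subset[OF h(1)], simp)
    finally have "integral {0..a} h = integral {P..a + P} h" by simp
    moreover have "integral {0..a} h + integral {a..a + P} h = integral {0..P} h + integral {P..a + P} h"
      using comb[of a] comb[of P] a P by simp
    ultimately show ?thesis by (metis add.commute add_left_imp_eq)
  qed
  show ?thesis
  proof (cases "0 \<le> a")
    case True
    then show ?thesis by (rule *[OF _ g per])
  next
    case False
    let ?h = "g \<circ> (\<lambda>s. s + a)"
    have shift: "integral {x..y} ?h = integral {x + a..y + a} g" for x y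
      by (rule integral_shift) (rule continuous_on_subset[OF g], simp)
    have "integral {- a..- a + P} ?h = integral {0..P} ?h"
      using False per[of "_ + a"]
      by (intro *) (auto intro!: continuous_on_compose2[OF g] continuous_intros simp: o_def algebra_simps)
    then show ?thesis unfolding shift by (simp add: add.commute)
  qed
qed

lemma Gamma_legendre_duplication_real:
  fixes a :: real
  assumes a: "0 < a"
  shows "Gamma a * Gamma (a + 1/2) = 2 powr (1 - 2 * a) * sqrt pi * Gamma (2 * a)"
proof -
  have "complex_of_real a \<notin> \<int>\<^sub>\<le>\<^sub>0" "complex_of_real a + 1/2 \<notin> \<int>\<^sub>\<le>\<^sub>0"
    using a by (auto elim!: nonpos_Ints_cases simp: complex_eq_iff)
  from Gamma_legendre_duplication[OF this]
  have "Gamma (complex_of_real a) * Gamma (complex_of_real (a + 1/2))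
      = complex_of_real (exp ((1 - 2 * a) * ln 2) * sqrt pi) * Gamma (complex_of_real (2 * a))"
    by (simp flip: exp_of_real)
  then have "complex_of_real (Gamma a * Gamma (a + 1/2)) = complex_of_real (exp ((1 - 2 * a) * ln 2) * sqrt pi * Gamma (2 * a))"
    unfolding Gamma_complex_of_real by (simp only: of_real_mult)
  then show ?thesis unfolding of_real_eq_iff by (simp add: powr_def)
qed

text \<open>
The substitution \<open>t = (1 + sin s) / 2\<close> turns the integral of \<open>(t * (1 - t)) powr (a - 1)\<close> for
\<open>a = (m + 1) / 2\<close>, which is \<open>Beta a a\<close>, into that of \<open>cos s powr m\<close>. This symmetric form of the Beta
integral has a continuous integrand because a > 1. The duplication formula then simplifies
\<open>Gamma a ^ 2 / Gamma (2 * a)\<close>.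
\<close>

lemma integral_cos_powr:
  assumes m: "1 < m"
  shows "((\<lambda>s. cos s powr m) has_integral sqrt pi * Gamma ((m + 1) / 2) / Gamma (m / 2 + 1)) {- (pi/2)..pi/2}"
proof -
  define a where "a = (m + 1) / 2"
  have a: "1 < a" using m by (simp add: a_def)
  let ?f = "\<lambda>t::real. t powr (a - 1) * (1 - t) powr (a - 1)"
  let ?g = "\<lambda>s::real. (1 + sin s) / 2"
  have cont: "continuous_on {0..1} ?f"
    using a by (intro continuous_on_mult continuous_on_powr' continuous_on_const continuous_on_id continuous_on_diff) auto
  have "((\<lambda>s. (cos s / 2) *\<^sub>R ?f (?g s)) has_integral integral {?g (- (pi/2))..?g (pi/2)} ?f) {- (pi/2)..pi/2}"
  proof (rule has_integral_substitution[OF _ _ _ cont])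
    show "?g ` {- (pi/2)..pi/2} \<subseteq> {0..1}"
    proof (rule image_subsetI)
      fix s :: real
      have "0 \<le> 1 + sin s" using sin_ge_minus_one[of s] by linarith
      then show "?g s \<in> {0..1}" by simp
    qed
    show "(?g has_field_derivative cos s / 2) (at s within {- (pi/2)..pi/2})" for s
      by (auto intro!: derivative_eq_intros)
  qed auto
  moreover have "integral {?g (- (pi/2))..?g (pi/2)} ?f = Beta a a"
    using has_integral_Beta_real[of a a] a by (simp add: integral_unique)
  moreover have "(cos s / 2) *\<^sub>R ?f (?g s) = cos s powr m * (1 / (2 * 4 powr (a - 1)))" if s: "s \<in> {- (pi/2)..pi/2}" for s
  proof -
    have c: "0 \<le> cos s" using s by (intro cos_ge_zero) auto
    have "?f (?g s) = (?g s * (1 - ?g s)) powr (a - 1)"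
      using sin_ge_minus_one[of s] sin_le_one[of s] by (subst powr_mult[symmetric]) auto
    also have "?g s * (1 - ?g s) = (cos s)\<^sup>2 / 4"
      unfolding cos_squared_eq by (simp add: power2_eq_square field_simps)
    also have "((cos s)\<^sup>2 / 4) powr (a - 1) = (cos s powr 2) powr (a - 1) / 4 powr (a - 1)"
      using c by (simp add: powr_divide)
    also have "\<dots> = cos s powr (m - 1) / 4 powr (a - 1)"
    proof -
      have "2 * (a - 1) = m - 1" by (simp add: a_def field_simps)
      then show ?thesis by (simp only: powr_powr)
    qed
    finally have "(cos s / 2) *\<^sub>R ?f (?g s) = (cos s * cos s powr (m - 1)) * (1 / (2 * 4 powr (a - 1)))" by simp
    also have "cos s * cos s powr (m - 1) = cos s powr m" using c by (cases "cos s = 0") (simp_all add: powr_diff)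
    finally show ?thesis .
  qed
  ultimately have "((\<lambda>s. cos s powr m * (1 / (2 * 4 powr (a - 1)))) has_integral Beta a a) {- (pi/2)..pi/2}"
    by (subst (asm) has_integral_cong) auto
  then have "((\<lambda>s. (2 * 4 powr (a - 1)) * (cos s powr m * (1 / (2 * 4 powr (a - 1))))) has_integral (2 * 4 powr (a - 1)) * Beta a a) {- (pi/2)..pi/2}"
    by (rule has_integral_mult_right)
  moreover have "(2 * 4 powr (a - 1)) * Beta a a = sqrt pi * Gamma a / Gamma (a + 1/2)"
  proof -
    have pos: "Gamma a > 0" "Gamma (a + 1/2) > 0" "Gamma (2 * a) > 0" using a by (auto intro: Gamma_real_pos)
    have four: "(4::real) powr (a - 1) = 2 powr (2 * a - 2)"
    proof -
      have "(4::real) powr (a - 1) = (2 powr 2) powr (a - 1)" by simp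
      also have "\<dots> = 2 powr (2 * a - 2)" unfolding powr_powr by (simp add: algebra_simps)
      finally show ?thesis .
    qed
    have "2 * 2 powr (2 * a - 2) * 2 powr (1 - 2 * a) = (1::real)"
      using powr_add[of "2::real" "2 * a - 2" "1 - 2 * a"] by simp
    then have "(2 * 4 powr (a - 1)) * (2 powr (1 - 2 * a) * sqrt pi * Gamma (2 * a)) = sqrt pi * Gamma (2 * a)"
      unfolding four by (metis mult.assoc mult.left_neutral)
    then have "(2 * 4 powr (a - 1)) * (Gamma a * Gamma (a + 1/2)) = sqrt pi * Gamma (2 * a)"
      using Gamma_legendre_duplication_real[of a] a by simp
    then have "2 * 4 powr (a - 1) = sqrt pi * Gamma (2 * a) / (Gamma a * Gamma (a + 1/2))"
      using pos by (simp add: nonzero_eq_divide_eq)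
    then show ?thesis using pos by (simp add: Beta_def)
  qed
  ultimately show ?thesis by (simp add: a_def add_divide_distrib add.commute)
qed

lemma integral_pos_cos_powr:
  assumes m: "1 < m"
  shows "integral {0..2 * pi} (\<lambda>s. (max 0 (cos s)) powr m) = sqrt pi * Gamma ((m + 1) / 2) / Gamma (m / 2 + 1)"
proof -
  let ?g = "\<lambda>s::real. (max 0 (cos s)) powr m"
  have cont: "continuous_on S ?g" for S
    using m by (intro pos_power_continuous continuous_on_cos continuous_on_id) auto
  have i: "?g integrable_on {x..y}" for x y by (intro integrable_continuous_real cont)
  have "integral {0..2 * pi} ?g = integral {- (pi/2)..- (pi/2) + 2 * pi} ?g"
    by (rule integral_period[symmetric]) (auto intro: cont)
  also have "\<dots> = integral {- (pi/2)..pi/2} ?g + integral {pi/2..- (pi/2) + 2 * pi} ?g"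
    by (rule Henstock_Kurzweil_Integration.integral_combine[symmetric]) (auto intro: i)
  also have "integral {- (pi/2)..pi/2} ?g = integral {- (pi/2)..pi/2} (\<lambda>s. cos s powr m)"
    by (intro integral_cong) (auto simp: max_def cos_ge_zero)
  also have "integral {pi/2..- (pi/2) + 2 * pi} ?g = integral {pi/2..- (pi/2) + 2 * pi} (\<lambda>_. 0)"
  proof (intro integral_cong)
    fix s assume s: "s \<in> {pi/2..- (pi/2) + 2 * pi}"
    have "cos (s - pi) \<ge> 0" using s by (intro cos_ge_zero) auto
    then show "?g s = 0" by (simp add: max_def)
  qed
  finally show ?thesis using integral_unique[OF integral_cos_powr[OF m]] by simp
qed

text \<open>
The factor of \<open>cmod z powr (\<alpha> - 1) * z\<close> in the mean of the homogeneous force over one period.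
\<close>

definition mean_coeff :: "real \<Rightarrow> real \<Rightarrow> real \<Rightarrow> real" where
  "mean_coeff \<alpha> km kp = (km + kp) * (sqrt pi * Gamma (\<alpha> / 2 + 1) / Gamma ((\<alpha> + 1) / 2 + 1)) / (2 * pi)"

text \<open>
In the real part, the positive and the negative half waves of the cosine give the same integral,
with the factors \<open>kp\<close> and \<open>km\<close>. The imaginary part vanishes because its integrand is the derivative
of the periodic function \<open>V_hom \<alpha> km kp (cos s)\<close>.
\<close>

lemma integral_hom_force_cos:
  assumes \<alpha>: "1 < \<alpha>"
  shows "((\<lambda>s. cis (- s) * complex_of_real (hom_force \<alpha> km kp (cos s)))
     has_integral complex_of_real (2 * pi * mean_coeff \<alpha> km kp)) {0..2 * pi}"
proof -
  let ?h = "hom_force \<alpha> km kp"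
  let ?I = "sqrt pi * Gamma (\<alpha> / 2 + 1) / Gamma ((\<alpha> + 1) / 2 + 1)"
  let ?g = "\<lambda>s::real. (max 0 (cos s)) powr (\<alpha> + 1)"
  have cont: "continuous_on S ?g" for S
    using \<alpha> by (intro pos_power_continuous continuous_on_cos continuous_on_id) auto
  have I: "integral {0..2 * pi} ?g = ?I"
    using integral_pos_cos_powr[of "\<alpha> + 1"] \<alpha> by (simp add: add_divide_distrib add.commute)
  have i1: "(?g has_integral ?I) {0..2 * pi}"
    using I cont by (metis integrable_continuous_real integrable_integral)
  have "integral {0..2 * pi} (?g \<circ> (\<lambda>s. s + pi)) = integral {0 + pi..2 * pi + pi} ?g"
    by (rule integral_shift) (rule cont)
  also have "\<dots> = integral {pi..pi + 2 * pi} ?g" by (simp add: add.commute)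
  also have "\<dots> = integral {0..2 * pi} ?g" by (rule integral_period) (auto intro: cont)
  finally have I2: "integral {0..2 * pi} (\<lambda>s. (max 0 (- cos s)) powr (\<alpha> + 1)) = ?I"
    using I by (simp add: o_def)
  have cont2: "continuous_on S (\<lambda>s. (max 0 (- cos s)) powr (\<alpha> + 1))" for S
    using \<alpha> by (intro pos_power_continuous continuous_on_minus continuous_on_cos continuous_on_id) auto
  have i2: "((\<lambda>s. (max 0 (- cos s)) powr (\<alpha> + 1)) has_integral ?I) {0..2 * pi}"
    using I2 cont2 by (metis integrable_continuous_real integrable_integral)
  have pw: "c * (kp * (max 0 c) powr \<alpha> - km * (max 0 (- c)) powr \<alpha>) = kp * (max 0 c) powr (\<alpha> + 1) + km * (max 0 (- c)) powr (\<alpha> + 1)" for c :: real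
    using \<alpha> by (auto simp: max_def powr_add not_le)
  have re: "((\<lambda>s. cos s * ?h (cos s)) has_integral kp * ?I + km * ?I) {0..2 * pi}"
    unfolding hom_force_def pw by (intro has_integral_add has_integral_mult_right i1 i2)
  have im: "((\<lambda>s. - sin s * ?h (cos s)) has_integral V_hom \<alpha> km kp (cos (2 * pi)) - V_hom \<alpha> km kp (cos 0)) {0..2 * pi}"
  proof (rule fundamental_theorem_of_calculus)
    show "((\<lambda>s. V_hom \<alpha> km kp (cos s)) has_vector_derivative - sin s * ?h (cos s)) (at s within {0..2 * pi})" for s
    proof -
      have "((\<lambda>s. V_hom \<alpha> km kp (cos s)) has_real_derivative ?h (cos s) * (- sin s)) (at s)"
        by (rule DERIV_chain2[OF V_hom_deriv[OF \<alpha>]]) (auto intro!: derivative_eq_intros)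
      then show ?thesis
        by (simp add: has_real_derivative_iff_has_vector_derivative mult.commute has_vector_derivative_at_within)
    qed
  qed simp
  have sum: "((\<lambda>s. complex_of_real (cos s * ?h (cos s)) + \<i> * complex_of_real (- sin s * ?h (cos s)))
      has_integral (complex_of_real (kp * ?I + km * ?I) + \<i> * complex_of_real 0)) {0..2 * pi}"
    using im by (intro has_integral_add has_integral_mult_right has_integral_of_real re) simp
  have split: "complex_of_real (cos s * ?h (cos s)) + \<i> * complex_of_real (- sin s * ?h (cos s))
      = cis (- s) * complex_of_real (?h (cos s))" for s
    by (simp add: complex_eq_iff)
  have total: "kp * ?I + km * ?I = 2 * pi * mean_coeff \<alpha> km kp"
    by (simp add: mean_coeff_def algebra_simps add_divide_distrib)
  show ?thesis
    using sum by (simp only: split total of_real_0 mult_zero_right add_0_right)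
qed

text \<open>
For z with argument \<open>\<theta>\<close>, \<open>Re (cis s * z)\<close> is \<open>cmod z * cos (s + \<theta>)\<close>. By homogeneity the modulus
factors out, and by periodicity the shift of s by \<open>\<theta>\<close> only leaves the factor \<open>cis \<theta>\<close>.
\<close>

lemma mean_hom_force:
  assumes \<alpha>: "1 < \<alpha>"
  shows "integral {0..2 * pi} (\<lambda>s. cis (- s) * complex_of_real (hom_force \<alpha> km kp (Re (cis s * z))))
     = complex_of_real (2 * pi * mean_coeff \<alpha> km kp * cmod z powr (\<alpha> - 1)) * z"
proof -
  let ?h = "hom_force \<alpha> km kp"
  define \<theta> where "\<theta> = Arg z"
  have z: "z = complex_of_real (cmod z) * cis \<theta>"
    by (metis \<theta>_def Arg_def rcis_cmod_Arg rcis_def)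
  let ?g = "\<lambda>s. cis (- s) * complex_of_real (?h (cos s))"
  have cont: "continuous_on S ?g" for S
    by (intro continuous_intros hom_force_continuous \<alpha>)
  have "cis (- s) * complex_of_real (?h (Re (cis s * z)))
      = (complex_of_real (cmod z powr \<alpha>) * cis \<theta>) * ?g (s + \<theta>)" for s
  proof -
    have "Re (cis s * z) = cmod z * cos (s + \<theta>)" by (subst z) (simp add: cos_add algebra_simps)
    moreover have "cis (- s) = cis \<theta> * cis (- (s + \<theta>))" by (simp add: cis_mult)
    ultimately show ?thesis by (simp add: hom_force_scale)
  qed
  then have "integral {0..2 * pi} (\<lambda>s. cis (- s) * complex_of_real (?h (Re (cis s * z))))
      = (complex_of_real (cmod z powr \<alpha>) * cis \<theta>) * integral {0..2 * pi} (?g \<circ> (\<lambda>s. s + \<theta>))"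
    by (simp add: o_def)
  also have "integral {0..2 * pi} (?g \<circ> (\<lambda>s. s + \<theta>)) = integral {0 + \<theta>..2 * pi + \<theta>} ?g"
    by (rule integral_shift) (rule cont)
  also have "\<dots> = integral {\<theta>..\<theta> + 2 * pi} ?g" by (simp add: add.commute)
  also have "\<dots> = integral {0..2 * pi} ?g"
  proof (rule integral_period)
    show "?g (s + 2 * pi) = ?g s" for s
    proof -
      have "cis (s + 2 * pi) = cis s" by (simp add: complex_eq_iff)
      then have "cis (- (s + 2 * pi)) = cis (- s)" by (metis cis_inverse)
      then show ?thesis by simp
    qed
  qed (auto intro: cont)
  also have "\<dots> = complex_of_real (2 * pi * mean_coeff \<alpha> km kp)"
    by (rule integral_unique[OF integral_hom_force_cos[OF \<alpha>]])
  also have "(complex_of_real (cmod z powr \<alpha>) * cis \<theta>) * complex_of_real (2 * pi * mean_coeff \<alpha> km kp)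
      = complex_of_real (2 * pi * mean_coeff \<alpha> km kp * cmod z powr (\<alpha> - 1)) * (complex_of_real (cmod z) * cis \<theta>)"
    using powr_add[of "cmod z" "\<alpha> - 1" 1] by (cases "z = 0") (simp_all add: mult_ac)
  finally show ?thesis by (simp only: z[symmetric])
qed

text \<open>
The power of 2 compensates for the factor \<open>sqrt 2\<close> between the amplitude and the rotating
coordinate, see \<open>amp_force_scaling\<close>.
\<close>

lemma omega0_mean_coeff:
  assumes \<alpha>: "1 < \<alpha>"
  shows "omega0 \<alpha> km kp = 2 powr ((\<alpha> - 1) / 2) * mean_coeff \<alpha> km kp"
proof -
  have G1: "Gamma (\<alpha> / 2 + 1) = \<alpha> / 2 * Gamma (\<alpha> / 2)"
    using \<alpha> by (intro Gamma_plus1) (auto elim!: nonpos_Ints_cases)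
  have G2: "Gamma ((\<alpha> + 1) / 2 + 1) = (\<alpha> + 1) / 2 * Gamma ((\<alpha> + 1) / 2)"
    using \<alpha> by (intro Gamma_plus1) (auto elim!: nonpos_Ints_cases)
  have p: "(2::real) powr ((\<alpha> - 1) / 2) = 2 * 2 powr ((\<alpha> - 3) / 2)"
    using powr_add[of "2::real" 1 "(\<alpha> - 3) / 2"] by (simp add: field_simps)
  have sp: "sqrt pi / pi = 1 / sqrt pi"
    by (simp add: field_simps)
  have mean: "mean_coeff \<alpha> km kp = (km + kp) * (sqrt pi / pi) * (\<alpha> * Gamma (\<alpha> / 2) / ((\<alpha> + 1) * Gamma ((\<alpha> + 1) / 2))) / 2"
    unfolding mean_coeff_def G1 G2 using \<alpha> by (simp add: mult_ac)
  show ?thesis unfolding omega0_def p mean sp by (simp add: mult_ac)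
qed

section \<open>Averaging over fast oscillations\<close>

text \<open>
Over one full period b may be replaced by its value at the beginning of the period: the integral
then vanishes, and the error is at most \<open>\<Lambda> * (K * P)\<close> per unit of time since b moves by at most
\<open>K * P\<close>. This accounts for the first term of the bound. The second one estimates the last,
incomplete period directly.
\<close>

theorem lp_averaging:
  fixes \<psi> :: "real \<Rightarrow> 'a::euclidean_space \<Rightarrow> 'a" and b :: "real \<Rightarrow> int \<Rightarrow> 'a"
  assumes p: "1 \<le> p" and P: "0 < P" and \<Lambda>: "0 \<le> \<Lambda>" and K: "0 \<le> K"
    and cont: "continuous_on UNIV (\<lambda>(s, z). \<psi> s z)"
    and per: "\<And>s z. \<psi> (s + P) z = \<psi> s z"
    and mean: "\<And>z. integral {0..P} (\<lambda>s. \<psi> s z) = 0"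
    and zero: "\<And>s. \<psi> s 0 = 0"
    and lip: "\<And>s z z'. norm z \<le> R \<Longrightarrow> norm z' \<le> R \<Longrightarrow> norm (\<psi> s z - \<psi> s z') \<le> \<Lambda> * norm (z - z')"
    and bR: "\<And>s n. s \<in> {0..T} \<Longrightarrow> norm (b s n) \<le> R"
    and bB: "\<And>s. s \<in> {0..T} \<Longrightarrow> lp_le p (b s) B"
    and bK: "\<And>s t. s \<in> {0..T} \<Longrightarrow> t \<in> {0..T} \<Longrightarrow> lp_le p (\<lambda>n. b s n - b t n) (K * \<bar>s - t\<bar>)"
    and t: "t \<in> {0..T}"
  shows "lp_le p (\<lambda>n. integral {0..t} (\<lambda>s. \<psi> s (b s n))) (\<Lambda> * K * P * t + \<Lambda> * P * B)"
proof -
  have R: "0 \<le> R" using bR[OF t, of 0] norm_ge_zero order_trans by blast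
  have B: "0 \<le> B" using lp_le_nonneg[OF bB[OF t] p] .
  have bc: "continuous_on {0..T} (\<lambda>s. b s n)" for n
    by (rule lp_lipschitz_component_continuous[OF p K bK])
  have c1: "continuous_on {0..T} (\<lambda>s. \<psi> s (b s n))" for n
    using continuous_on_compose2[OF cont continuous_on_Pair[OF continuous_on_id bc]] by simp
  have c2: "continuous_on S (\<lambda>s. \<psi> s z)" for S z
    using continuous_on_compose2[OF cont continuous_on_Pair[OF continuous_on_id continuous_on_const]] by simp
  have i: "(\<lambda>s. \<psi> s (b s n)) integrable_on {x..y}" if "0 \<le> x" "y \<le> T" for x y n
    using that by (intro integrable_continuous_real continuous_on_subset[OF c1]) auto
  have split: "integral {0..y} (\<lambda>s. \<psi> s (b s n)) = integral {0..x} (\<lambda>s. \<psi> s (b s n)) + integral {x..y} (\<lambda>s. \<psi> s (b s n))"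
    if "0 \<le> x" "x \<le> y" "y \<le> T" for x y n
    using that by (intro Henstock_Kurzweil_Integration.integral_combine[symmetric] i) auto
  have one: "lp_le p (\<lambda>n. integral {x..x + P} (\<lambda>s. \<psi> s (b s n))) (\<Lambda> * K * P * P)"
    if x: "0 \<le> x" "x + P \<le> T" for x
  proof -
    have "lp_le p (\<lambda>n. integral {x..x + P} (\<lambda>s. \<psi> s (b s n) - \<psi> s (b x n))) ((x + P - x) * (\<Lambda> * (K * P)))"
    proof (rule lp_le_integral_const[OF p])
      show "x \<le> x + P" using P by simp
      show "continuous_on {x..x + P} (\<lambda>s. \<psi> s (b s n) - \<psi> s (b x n))" for n
        using x by (intro continuous_on_diff continuous_on_subset[OF c1] c2) auto
      show "lp_le p (\<lambda>n. \<psi> s (b s n) - \<psi> s (b x n)) (\<Lambda> * (K * P))" if s: "s \<in> {x..x + P}" for s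
      proof (rule lp_le_dominated[OF p _ \<Lambda>])
        show "lp_le p (\<lambda>n. b s n - b x n) (K * P)"
          by (rule lp_le_mono[OF bK]) (use s x P K in \<open>auto intro!: mult_left_mono\<close>)
        show "norm (\<psi> s (b s n) - \<psi> s (b x n)) \<le> \<Lambda> * norm (b s n - b x n)" for n
          using s x P by (intro lip bR) auto
      qed
    qed
    moreover have "integral {x..x + P} (\<lambda>s. \<psi> s (b s n) - \<psi> s (b x n)) = integral {x..x + P} (\<lambda>s. \<psi> s (b s n))" for n
      using x integral_period[OF P c2 per, of x "b x n"] mean
      by (subst integral_diff) (auto intro: i integrable_continuous_real c2)
    ultimately show ?thesis using P by (simp add: mult_ac)
  qed
  have many: "real k * P \<le> T \<Longrightarrow> lp_le p (\<lambda>n. integral {0..real k * P} (\<lambda>s. \<psi> s (b s n))) (\<Lambda> * K * P * (real k * P))" for k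
  proof (induction k)
    case 0
    show ?case by (simp add: lp_le_zero[OF p])
  next
    case (Suc k)
    let ?x = "real k * P"
    have x: "0 \<le> ?x" "?x + P \<le> T" using Suc.prems P by (auto simp: algebra_simps)
    have "lp_le p (\<lambda>n. integral {0..?x} (\<lambda>s. \<psi> s (b s n)) + integral {?x..?x + P} (\<lambda>s. \<psi> s (b s n))) (\<Lambda> * K * P * ?x + \<Lambda> * K * P * P)"
      using Suc x P by (intro lp_le_sum p one) auto
    also have "(\<lambda>n. integral {0..?x} (\<lambda>s. \<psi> s (b s n)) + integral {?x..?x + P} (\<lambda>s. \<psi> s (b s n)))
        = (\<lambda>n. integral {0..real (Suc k) * P} (\<lambda>s. \<psi> s (b s n)))"
      using split[of ?x "?x + P"] x P by (simp add: algebra_simps)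
    finally show ?case by (simp add: algebra_simps)
  qed
  define k where "k = nat \<lfloor>t / P\<rfloor>"
  have "real k = of_int \<lfloor>t / P\<rfloor>" using t P by (simp add: k_def)
  then have "real k \<le> t / P" "t / P < real k + 1" by linarith+
  then have kt: "real k * P \<le> t" "t \<le> real k * P + P" using P by (auto simp: field_simps)
  have kP: "0 \<le> real k * P" using P by simp
  have "lp_le p (\<lambda>n. integral {real k * P..t} (\<lambda>s. \<psi> s (b s n))) ((t - real k * P) * (\<Lambda> * B))"
  proof (rule lp_le_integral_const[OF p kt(1)])
    show "continuous_on {real k * P..t} (\<lambda>s. \<psi> s (b s n))" for n
      using t kP by (intro continuous_on_subset[OF c1]) auto
    show "lp_le p (\<lambda>n. \<psi> s (b s n)) (\<Lambda> * B)" if s: "s \<in> {real k * P..t}" for s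
    proof (rule lp_le_dominated[OF p _ \<Lambda>])
      show "lp_le p (b s) B" using s t kP by (intro bB) auto
      show "norm (\<psi> s (b s n)) \<le> \<Lambda> * norm (b s n)" for n
        using lip[of "b s n" 0 s] bR[of s n] s t kP R zero by auto
    qed
  qed
  from lp_le_sum[OF p many this]
  have "lp_le p (\<lambda>n. integral {0..t} (\<lambda>s. \<psi> s (b s n))) (\<Lambda> * K * P * (real k * P) + (t - real k * P) * (\<Lambda> * B))"
    using kt t kP split[of "real k * P" t] by simp
  moreover have "\<Lambda> * K * P * (real k * P) \<le> \<Lambda> * K * P * t" using kt \<Lambda> K P by (intro mult_left_mono) auto
  moreover have "(t - real k * P) * (\<Lambda> * B) \<le> P * (\<Lambda> * B)" using kt \<Lambda> B by (intro mult_right_mono) auto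
  ultimately show ?thesis by (elim lp_le_mono) (simp add: mult_ac)
qed

section \<open>The lattice as a Lipschitz vector field\<close>

text \<open>
The right hand side of the lattice for arbitrary forces in place of the derivatives of V and
\<open>\<phi>\<close>: it is applied to truncated forces and to the homogeneous force.
\<close>

definition chain_force :: "(real \<Rightarrow> real) \<Rightarrow> (real \<Rightarrow> real) \<Rightarrow> (int \<Rightarrow> real) \<Rightarrow> int \<Rightarrow> real" where
  "chain_force v f x n = v (x (n + 1) - x n) - v (x n - x (n - 1)) - f (x n)"

definition chain_field ::
  "(real \<Rightarrow> real) \<Rightarrow> (real \<Rightarrow> real) \<Rightarrow> (int \<Rightarrow> real \<times> real) \<Rightarrow> int \<Rightarrow> real \<times> real" where
  "chain_field v f X n = (snd (X n), - fst (X n) + chain_force v f (\<lambda>m. fst (X m)) n)"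

lemma lattice_field_eq_chain_field:
  "lattice_J X + lattice_G V \<phi> X = chain_field (deriv V) (deriv \<phi>) X"
  by (rule ext) (simp add: lattice_J_def lattice_G_def lattice_F_def chain_field_def chain_force_def
      delta_plus_def delta_minus_def)

lemma lp_le_difference:
  fixes u :: "int \<Rightarrow> 'a::real_normed_vector"
  assumes p: "1 \<le> p" and u: "lp_le p u M"
  shows "lp_le p (\<lambda>n. u (n + 1) - u n) (2 * M)" "lp_le p (\<lambda>n. u n - u (n - 1)) (2 * M)"
  using lp_le_diff[OF p lp_le_shift[OF u, of 1] u] lp_le_diff[OF p u lp_le_shift[OF u, of "-1"]] by simp_all

text \<open>
The estimate is by \<open>L1\<close> and \<open>L2\<close> alone, without the linear part of the field. It is this constant,
and not that of \<open>chain_field_lipschitz\<close>, that enters the exponential in the error estimate.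
\<close>

lemma chain_force_lipschitz:
  assumes p: "1 \<le> p" and L: "0 \<le> L1" "0 \<le> L2"
    and v: "\<And>r r'. \<bar>v r - v r'\<bar> \<le> L1 * \<bar>r - r'\<bar>" and f: "\<And>r r'. \<bar>f r - f r'\<bar> \<le> L2 * \<bar>r - r'\<bar>"
    and xy: "lp_le p (\<lambda>n. x n - y n) M"
  shows "lp_le p (\<lambda>n. chain_force v f x n - chain_force v f y n) ((4 * L1 + L2) * M)"
proof -
  let ?d = "\<lambda>n. x n - y n"
  have 1: "lp_le p (\<lambda>n. v (x (n + 1) - x n) - v (y (n + 1) - y n)) (L1 * (2 * M))"
  proof (rule lp_le_dominated[OF p lp_le_difference(1)[OF p xy] L(1)])
    show "norm (v (x (n + 1) - x n) - v (y (n + 1) - y n)) \<le> L1 * norm (x (n + 1) - y (n + 1) - (x n - y n))" for n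
      using v[of "x (n + 1) - x n" "y (n + 1) - y n"] by (simp add: algebra_simps)
  qed
  have 2: "lp_le p (\<lambda>n. v (x n - x (n - 1)) - v (y n - y (n - 1))) (L1 * (2 * M))"
    using lp_le_shift[OF 1, of "-1"] by simp
  have 3: "lp_le p (\<lambda>n. f (x n) - f (y n)) (L2 * M)"
    by (rule lp_le_dominated[OF p xy L(2)]) (use f in simp)
  have "lp_le p (\<lambda>n. chain_force v f x n - chain_force v f y n) (L1 * (2 * M) + L1 * (2 * M) + L2 * M)"
    by (rule lp_le_add[OF p lp_le_diff[OF p 1 2] 3]) (auto simp: chain_force_def)
  then show ?thesis by (simp add: algebra_simps)
qed

lemma chain_field_lipschitz:
  assumes p: "1 \<le> p" and L: "0 \<le> L1" "0 \<le> L2"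
    and v: "\<And>r r'. \<bar>v r - v r'\<bar> \<le> L1 * \<bar>r - r'\<bar>" and f: "\<And>r r'. \<bar>f r - f r'\<bar> \<le> L2 * \<bar>r - r'\<bar>"
  shows "lp_lipschitz p (1 + 4 * L1 + L2) (chain_field v f)"
  unfolding lp_lipschitz_def
proof (intro allI impI)
  fix X Y :: "int \<Rightarrow> real \<times> real" and M
  assume XY: "lp_le p (\<lambda>n. X n - Y n) M"
  have x: "lp_le p (\<lambda>n. fst (X n) - fst (Y n)) M"
    by (rule lp_le_cong[OF XY p]) (metis fst_diff norm_fst_le prod.collapse)
  have "lp_le p (\<lambda>n. chain_field v f X n - chain_field v f Y n) (M + (4 * L1 + L2) * M)"
  proof (rule lp_le_add[OF p XY chain_force_lipschitz[OF p L v f x]])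
    fix n
    let ?F = "chain_force v f (\<lambda>m. fst (X m)) n - chain_force v f (\<lambda>m. fst (Y m)) n"
    have "chain_field v f X n - chain_field v f Y n
        = (snd (X n - Y n), - fst (X n - Y n)) + (0, ?F)"
      by (simp add: chain_field_def)
    moreover have "norm (snd (X n - Y n), - fst (X n - Y n)) = norm (X n - Y n)"
      by (simp add: norm_prod_def add.commute power2_commute[of "fst (Y n)"])
    moreover have "norm (0::real, ?F) = norm ?F" by (simp add: norm_prod_def)
    ultimately show "norm (chain_field v f X n - chain_field v f Y n) \<le> norm (X n - Y n) + norm ?F"
      by (metis norm_triangle_ineq)
  qed
  then show "lp_le p (\<lambda>n. chain_field v f X n - chain_field v f Y n) ((1 + 4 * L1 + L2) * M)"
    by (simp add: algebra_simps)
qed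

section \<open>The rotating frame\<close>

text \<open>
The sign makes \<open>phase\<close> conjugate the linear part of the lattice to multiplication by \<open>\<i>\<close>.
\<close>

definition phase :: "real \<times> real \<Rightarrow> complex" where
  "phase X = Complex (fst X) (- snd X)"

lemma phase_diff: "phase (X - Y) = phase X - phase Y"
  by (simp add: phase_def complex_eq_iff)

lemma norm_phase [simp]: "cmod (phase X) = norm X"
  by (simp add: phase_def cmod_def norm_prod_def)

lemma Re_phase [simp]: "Re (phase X) = fst X"
  by (simp add: phase_def)

lemma bounded_linear_phase: "bounded_linear phase"
  by (rule bounded_linear_intro[where K = 1]) (auto simp: phase_def complex_eq_iff norm_phase[unfolded phase_def])

lemma cis_has_vector_derivative:
  "((\<lambda>t. cis (- t)) has_vector_derivative - \<i> * cis (- t)) (at t within S)"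
proof -
  have "((\<lambda>t. cos t - \<i> * sin t) has_vector_derivative (- sin t - \<i> * cos t)) (at t within S)"
    by (auto intro!: derivative_eq_intros has_vector_derivative_of_real has_vector_derivative_mult_right
        has_vector_derivative_diff simp: has_real_derivative_iff_has_vector_derivative[symmetric])
  moreover have "(\<lambda>t. cis (- t)) = (\<lambda>t. complex_of_real (cos t) - \<i> * complex_of_real (sin t))"
    by (rule ext) (simp add: complex_eq_iff)
  moreover have "complex_of_real (- sin t) - \<i> * complex_of_real (cos t) = - \<i> * cis (- t)"
    by (simp add: complex_eq_iff)
  ultimately show ?thesis by (simp only:)
qed

text \<open>
The factor \<open>cis (- t)\<close> removes the linear part of the equation, and only the slow nonlinear terms
are left.
\<close>

lemma rotating_frame:
  assumes p: "1 \<le> p" and X: "has_lp_derivative p {0..T} X (\<lambda>t. chain_field v f (X t))" and t: "t \<in> {0..T}"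
  defines "w \<equiv> \<lambda>t n. cis (- t) * phase (X t n)"
  shows "((\<lambda>s. cis (- s) * (- \<i> * complex_of_real (chain_force v f (\<lambda>m. Re (cis s * w s m)) n)))
    has_integral w t n - w 0 n) {0..t}"
proof (rule fundamental_theorem_of_calculus)
  show "0 \<le> t" using t by simp
  fix s assume s: "s \<in> {0..t}"
  have re: "Re (cis s * w s m) = fst (X s m)" for m
  proof -
    have "cis s * w s m = phase (X s m)" by (simp add: w_def mult.assoc[symmetric] cis_mult)
    then show ?thesis by simp
  qed
  have d: "((\<lambda>s. X s n) has_vector_derivative chain_field v f (X s) n) (at s within {0..t})"
    using s t by (intro has_vector_derivative_within_subset[OF lp_derivative_component[OF p X]]) auto
  have "((\<lambda>s. phase (X s n)) has_vector_derivative phase (chain_field v f (X s) n)) (at s within {0..t})"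
    by (rule bounded_linear.has_vector_derivative[OF bounded_linear_phase d])
  from has_vector_derivative_mult[OF cis_has_vector_derivative this]
  have "((\<lambda>s. w s n) has_vector_derivative
     cis (- s) * phase (chain_field v f (X s) n) + (- \<i> * cis (- s)) * phase (X s n)) (at s within {0..t})"
    by (simp add: w_def)
  moreover have "cis (- s) * phase (chain_field v f (X s) n) + (- \<i> * cis (- s)) * phase (X s n)
      = cis (- s) * (phase (chain_field v f (X s) n) - \<i> * phase (X s n))"
    by (simp add: algebra_simps)
  moreover have "phase (chain_field v f (X s) n) - \<i> * phase (X s n)
      = - \<i> * complex_of_real (chain_force v f (\<lambda>m. Re (cis s * w s m)) n)"
    unfolding re by (simp add: phase_def chain_field_def complex_eq_iff)
  ultimately show "((\<lambda>s. w s n) has_vector_derivative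
     cis (- s) * (- \<i> * complex_of_real (chain_force v f (\<lambda>m. Re (cis s * w s m)) n))) (at s within {0..t})"
    by simp
qed

section \<open>Comparison with the averaged equation\<close>

definition amp_force :: "real \<Rightarrow> real \<Rightarrow> real \<Rightarrow> complex \<Rightarrow> complex" where
  "amp_force \<alpha> km kp z = complex_of_real (mean_coeff \<alpha> km kp * cmod z powr (\<alpha> - 1)) * z"

lemma hom_force_rotating_continuous:
  "1 < \<alpha> \<Longrightarrow> continuous_on S (\<lambda>s. cis (- s) * complex_of_real (hom_force \<alpha> km kp (Re (cis s * z))))"
  by (intro continuous_intros hom_force_continuous)

text \<open>
A mean inherits the Lipschitz constant of the functions that are averaged.
\<close>

lemma amp_force_lipschitz:
  assumes \<alpha>: "1 < \<alpha>" and z: "cmod z \<le> R" "cmod z' \<le> R"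
    and h: "\<And>r r'. \<bar>r\<bar> \<le> R \<Longrightarrow> \<bar>r'\<bar> \<le> R \<Longrightarrow>
      \<bar>hom_force \<alpha> km kp r - hom_force \<alpha> km kp r'\<bar> \<le> L * \<bar>r - r'\<bar>" and L: "0 \<le> L"
  shows "cmod (amp_force \<alpha> km kp z - amp_force \<alpha> km kp z') \<le> L * cmod (z - z')"
proof -
  let ?h = "\<lambda>z s. cis (- s) * complex_of_real (hom_force \<alpha> km kp (Re (cis s * z)))"
  note c = hom_force_rotating_continuous[OF \<alpha>]
  have i: "?h z integrable_on {0..2 * pi}" for z by (intro integrable_continuous_real c)
  have "of_real (2 * pi) * (amp_force \<alpha> km kp z - amp_force \<alpha> km kp z') = integral {0..2 * pi} (\<lambda>s. ?h z s - ?h z' s)"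
    unfolding integral_diff[OF i i] mean_hom_force[OF \<alpha>] by (simp add: amp_force_def algebra_simps)
  moreover have "norm (integral {0..2 * pi} (\<lambda>s. ?h z s - ?h z' s)) \<le> integral {0..2 * pi} (\<lambda>_. L * cmod (z - z'))"
  proof (rule integral_norm_bound_integral)
    fix s
    have r: "\<bar>Re (cis s * y)\<bar> \<le> cmod y" for y
      using abs_Re_le_cmod[of "cis s * y"] by (simp add: norm_mult)
    have "norm (?h z s - ?h z' s) = \<bar>hom_force \<alpha> km kp (Re (cis s * z)) - hom_force \<alpha> km kp (Re (cis s * z'))\<bar>"
      by (simp add: norm_mult flip: right_diff_distrib of_real_diff)
    also have "\<dots> \<le> L * \<bar>Re (cis s * z) - Re (cis s * z')\<bar>"
      using r[of z] r[of z'] z by (intro h) auto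
    also have "\<dots> = L * \<bar>Re (cis s * (z - z'))\<bar>" by (simp add: algebra_simps)
    also have "\<dots> \<le> L * cmod (z - z')" by (rule mult_left_mono[OF r L])
    finally show "norm (?h z s - ?h z' s) \<le> L * cmod (z - z')" .
  qed (intro integrable_diff i, auto)
  ultimately have "cmod (of_real (2 * pi) * (amp_force \<alpha> km kp z - amp_force \<alpha> km kp z')) \<le> 2 * pi * (L * cmod (z - z'))"
    by (simp add: mult_ac)
  then show ?thesis by (simp add: norm_mult)
qed

lemma continuous_of_lipschitz:
  fixes v :: "real \<Rightarrow> real"
  assumes "0 \<le> L" "\<And>r r'. \<bar>v r - v r'\<bar> \<le> L * \<bar>r - r'\<bar>"
  shows "continuous_on S v"
  by (rule lipschitz_on_continuous_on[of L]) (use assms in \<open>auto intro!: lipschitz_onI simp: dist_real_def\<close>)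

text \<open>
Write \<open>\<Phi> s x\<close> for the right hand side of the equation for w at time s and state x. Then \<open>\<Phi> s (u s)\<close>
exceeds \<open>u'\<close> by a small residual \<open>\<rho>\<close>, due to the difference between v and the homogeneous force and to
f, and by the difference of \<open>\<psi>\<close> at neighbouring sites, where \<open>\<psi>\<close> is the homogeneous force minus its
mean. The integral of \<open>\<rho>\<close> is bounded by its size, that of \<open>\<psi>\<close> by averaging: u moves with speed at most
\<open>4 * L1 * M\<close>. Gronwall's inequality is applied with these integrals as the inhomogeneous term.
\<close>

theorem averaged_dynamics_estimate:
  fixes w u :: "real \<Rightarrow> int \<Rightarrow> complex" and v f :: "real \<Rightarrow> real"
  assumes p: "1 \<le> p" and \<alpha>: "1 < \<alpha>" and L: "0 < L1" "0 \<le> L2" "0 \<le> E" and T: "0 \<le> T"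
    and v: "\<And>r r'. \<bar>v r - v r'\<bar> \<le> L1 * \<bar>r - r'\<bar>"
    and f: "\<And>r r'. \<bar>f r - f r'\<bar> \<le> L2 * \<bar>r - r'\<bar>" "f 0 = 0"
    and h: "\<And>r r'. \<bar>r\<bar> \<le> R \<Longrightarrow> \<bar>r'\<bar> \<le> R \<Longrightarrow>
      \<bar>hom_force \<alpha> km kp r - hom_force \<alpha> km kp r'\<bar> \<le> L1 * \<bar>r - r'\<bar>"
    and vh: "\<And>r. \<bar>r\<bar> \<le> R \<Longrightarrow> \<bar>v r - hom_force \<alpha> km kp r\<bar> \<le> E * \<bar>r\<bar>"
    and u: "\<And>t n. t \<in> {0..T} \<Longrightarrow> ((\<lambda>s. - \<i> * (amp_force \<alpha> km kp (u s (n + 1) - u s n)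
          - amp_force \<alpha> km kp (u s n - u s (n - 1)))) has_integral u t n - u 0 n) {0..t}"
    and uc: "\<And>n. continuous_on {0..T} (\<lambda>t. u t n)"
    and uM: "\<And>t. t \<in> {0..T} \<Longrightarrow> lp_le p (u t) M"
    and uR: "\<And>t n. t \<in> {0..T} \<Longrightarrow> cmod (u t n) \<le> R / 2"
    and w: "\<And>t n. t \<in> {0..T} \<Longrightarrow>
        ((\<lambda>s. cis (- s) * (- \<i> * complex_of_real (chain_force v f (\<lambda>m. Re (cis s * w s m)) n)))
          has_integral w t n - w 0 n) {0..t}"
    and wc: "\<And>n. continuous_on {0..T} (\<lambda>t. w t n)"
    and wB: "\<And>t. t \<in> {0..T} \<Longrightarrow> lp_le p (w t) B"
    and D: "lp_le p (\<lambda>n. w 0 n - u 0 n) D"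
    and t: "t \<in> {0..T}"
  shows "lp_le p (\<lambda>n. w t n - u t n)
    ((D + T * (4 * E + L2) * M + 8 * pi * L1 * M * (8 * L1 * T + 2)) * exp (2 * (4 * L1 + L2) * t))"
proof -
  let ?h = "hom_force \<alpha> km kp" and ?g = "amp_force \<alpha> km kp"
  define b where "b s n = u s n - u s (n - 1)" for s n
  define \<psi> where "\<psi> s z = cis (- s) * complex_of_real (?h (Re (cis s * z))) - ?g z" for s z
  define \<Phi> where "\<Phi> s x n = cis (- s) * (- \<i> * complex_of_real (chain_force v f (\<lambda>m. Re (cis s * x m)) n))"
    for s and x :: "int \<Rightarrow> complex" and n
  define \<rho> where "\<rho> s n = \<Phi> s (u s) n - cis (- s) * (- \<i> * complex_of_real (chain_force ?h (\<lambda>_. 0) (\<lambda>m. Re (cis s * u s m)) n))"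
    for s n
  have M0: "0 \<le> M" using lp_le_nonneg[OF uM[OF t] p] .
  have R0: "0 \<le> R" using uR[OF t, of 0] norm_ge_zero[of "u t 0"] by linarith
  have vc: "continuous_on S v" "continuous_on S f" for S
    using continuous_of_lipschitz[OF _ v] continuous_of_lipschitz[OF _ f(1)] L by auto
  have bR: "cmod (b s n) \<le> R" if "s \<in> {0..T}" for s n
    using norm_triangle_ineq4[of "u s n" "u s (n - 1)"] uR[OF that, of n] uR[OF that, of "n - 1"] by (simp add: b_def)
  have bM: "lp_le p (b s) (2 * M)" if "s \<in> {0..T}" for s
    unfolding b_def using lp_le_difference(2)[OF p uM[OF that]] by simp
  have bc: "continuous_on {0..T} (\<lambda>s. b s n)" for n unfolding b_def by (intro continuous_intros uc)
  have g0: "?g 0 = 0" by (simp add: amp_force_def)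
  have glip: "cmod (?g z - ?g z') \<le> L1 * cmod (z - z')" if "cmod z \<le> R" "cmod z' \<le> R" for z z'
    using that h L by (intro amp_force_lipschitz[OF \<alpha>]) auto
  have gc: "continuous_on S (\<lambda>x. ?g (y x))" if "continuous_on S y" for S and y :: "'b::topological_space \<Rightarrow> complex"
    unfolding amp_force_def using \<alpha> that
    by (intro continuous_on_mult continuous_on_of_real continuous_on_powr' continuous_on_const continuous_on_norm) auto
  \<comment> \<open>The averaged force inherits the bound \<open>L1\<close>, which limits the speed of u and hence that of b.\<close>
  have gb: "lp_le p (\<lambda>n. ?g (b s n)) (L1 * (2 * M))" if "s \<in> {0..T}" for s
    using glip[OF bR[OF that], of 0] R0 g0 L by (intro lp_le_dominated[OF p bM[OF that]]) auto
  have u': "lp_le p (\<lambda>n. - \<i> * (?g (b s (n + 1)) - ?g (b s n))) (4 * L1 * M)" if "s \<in> {0..T}" for s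
    using lp_le_difference(1)[OF p gb[OF that]] by (rule lp_le_cong[OF _ p, THEN lp_le_mono]) (auto simp: norm_mult)
  have uK: "lp_le p (\<lambda>n. u s n - u r n) (4 * L1 * M * \<bar>s - r\<bar>)" if "s \<in> {0..T}" "r \<in> {0..T}" for s r
  proof (rule lp_integral_lipschitz[OF p _ u' _ that])
    show "continuous_on {0..T} (\<lambda>t. - \<i> * (?g (b t (n + 1)) - ?g (b t n)))" for n
      by (intro continuous_intros gc bc)
    show "u t n = u 0 n + integral {0..t} (\<lambda>s. - \<i> * (?g (b s (n + 1)) - ?g (b s n)))" if "t \<in> {0..T}" for t n
      using integral_unique[OF u[OF that, of n]] by (simp add: b_def)
  qed
  have bK: "lp_le p (\<lambda>n. b s n - b r n) (8 * L1 * M * \<bar>s - r\<bar>)" if "s \<in> {0..T}" "r \<in> {0..T}" for s r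
  proof -
    have "(\<lambda>n. b s n - b r n) = (\<lambda>n. u s n - u r n - (u s (n - 1) - u r (n - 1)))"
      by (rule ext) (simp add: b_def)
    then show ?thesis using lp_le_difference(2)[OF p uK[OF that]] by (simp add: mult.assoc)
  qed
  \<comment> \<open>The constant is doubled because both the homogeneous force and its mean vary with z.\<close>
  have avg: "lp_le p (\<lambda>n. integral {0..t} (\<lambda>s. \<psi> s (b s n)))
     (2 * L1 * (8 * L1 * M) * (2 * pi) * t + 2 * L1 * (2 * pi) * (2 * M))" if t: "t \<in> {0..T}" for t
  proof (rule lp_averaging[OF p, where R = R and T = T and b = b and \<psi> = \<psi>])
    show "continuous_on UNIV (\<lambda>(s, z). \<psi> s z)"
      unfolding \<psi>_def case_prod_beta
      by (intro continuous_intros hom_force_continuous \<alpha> gc)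
    show "\<psi> (s + 2 * pi) z = \<psi> s z" for s z
    proof -
      have "cis (s + 2 * pi) = cis s" by (simp add: complex_eq_iff)
      moreover from this have "cis (- (s + 2 * pi)) = cis (- s)" by (metis cis_inverse)
      ultimately show ?thesis by (simp only: \<psi>_def)
    qed
    show "integral {0..2 * pi} (\<lambda>s. \<psi> s z) = 0" for z
    proof -
      have "integral {0..2 * pi} (\<lambda>s. \<psi> s z) = integral {0..2 * pi} (\<lambda>s. cis (- s) * complex_of_real (?h (Re (cis s * z))))
          - integral {0..2 * pi} (\<lambda>_. ?g z)"
        unfolding \<psi>_def by (intro integral_diff integrable_continuous_real hom_force_rotating_continuous \<alpha>) auto
      then show ?thesis unfolding mean_hom_force[OF \<alpha>] by (simp add: amp_force_def scaleR_conv_of_real)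
    qed
    show "\<psi> s 0 = 0" for s by (simp add: \<psi>_def g0)
    show "cmod (\<psi> s z - \<psi> s z') \<le> 2 * L1 * cmod (z - z')" if z: "cmod z \<le> R" "cmod z' \<le> R" for s z z'
    proof -
      have r: "\<bar>Re (cis s * y)\<bar> \<le> cmod y" for y
        using abs_Re_le_cmod[of "cis s * y"] by (simp add: norm_mult)
      let ?d = "?h (Re (cis s * z)) - ?h (Re (cis s * z'))"
      have "\<psi> s z - \<psi> s z' = cis (- s) * complex_of_real ?d - (?g z - ?g z')"
        by (simp add: \<psi>_def algebra_simps)
      then have "cmod (\<psi> s z - \<psi> s z') \<le> cmod (cis (- s) * complex_of_real ?d) + cmod (?g z - ?g z')"
        by (metis norm_triangle_ineq4)
      also have "cmod (cis (- s) * complex_of_real ?d) = \<bar>?d\<bar>"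
        unfolding norm_mult norm_of_real by simp
      also have "\<bar>?d\<bar> \<le> L1 * \<bar>Re (cis s * z) - Re (cis s * z')\<bar>"
        using r[of z] r[of z'] z by (intro h) auto
      also have "Re (cis s * z) - Re (cis s * z') = Re (cis s * (z - z'))" by (simp add: algebra_simps)
      also have "L1 * \<bar>Re (cis s * (z - z'))\<bar> \<le> L1 * cmod (z - z')" using L by (intro mult_left_mono r) simp
      also have "cmod (?g z - ?g z') \<le> L1 * cmod (z - z')" by (rule glip[OF z])
      finally show ?thesis by (simp add: algebra_simps)
    qed
  qed (use L M0 bR bM bK t in auto)
  \<comment> \<open>This part of the residual is small pointwise in time and needs no averaging.\<close>
  have \<rho>: "lp_le p (\<rho> s) ((4 * E + L2) * M)" if s: "s \<in> {0..T}" for s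
  proof -
    let ?x = "\<lambda>m. Re (cis s * u s m)"
    let ?e = "\<lambda>r. v r - ?h r"
    have r: "\<bar>Re (cis s * y)\<bar> \<le> cmod y" for y
      using abs_Re_le_cmod[of "cis s * y"] by (simp add: norm_mult)
    have x: "lp_le p ?x M" by (rule lp_le_cong[OF uM[OF s] p]) (use r in simp)
    have xd: "\<bar>?x (n + 1) - ?x n\<bar> \<le> R" for n
      using r[of "u s n"] r[of "u s (n + 1)"] uR[OF s, of n] uR[OF s, of "n + 1"] by linarith
    have 1: "lp_le p (\<lambda>n. ?e (?x (n + 1) - ?x n)) (E * (2 * M))"
      by (rule lp_le_dominated[OF p lp_le_difference(1)[OF p x] L(3)]) (use vh xd in simp)
    have 2: "lp_le p (\<lambda>n. ?e (?x n - ?x (n - 1))) (E * (2 * M))"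
      using lp_le_shift[OF 1, of "-1"] by simp
    have 3: "lp_le p (\<lambda>n. f (?x n)) (L2 * M)"
      by (rule lp_le_dominated[OF p x L(2)]) (use f(1)[of _ 0] f(2) in simp)
    have "lp_le p (\<rho> s) (E * (2 * M) + E * (2 * M) + L2 * M)"
    proof (rule lp_le_add[OF p lp_le_diff[OF p 1 2] 3])
      fix n
      have "\<rho> s n = cis (- s) * (- \<i> * complex_of_real ((?e (?x (n + 1) - ?x n) - ?e (?x n - ?x (n - 1))) - f (?x n)))"
        by (simp add: \<rho>_def \<Phi>_def chain_force_def algebra_simps)
      then have "norm (\<rho> s n) = \<bar>(?e (?x (n + 1) - ?x n) - ?e (?x n - ?x (n - 1))) - f (?x n)\<bar>"
        by (simp only: norm_mult norm_of_real) simp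
      then show "norm (\<rho> s n) \<le> norm (?e (?x (n + 1) - ?x n) - ?e (?x n - ?x (n - 1))) + norm (f (?x n))"
        by simp
    qed
    then show ?thesis by (simp add: algebra_simps)
  qed
  have xc: "continuous_on {0..T} (\<lambda>s. Re (cis s * y s m))" if "\<And>n. continuous_on {0..T} (\<lambda>s. y s n)"
    for y :: "real \<Rightarrow> int \<Rightarrow> complex" and m
    by (intro continuous_intros that)
  have \<Phi>c: "continuous_on {0..T} (\<lambda>s. \<Phi> s (y s) n)" if y: "\<And>n. continuous_on {0..T} (\<lambda>s. y s n)"
    for y :: "real \<Rightarrow> int \<Rightarrow> complex" and n
    unfolding \<Phi>_def chain_force_def
    by (intro continuous_intros xc y continuous_on_compose2[OF vc(1)[of UNIV]] continuous_on_compose2[OF vc(2)[of UNIV]]) auto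
  have \<rho>c: "continuous_on {0..T} (\<lambda>s. \<rho> s n)" for n
    unfolding \<rho>_def chain_force_def
    by (intro continuous_intros \<Phi>c xc uc hom_force_continuous \<alpha>)
  have \<psi>c: "continuous_on {0..T} (\<lambda>s. \<psi> s (b s n))" for n
    unfolding \<psi>_def by (intro continuous_intros gc bc hom_force_continuous \<alpha>)
  have int: "k integrable_on {0..r}" if "continuous_on {0..T} k" "r \<in> {0..T}" for k :: "real \<Rightarrow> complex" and r
    using that by (intro integrable_continuous_real continuous_on_subset[OF that(1)]) auto
  define d where "d r n = (w 0 n - u 0 n) + integral {0..r} (\<lambda>s. \<rho> s n)
      - \<i> * (integral {0..r} (\<lambda>s. \<psi> s (b s (n + 1))) - integral {0..r} (\<lambda>s. \<psi> s (b s n)))" for r n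
  have dle: "lp_le p (d r) (D + T * (4 * E + L2) * M + 8 * pi * L1 * M * (8 * L1 * T + 2))" if r: "r \<in> {0..T}" for r
  proof -
    have "lp_le p (\<lambda>n. integral {0..r} (\<lambda>s. \<rho> s n)) ((r - 0) * ((4 * E + L2) * M))"
      using r by (intro lp_le_integral_const p continuous_on_subset[OF \<rho>c] \<rho>) auto
    moreover have "r * ((4 * E + L2) * M) \<le> T * ((4 * E + L2) * M)"
      using r L M0 by (intro mult_right_mono) auto
    ultimately have 1: "lp_le p (\<lambda>n. integral {0..r} (\<lambda>s. \<rho> s n)) (T * (4 * E + L2) * M)"
      by (auto elim: lp_le_mono simp: mult.assoc)
    have "2 * L1 * (8 * L1 * M) * (2 * pi) * r \<le> 2 * L1 * (8 * L1 * M) * (2 * pi) * T"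
      using r L M0 by (intro mult_left_mono) auto
    then have "lp_le p (\<lambda>n. integral {0..r} (\<lambda>s. \<psi> s (b s n))) (4 * pi * L1 * M * (8 * L1 * T + 2))"
      by (intro lp_le_mono[OF avg[OF r]]) (simp add: algebra_simps)
    from lp_le_difference(1)[OF p this]
    have 2: "lp_le p (\<lambda>n. integral {0..r} (\<lambda>s. \<psi> s (b s (n + 1))) - integral {0..r} (\<lambda>s. \<psi> s (b s n)))
        (8 * pi * L1 * M * (8 * L1 * T + 2))" by (simp add: algebra_simps)
    show ?thesis
      by (rule lp_le_add[OF p lp_le_sum[OF p D 1] 2])
        (unfold d_def, rule order_trans[OF norm_triangle_ineq4], simp add: norm_mult)
  qed
  show ?thesis
  proof (rule lp_gronwall[OF p _ _ dle, where k = "\<lambda>s n. \<Phi> s (w s) n - \<Phi> s (u s) n" and B = "B + M" and T = T])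
    show "0 < 4 * L1 + L2" using L by simp
    show "w r n - u r n = d r n + integral {0..r} (\<lambda>s. \<Phi> s (w s) n - \<Phi> s (u s) n)" if r: "r \<in> {0..T}" for r n
    proof -
      have iw: "integral {0..r} (\<lambda>s. \<Phi> s (w s) n) = w r n - w 0 n"
        using integral_unique[OF w[OF r]] by (simp add: \<Phi>_def)
      have iu: "integral {0..r} (\<lambda>s. - \<i> * (?g (b s (n + 1)) - ?g (b s n))) = u r n - u 0 n"
        using integral_unique[OF u[OF r]] by (simp add: b_def)
      have "\<Phi> s (u s) n = \<rho> s n - \<i> * (\<psi> s (b s (n + 1)) - \<psi> s (b s n)) + (- \<i> * (?g (b s (n + 1)) - ?g (b s n)))" for s
        by (simp add: \<rho>_def \<psi>_def b_def chain_force_def algebra_simps)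
      then have "integral {0..r} (\<lambda>s. \<Phi> s (u s) n) = integral {0..r} (\<lambda>s. \<rho> s n - \<i> * (\<psi> s (b s (n + 1)) - \<psi> s (b s n)) + (- \<i> * (?g (b s (n + 1)) - ?g (b s n))))"
        by simp
      also have "\<dots> = integral {0..r} (\<lambda>s. \<rho> s n - \<i> * (\<psi> s (b s (n + 1)) - \<psi> s (b s n))) + (u r n - u 0 n)"
        unfolding iu[symmetric] by (intro integral_add int r continuous_intros \<rho>c \<psi>c gc bc)
      also have "integral {0..r} (\<lambda>s. \<rho> s n - \<i> * (\<psi> s (b s (n + 1)) - \<psi> s (b s n)))
          = integral {0..r} (\<lambda>s. \<rho> s n) - integral {0..r} (\<lambda>s. \<i> * (\<psi> s (b s (n + 1)) - \<psi> s (b s n)))"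
        by (intro integral_diff int r continuous_intros \<rho>c \<psi>c)
      also have "integral {0..r} (\<lambda>s. \<i> * (\<psi> s (b s (n + 1)) - \<psi> s (b s n)))
          = \<i> * (integral {0..r} (\<lambda>s. \<psi> s (b s (n + 1))) - integral {0..r} (\<lambda>s. \<psi> s (b s n)))"
        by (simp add: Henstock_Kurzweil_Integration.integral_diff[OF int[OF \<psi>c r] int[OF \<psi>c r]])
      finally have "integral {0..r} (\<lambda>s. \<Phi> s (u s) n) = d r n - (w 0 n - u 0 n) + (u r n - u 0 n)"
        by (simp add: d_def)
      then show ?thesis
        using iw by (subst integral_diff) (auto intro!: int r \<Phi>c wc uc)
    qed
    show "continuous_on {0..T} (\<lambda>s. \<Phi> s (w s) n - \<Phi> s (u s) n)" for n
      by (intro continuous_on_diff \<Phi>c wc uc)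
    show "lp_le p (\<lambda>n. \<Phi> s (w s) n - \<Phi> s (u s) n) ((4 * L1 + L2) * m)"
      if s: "s \<in> {0..T}" and m: "lp_le p (\<lambda>n. w s n - u s n) m" for s m
    proof -
      have r: "\<bar>Re (cis s * y)\<bar> \<le> cmod y" for y
        using abs_Re_le_cmod[of "cis s * y"] by (simp add: norm_mult)
      have x: "lp_le p (\<lambda>n. Re (cis s * w s n) - Re (cis s * u s n)) m"
        by (rule lp_le_cong[OF m p]) (use r[of "w s _ - u s _"] in \<open>simp add: algebra_simps\<close>)
      show ?thesis
      proof (rule lp_le_cong[OF chain_force_lipschitz[OF p _ _ v f(1) x] p])
        fix n
        have "\<Phi> s (w s) n - \<Phi> s (u s) n = cis (- s) * (- \<i> * complex_of_real
          (chain_force v f (\<lambda>m. Re (cis s * w s m)) n - chain_force v f (\<lambda>m. Re (cis s * u s m)) n))"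
          by (simp add: \<Phi>_def algebra_simps)
        then show "norm (\<Phi> s (w s) n - \<Phi> s (u s) n) \<le>
          norm (chain_force v f (\<lambda>m. Re (cis s * w s m)) n - chain_force v f (\<lambda>m. Re (cis s * u s m)) n)"
          by (simp only: norm_mult norm_of_real) simp
      qed (use L in auto)
    qed
    show "lp_le p (\<lambda>n. w s n - u s n) (B + M)" if "s \<in> {0..T}" for s
      by (intro lp_le_diff p wB uM that)
    show "t \<in> {0..T}" by (rule t)
  qed
qed

section \<open>Time intervals, essential suprema and logarithms\<close>

lemma has_lp_derivative_subset:
  "has_lp_derivative p S u u' \<Longrightarrow> S' \<subseteq> S \<Longrightarrow> has_lp_derivative p S' u u'"
  unfolding has_lp_derivative_def by (meson subsetD tendsto_within_subset)

lemma has_lp_derivative_cong: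
  assumes "has_lp_derivative p S u u'" "\<And>t. t \<in> S \<Longrightarrow> u' t = u'' t"
  shows "has_lp_derivative p S u u''"
  using assms unfolding has_lp_derivative_def by auto

text \<open>
The norm of a solution is continuous in time, so a value above N would be shared by an interval,
which is not a null set.
\<close>

lemma lp_norm_le_of_Linfty_norm:
  assumes p: "1 \<le> p" and a: "has_lp_derivative p {0..} a a'" and N: "Linfty_norm_lp p a = ereal N"
    and t: "0 \<le> t"
  shows "lp_norm p (a t) \<le> N"
proof (rule ccontr)
  assume "\<not> lp_norm p (a t) \<le> N"
  then have gt: "N < lp_norm p (a t)" by simp
  have "((\<lambda>t. lp_norm p (a t)) \<longlongrightarrow> lp_norm p (a t)) (at t within {0..})"
    using lp_derivative_norm_continuous[OF p a] t by (simp add: continuous_on_def)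
  from order_tendstoD(1)[OF this gt]
  obtain d where d: "d > 0" "\<And>s. 0 \<le> s \<Longrightarrow> s \<noteq> t \<Longrightarrow> dist s t < d \<Longrightarrow> N < lp_norm p (a s)"
    unfolding eventually_at by auto
  have gt': "N < lp_norm p (a s)" if "s \<in> {t<..<t + d}" for s
    using that t by (intro d(2)) (auto simp: dist_real_def)
  have "AE s in lebesgue_on {0..}. ereal (lp_norm p (a s)) \<le> ereal N"
    using esssup_AE[where f = "\<lambda>s. ereal (lp_norm p (a s))" and M = "lebesgue_on {0..}"] N
    by (simp add: Linfty_norm_lp_def)
  then have "AE s in lebesgue. 0 \<le> s \<longrightarrow> lp_norm p (a s) \<le> N"
    by (simp add: AE_restrict_space_iff)
  then have "AE s in lebesgue. s \<notin> {t<..<t + d}"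
    by eventually_elim (use gt' t in fastforce)
  then have "{t<..<t + d} \<in> null_sets lebesgue"
    by (subst AE_iff_null_sets) auto
  then have "negligible {t<..<t + d}" by (simp add: negligible_iff_null_sets)
  moreover have "\<not> negligible {t<..<t + d}" using d by (intro open_not_negligible) auto
  ultimately show False by blast
qed

lemma ln_times_powr_tendsto_0:
  assumes s: "0 < s"
  shows "((\<lambda>x::real. \<bar>ln x\<bar> * x powr s) \<longlongrightarrow> 0) (at_right 0)"
proof -
  have ev: "\<forall>\<^sub>F x::real in at_right 0. 0 < x \<and> x < 1"
    unfolding eventually_at_right_field by (intro exI[of _ 1]) auto
  have bd: "\<forall>\<^sub>F x::real in at_right 0. norm (\<bar>ln x\<bar> * x powr s) \<le> x powr (s / 2) / (s / 2)"
    using ev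
  proof eventually_elim
    case (elim x)
    have "ln (1 / x) \<le> (1 / x) powr (s / 2) / (s / 2)"
      using elim s by (intro ln_powr_bound) auto
    then have "\<bar>ln x\<bar> \<le> x powr - (s / 2) / (s / 2)"
      using elim by (simp add: ln_div powr_divide powr_minus_divide)
    then have "\<bar>ln x\<bar> * x powr s \<le> (x powr - (s / 2) / (s / 2)) * x powr s"
      by (intro mult_right_mono) auto
    also have "\<dots> = x powr (s / 2) / (s / 2)"
      by (simp flip: powr_add)
    finally show ?case by (simp add: abs_mult)
  qed
  have lim: "((\<lambda>x::real. x powr (s / 2) / (s / 2)) \<longlongrightarrow> 0 / (s / 2)) (at_right 0)"
    using s ev by (intro tendsto_divide tendsto_const tendsto_zero_powrI[where b = "s / 2"])
      (auto intro!: tendsto_eq_intros elim: eventually_mono)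
  show ?thesis using Lim_null_comparison[OF bd] lim by simp
qed

section \<open>Truncation of the forces\<close>

text \<open>
Composing the forces with this projection onto [-R, R] makes them globally Lipschitz, with their
Lipschitz constants on [-R, R].
\<close>

definition clamp_real :: "real \<Rightarrow> real \<Rightarrow> real" where
  "clamp_real R r = max (- R) (min R r)"

lemma clamp_real_bounds:
  assumes "0 \<le> R"
  shows "\<bar>clamp_real R r\<bar> \<le> R" "\<bar>clamp_real R r - clamp_real R r'\<bar> \<le> \<bar>r - r'\<bar>"
    "\<bar>r\<bar> \<le> R \<Longrightarrow> clamp_real R r = r"
proof -
  show "\<bar>clamp_real R r\<bar> \<le> R" using assms by (auto simp: clamp_real_def max_def min_def)
  show "\<bar>clamp_real R r - clamp_real R r'\<bar> \<le> \<bar>r - r'\<bar>"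
    using assms by (auto simp: clamp_real_def max_def min_def)
  show "\<bar>r\<bar> \<le> R \<Longrightarrow> clamp_real R r = r" by (simp add: clamp_real_def abs_le_iff)
qed

lemma clamp_lipschitz:
  assumes "0 \<le> R" "0 \<le> L"
    and v: "\<And>r r'. \<bar>r\<bar> \<le> R \<Longrightarrow> \<bar>r'\<bar> \<le> R \<Longrightarrow> \<bar>v r - v r'\<bar> \<le> L * \<bar>r - r'\<bar>"
  shows "\<bar>(v \<circ> clamp_real R) r - (v \<circ> clamp_real R) r'\<bar> \<le> L * \<bar>r - r'\<bar>"
proof -
  have "\<bar>v (clamp_real R r) - v (clamp_real R r')\<bar> \<le> L * \<bar>clamp_real R r - clamp_real R r'\<bar>"
    using assms clamp_real_bounds(1) by (intro v) auto
  also have "\<dots> \<le> L * \<bar>r - r'\<bar>" using assms clamp_real_bounds(2) by (intro mult_left_mono) auto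
  finally show ?thesis by simp
qed

text \<open>
The bound is R / 2 because the interaction forces act on differences of two positions.
\<close>

lemma chain_field_clamp:
  assumes R: "0 \<le> R" and X: "\<And>n. norm (X n) \<le> R / 2"
  shows "chain_field (v \<circ> clamp_real R) (f \<circ> clamp_real R) X = chain_field v f X"
proof (rule ext)
  fix n
  have x: "\<bar>fst (X m)\<bar> \<le> R / 2" for m
    using norm_fst_le[of "fst (X m)" "snd (X m)"] X[of m] by simp
  have "\<bar>fst (X n)\<bar> \<le> R" using x[of n] R by linarith
  moreover have "\<bar>fst (X (n + 1)) - fst (X n)\<bar> \<le> R" "\<bar>fst (X n) - fst (X (n - 1))\<bar> \<le> R"
    using x[of n] x[of "n + 1"] x[of "n - 1"] by linarith+
  ultimately show "chain_field (v \<circ> clamp_real R) (f \<circ> clamp_real R) X n = chain_field v f X n"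
    using R by (simp add: chain_field_def chain_force_def clamp_real_bounds(3))
qed

lemma lattice_solution_iff:
  "lattice_solution V \<phi> p T X0 X \<longleftrightarrow>
    X 0 = X0 \<and> has_lp_derivative p {0..T} X (\<lambda>t. chain_field (deriv V) (deriv \<phi>) (X t))"
  by (simp add: lattice_solution_def lattice_field_eq_chain_field)

text \<open>
Both solutions are bounded on the compact time interval, so they solve a common truncated, globally
Lipschitz equation.
\<close>

theorem lattice_solution_unique:
  assumes p: "1 \<le> p" and V: "C2 V" and \<phi>: "C2 \<phi>"
    and X: "lattice_solution V \<phi> p T X0 X" and Y: "lattice_solution V \<phi> p T X0 Y" and t: "t \<in> {0..T}"
  shows "Y t = X t"
proof -
  have dX: "has_lp_derivative p {0..T} X (\<lambda>t. chain_field (deriv V) (deriv \<phi>) (X t))" and X0: "X 0 = X0"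
    and dY: "has_lp_derivative p {0..T} Y (\<lambda>t. chain_field (deriv V) (deriv \<phi>) (Y t))" and Y0: "Y 0 = X0"
    using X Y by (auto simp: lattice_solution_iff)
  obtain B C where B: "\<And>t. t \<in> {0..T} \<Longrightarrow> lp_le p (X t) B" and C: "\<And>t. t \<in> {0..T} \<Longrightarrow> lp_le p (Y t) C"
    using lp_derivative_bounded[OF p dX] lp_derivative_bounded[OF p dY] by blast
  define R where "R = 2 * max B C"
  have R: "0 \<le> R" using lp_le_nonneg[OF B[OF t] p] by (simp add: R_def)
  obtain L1 where L1: "0 \<le> L1" "\<And>r r'. \<bar>r\<bar> \<le> R \<Longrightarrow> \<bar>r'\<bar> \<le> R \<Longrightarrow> \<bar>deriv V r - deriv V r'\<bar> \<le> L1 * \<bar>r - r'\<bar>"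
    using C2_locally_lipschitz[OF V] by blast
  obtain L2 where L2: "0 \<le> L2" "\<And>r r'. \<bar>r\<bar> \<le> R \<Longrightarrow> \<bar>r'\<bar> \<le> R \<Longrightarrow> \<bar>deriv \<phi> r - deriv \<phi> r'\<bar> \<le> L2 * \<bar>r - r'\<bar>"
    using C2_locally_lipschitz[OF \<phi>] by blast
  let ?\<Psi> = "chain_field (deriv V \<circ> clamp_real R) (deriv \<phi> \<circ> clamp_real R)"
  have lip: "lp_lipschitz p (1 + 4 * L1 + L2) ?\<Psi>"
    by (intro chain_field_lipschitz p L1 L2 clamp_lipschitz R)
  have bX: "norm (X s n) \<le> R / 2" and bY: "norm (Y s n) \<le> R / 2" if "s \<in> {0..T}" for s n
    using lp_le_pointwise[OF p B[OF that], of n] lp_le_pointwise[OF p C[OF that], of n] by (auto simp: R_def)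
  show ?thesis
  proof (rule lp_flow_unique[OF p _ lip _ _ _ t])
    show "0 < 1 + 4 * L1 + L2" using L1 L2 by simp
    show "has_lp_derivative p {0..T} Y (\<lambda>t. ?\<Psi> (Y t))"
      by (rule has_lp_derivative_cong[OF dY]) (simp add: chain_field_clamp[OF R bY])
    show "has_lp_derivative p {0..T} X (\<lambda>t. ?\<Psi> (X t))"
      by (rule has_lp_derivative_cong[OF dX]) (simp add: chain_field_clamp[OF R bX])
    show "Y 0 = X 0" using X0 Y0 by simp
  qed
qed

section \<open>Validity of the amplitude equation\<close>

text \<open>
The approximation \<open>X_approx\<close> in the rotating frame.
\<close>

definition amp_profile :: "real \<Rightarrow> (real \<Rightarrow> int \<Rightarrow> complex) \<Rightarrow> real \<Rightarrow> real \<Rightarrow> int \<Rightarrow> complex" where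
  "amp_profile \<alpha> a \<epsilon> t n = complex_of_real (sqrt 2 * \<epsilon>) * a (\<epsilon> powr (\<alpha> - 1) * t) n"

lemma phase_X_approx: "phase (X_approx \<alpha> a \<epsilon> t n) = cis t * amp_profile \<alpha> a \<epsilon> t n"
proof -
  define A where "A = complex_of_real (\<epsilon> / sqrt 2) * a (\<epsilon> powr (\<alpha> - 1) * t) n * exp (\<i> * complex_of_real t)"
  have "phase (X_approx \<alpha> a \<epsilon> t n) = 2 * A"
    unfolding X_approx_def Let_def A_def[symmetric] by (simp add: phase_def complex_eq_iff)
  also have "2 * A = (complex_of_real 2 * complex_of_real (\<epsilon> / sqrt 2)) * a (\<epsilon> powr (\<alpha> - 1) * t) n * cis t"
    by (simp add: A_def cis_conv_exp)
  also have "complex_of_real 2 * complex_of_real (\<epsilon> / sqrt 2) = complex_of_real (sqrt 2 * \<epsilon>)"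
  proof -
    have "2 * (\<epsilon> / sqrt 2) = sqrt 2 * \<epsilon>" by (simp add: field_simps)
    then show ?thesis by (simp only: of_real_mult[symmetric])
  qed
  finally show ?thesis by (simp add: amp_profile_def mult_ac)
qed

lemma amp_force_scaling:
  assumes \<alpha>: "1 < \<alpha>" and \<epsilon>: "0 < \<epsilon>"
  shows "complex_of_real (sqrt 2 * \<epsilon>) * (complex_of_real (\<epsilon> powr (\<alpha> - 1)) *
     (complex_of_real (omega0 \<alpha> km kp) * z * complex_of_real (cmod z powr (\<alpha> - 1))))
    = amp_force \<alpha> km kp (complex_of_real (sqrt 2 * \<epsilon>) * z)"
proof -
  have "sqrt 2 powr (\<alpha> - 1) = 2 powr ((\<alpha> - 1) / 2)"
    by (simp add: powr_half_sqrt[symmetric] powr_powr)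
  then have "cmod (complex_of_real (sqrt 2 * \<epsilon>) * z) powr (\<alpha> - 1)
      = 2 powr ((\<alpha> - 1) / 2) * (\<epsilon> powr (\<alpha> - 1) * cmod z powr (\<alpha> - 1))"
    using \<epsilon> by (simp add: norm_mult powr_mult)
  then show ?thesis
    by (simp add: amp_force_def omega0_mean_coeff[OF \<alpha>] mult_ac)
qed

lemma amp_profile_equation:
  assumes p: "1 \<le> p" and \<alpha>: "1 < \<alpha>" and \<epsilon>: "0 < \<epsilon>"
    and a: "has_lp_derivative p {0..} a a'"
    and eq: "\<And>\<tau> n. 0 \<le> \<tau> \<Longrightarrow> \<i> * a' \<tau> n = delta_plus (amp_f \<alpha> km kp (delta_minus (a \<tau>))) n"
    and t: "0 \<le> t"
  defines "u \<equiv> amp_profile \<alpha> a \<epsilon>"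
  shows "((\<lambda>t. u t n) has_vector_derivative - \<i> * (amp_force \<alpha> km kp (u t (n + 1) - u t n)
          - amp_force \<alpha> km kp (u t n - u t (n - 1)))) (at t within {0..})"
proof -
  let ?s = "\<epsilon> powr (\<alpha> - 1)"
  let ?G = "\<lambda>z. complex_of_real (omega0 \<alpha> km kp) * z * complex_of_real (cmod z powr (\<alpha> - 1))"
  let ?a = "a (?s * t)"
  have st: "0 \<le> ?s * t" using t by simp
  have lin: "((\<lambda>t. ?s * t) has_vector_derivative ?s) (at t within {0..})"
    by (auto intro!: derivative_eq_intros simp: has_real_derivative_iff_has_vector_derivative[symmetric])
  have "((\<lambda>\<tau>. a \<tau> n) has_vector_derivative a' (?s * t) n) (at (?s * t) within (\<lambda>t. ?s * t) ` {0..})"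
    by (rule has_vector_derivative_within_subset[OF lp_derivative_component[OF p a]]) (use st in auto)
  from vector_diff_chain_within[OF lin this]
  have "((\<lambda>t. a (?s * t) n) has_vector_derivative ?s *\<^sub>R a' (?s * t) n) (at t within {0..})"
    by (simp add: o_def)
  from has_vector_derivative_mult_right[OF this, of "complex_of_real (sqrt 2 * \<epsilon>)"]
  have "((\<lambda>t. u t n) has_vector_derivative complex_of_real (sqrt 2 * \<epsilon>) * (?s *\<^sub>R a' (?s * t) n)) (at t within {0..})"
    unfolding u_def amp_profile_def .
  moreover have "a' (?s * t) n = - \<i> * (?G (?a (n + 1) - ?a n) - ?G (?a n - ?a (n - 1)))"
  proof -
    have "a' (?s * t) n = - \<i> * (\<i> * a' (?s * t) n)" by simp
    then show ?thesis
      unfolding eq[OF st] by (simp add: delta_plus_def delta_minus_def amp_f_def)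
  qed
  moreover have "complex_of_real (sqrt 2 * \<epsilon>) * (?s *\<^sub>R (- \<i> * (?G x - ?G y)))
      = - \<i> * (complex_of_real (sqrt 2 * \<epsilon>) * (complex_of_real ?s * ?G x) - complex_of_real (sqrt 2 * \<epsilon>) * (complex_of_real ?s * ?G y))" for x y
    by (simp add: scaleR_conv_of_real right_diff_distrib mult.left_commute)
  moreover have "u t m - u t k = complex_of_real (sqrt 2 * \<epsilon>) * (?a m - ?a k)" for m k
    by (simp only: u_def amp_profile_def right_diff_distrib)
  ultimately show ?thesis
    unfolding amp_force_scaling[OF \<alpha> \<epsilon>, symmetric] by (simp only: amp_force_scaling[OF \<alpha> \<epsilon>])
qed

text \<open>
The approximation is bounded by M, so the level \<open>R = 2 * (M + \<epsilon>)\<close> leaves states within \<open>\<epsilon>\<close> of it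
unaffected by the truncation. The solution of the truncated equation satisfies the estimate by A on
the whole time interval, and \<open>A \<le> \<epsilon>\<close>; hence it also solves the lattice equation.
\<close>

theorem lattice_follows_amplitude:
  assumes p: "1 \<le> p" and \<alpha>: "1 < \<alpha>" and L2: "0 \<le> L2" and E: "0 \<le> E"
    and V: "\<And>r r'. \<bar>r\<bar> \<le> R \<Longrightarrow> \<bar>r'\<bar> \<le> R \<Longrightarrow> \<bar>deriv V r - deriv V r'\<bar> \<le> L1 * \<bar>r - r'\<bar>"
    and \<phi>: "\<And>r r'. \<bar>r\<bar> \<le> R \<Longrightarrow> \<bar>r'\<bar> \<le> R \<Longrightarrow> \<bar>deriv \<phi> r - deriv \<phi> r'\<bar> \<le> L2 * \<bar>r - r'\<bar>"
    and Vh: "\<And>r. \<bar>r\<bar> \<le> R \<Longrightarrow> \<bar>deriv V r - hom_force \<alpha> km kp r\<bar> \<le> E * \<bar>r\<bar>"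
    and h: "\<And>r r'. \<bar>r\<bar> \<le> R \<Longrightarrow> \<bar>r'\<bar> \<le> R \<Longrightarrow>
        \<bar>hom_force \<alpha> km kp r - hom_force \<alpha> km kp r'\<bar> \<le> L1 * \<bar>r - r'\<bar>"
    and L1: "0 < L1" and V0: "deriv V 0 = 0" and \<phi>0: "deriv \<phi> 0 = 0"
    and a: "has_lp_derivative p {0..} a a'"
    and eq: "\<And>\<tau> n. 0 \<le> \<tau> \<Longrightarrow> \<i> * a' \<tau> n = delta_plus (amp_f \<alpha> km kp (delta_minus (a \<tau>))) n"
    and aN: "\<And>\<tau>. 0 \<le> \<tau> \<Longrightarrow> lp_le p (a \<tau>) N"
    and \<epsilon>: "0 < \<epsilon>" and M: "M = sqrt 2 * \<epsilon> * N" and R: "R = 2 * (M + \<epsilon>)"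
    and T: "0 \<le> T" and X0: "X0 \<in> lp p" and D: "lp_norm p (X0 - X_approx \<alpha> a \<epsilon> 0) \<le> D"
    and A: "A = (D + T * (4 * E + L2) * M + 8 * pi * L1 * M * (8 * L1 * T + 2)) * exp (2 * (4 * L1 + L2) * T)"
    and small: "A \<le> \<epsilon>"
  shows "\<exists>X. lattice_solution V \<phi> p T X0 X \<and> (\<forall>t\<in>{0..T}. lp_norm p (X t - X_approx \<alpha> a \<epsilon> t) \<le> A)"
proof -
  define u where "u = amp_profile \<alpha> a \<epsilon>"
  let ?v = "deriv V \<circ> clamp_real R" and ?f = "deriv \<phi> \<circ> clamp_real R"
  have N: "0 \<le> N" using lp_le_nonneg[OF aN[OF order_refl] p] .
  have M0: "0 \<le> M" using N \<epsilon> by (simp add: M)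
  have R0: "0 \<le> R" using M0 \<epsilon> by (simp add: R)
  have vl: "\<bar>?v r - ?v r'\<bar> \<le> L1 * \<bar>r - r'\<bar>" for r r' using L1 by (intro clamp_lipschitz R0 V) auto
  have fl: "\<bar>?f r - ?f r'\<bar> \<le> L2 * \<bar>r - r'\<bar>" for r r' by (intro clamp_lipschitz R0 \<phi> L2)
  have v0: "?v 0 = 0" "?f 0 = 0" using R0 V0 \<phi>0 by (simp_all add: clamp_real_bounds(3))
  have lip: "lp_lipschitz p (1 + 4 * L1 + L2) (chain_field ?v ?f)"
    using L1 L2 by (intro chain_field_lipschitz p vl fl) auto
  have "0 < 1 + 4 * L1 + L2" using L1 L2 by simp
  moreover have "chain_field ?v ?f (\<lambda>_. 0) n = 0" for n
    using v0 by (simp add: chain_field_def chain_force_def zero_prod_def del: o_apply)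
  ultimately obtain X where X0': "X 0 = X0" and X: "has_lp_derivative p {0..T} X (\<lambda>t. chain_field ?v ?f (X t))"
    using lp_picard[OF p _ lip _ X0 T] by blast
  define w where "w = (\<lambda>t n. cis (- t) * phase (X t n))"
  have diff: "cmod (w t n - u t n) = norm (X t n - X_approx \<alpha> a \<epsilon> t n)" for t n
  proof -
    have "w t n - u t n = cis (- t) * phase (X t n - X_approx \<alpha> a \<epsilon> t n)"
      by (simp add: w_def u_def phase_diff phase_X_approx right_diff_distrib mult.assoc[symmetric] cis_mult)
    then show ?thesis by (simp add: norm_mult)
  qed
  obtain B where B: "\<And>t. t \<in> {0..T} \<Longrightarrow> lp_le p (X t) B"
    using lp_derivative_bounded[OF p X] by blast
  have uM: "lp_le p (u t) M" if t: "0 \<le> t" for t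
  proof -
    have "lp_le p (a (\<epsilon> powr (\<alpha> - 1) * t)) N" using t by (intro aN) auto
    from lp_le_dominated[OF p this, of "sqrt 2 * \<epsilon>" "u t"] show ?thesis
      using \<epsilon> by (simp add: u_def amp_profile_def M norm_mult)
  qed
  note ud = amp_profile_equation[OF p \<alpha> \<epsilon> a eq, folded u_def]
  have estimate: "lp_le p (\<lambda>n. w t n - u t n)
      ((D + T * (4 * E + L2) * M + 8 * pi * L1 * M * (8 * L1 * T + 2)) * exp (2 * (4 * L1 + L2) * t))"
    if t: "t \<in> {0..T}" for t
  proof (rule averaged_dynamics_estimate[OF p \<alpha> L1 L2 E T vl fl v0(2) h _ _ _ _ _ _ _ _ _ t])
    show "\<bar>?v r - hom_force \<alpha> km kp r\<bar> \<le> E * \<bar>r\<bar>" if "\<bar>r\<bar> \<le> R" for r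
      using Vh[OF that] clamp_real_bounds(3)[OF R0 that] by simp
    show "((\<lambda>s. - \<i> * (amp_force \<alpha> km kp (u s (n + 1) - u s n) - amp_force \<alpha> km kp (u s n - u s (n - 1))))
        has_integral u t n - u 0 n) {0..t}" if "t \<in> {0..T}" for t n
      using that by (intro fundamental_theorem_of_calculus has_vector_derivative_within_subset[OF ud]) auto
    show "continuous_on {0..T} (\<lambda>t. u t n)" for n
      by (rule continuous_on_vector_derivative, rule has_vector_derivative_within_subset[OF ud]) auto
    show "lp_le p (u t) M" if "t \<in> {0..T}" for t using that by (intro uM) auto
    show "cmod (u t n) \<le> R / 2" if "t \<in> {0..T}" for t n
      using lp_le_pointwise[OF p uM, of t n] that \<epsilon> by (simp add: R)
    show "((\<lambda>s. cis (- s) * (- \<i> * complex_of_real (chain_force ?v ?f (\<lambda>m. Re (cis s * w s m)) n)))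
        has_integral w t n - w 0 n) {0..t}" if "t \<in> {0..T}" for t n
      unfolding w_def by (rule rotating_frame[OF p X that])
    show "continuous_on {0..T} (\<lambda>t. w t n)" for n
    proof -
      have "continuous_on {0..T} (\<lambda>t. X t n)"
        by (rule continuous_on_vector_derivative, rule lp_derivative_component[OF p X])
      then have "continuous_on {0..T} (\<lambda>t. phase (X t n))"
        by (rule bounded_linear.continuous_on[OF bounded_linear_phase])
      then show ?thesis unfolding w_def by (intro continuous_intros)
    qed
    show "lp_le p (w t) B" if "t \<in> {0..T}" for t
      by (rule lp_le_cong[OF B[OF that] p]) (simp add: w_def norm_mult)
    show "lp_le p (\<lambda>n. w 0 n - u 0 n) D"
    proof (rule lp_le_cong[OF _ p])
      have "X_approx \<alpha> a \<epsilon> 0 \<in> lp p"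
      proof -
        have "lp_le p (X_approx \<alpha> a \<epsilon> 0) M"
        proof (rule lp_le_cong[OF uM[OF order_refl] p])
          have "norm (X_approx \<alpha> a \<epsilon> 0 n) = cmod (phase (X_approx \<alpha> a \<epsilon> 0 n))" for n by simp
          then show "norm (X_approx \<alpha> a \<epsilon> 0 n) \<le> norm (u 0 n)" for n by (simp add: phase_X_approx u_def)
        qed
        then show ?thesis by (auto simp: lp_mem)
      qed
      from lp_diff_mem[OF p X0 this] show "lp_le p (X0 - X_approx \<alpha> a \<epsilon> 0) D"
        using D by (simp add: lp_le_def fun_diff_def)
      show "norm (w 0 n - u 0 n) \<le> norm ((X0 - X_approx \<alpha> a \<epsilon> 0) n)" for n
        using diff[of 0 n] X0' by simp
    qed
  qed
  have D0: "0 \<le> D + T * (4 * E + L2) * M + 8 * pi * L1 * M * (8 * L1 * T + 2)"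
    using lp_le_nonneg[OF estimate[of 0] p] T by (simp add: zero_le_mult_iff)
  have final: "lp_le p (\<lambda>n. X t n - X_approx \<alpha> a \<epsilon> t n) A" if t: "t \<in> {0..T}" for t
  proof -
    have "exp (2 * (4 * L1 + L2) * t) \<le> exp (2 * (4 * L1 + L2) * T)"
      using t L1 L2 by (simp add: mult_left_mono)
    then have "lp_le p (\<lambda>n. w t n - u t n) A"
      unfolding A using D0 by (intro lp_le_mono[OF estimate[OF t]] mult_left_mono) auto
    then show ?thesis by (rule lp_le_cong[OF _ p]) (simp add: diff)
  qed
  have bX: "norm (X t n) \<le> R / 2" if t: "t \<in> {0..T}" for t n
  proof -
    have "norm (X t n - X_approx \<alpha> a \<epsilon> t n) \<le> \<epsilon>"
      using lp_le_pointwise[OF p final[OF t], of n] small by simp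
    moreover have "norm (X_approx \<alpha> a \<epsilon> t n) = norm (u t n)"
    proof -
      have "norm (X_approx \<alpha> a \<epsilon> t n) = cmod (phase (X_approx \<alpha> a \<epsilon> t n))" by simp
      then show ?thesis by (simp add: phase_X_approx u_def norm_mult)
    qed
    moreover have "norm (u t n) \<le> M" using lp_le_pointwise[OF p uM] t by auto
    ultimately show ?thesis
      using norm_triangle_sub[of "X t n" "X_approx \<alpha> a \<epsilon> t n"] by (simp add: R)
  qed
  have "lattice_solution V \<phi> p T X0 X"
    unfolding lattice_solution_iff using X0'
    by (auto intro!: has_lp_derivative_cong[OF X] chain_field_clamp R0 bX)
  moreover have "lp_norm p (X t - X_approx \<alpha> a \<epsilon> t) \<le> A" if "t \<in> {0..T}" for t
    using lp_norm_le[OF final[OF that]] by (simp add: fun_diff_def)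
  ultimately show ?thesis by blast
qed

text \<open>
On the time scale T the product \<open>L1 * T\<close> is \<open>\<mu> * \<bar>ln \<epsilon>\<bar> / 10\<close>: all dependence
on N and K cancels. Hence the exponential is at most \<open>\<epsilon> powr (- \<mu>)\<close>, while in each error term a
factor T is compensated by a factor of order \<open>\<epsilon> powr (\<alpha> - 1)\<close> up to a logarithm. The logarithm is at
least 1, so it also bounds the term without T. Since \<open>\<mu> < \<eta>\<close>, the final constant can be taken
independent of \<open>\<mu>\<close>.
\<close>

lemma error_budget:
  fixes \<alpha> \<beta> \<gamma> \<eta> \<mu> K N Ci \<epsilon> :: real
  defines "\<rho> \<equiv> 2 * (sqrt 2 * N + 1)"
  assumes \<alpha>: "1 < \<alpha>" and \<eta>: "\<eta> \<le> \<alpha> - 1" "\<eta> \<le> \<beta>" "\<eta> \<le> \<gamma>" and \<mu>: "0 < \<mu>" "\<mu> < \<eta>" and K: "0 < K" and N: "0 \<le> N"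
    and Ci: "0 < Ci" and \<epsilon>: "0 < \<epsilon>" "\<epsilon> \<le> exp (- 1)" and R1: "\<rho> * \<epsilon> \<le> 1"
  defines "T \<equiv> \<mu> * (1 / (10 * K * \<rho> powr (\<alpha> - 1))) * \<bar>ln \<epsilon>\<bar> * \<epsilon> powr (1 - \<alpha>)"
    and "M \<equiv> sqrt 2 * \<epsilon> * N"
    and "L1 \<equiv> K * (\<rho> * \<epsilon>) powr (\<alpha> - 1)" and "L2 \<equiv> K * (\<rho> * \<epsilon>) powr (\<alpha> - 1 + \<gamma>)"
    and "E \<equiv> K * (\<rho> * \<epsilon>) powr (\<alpha> - 1 + \<beta>)"
  shows "(Ci * \<bar>ln \<epsilon>\<bar> * \<epsilon> powr (1 + \<eta>) + T * (4 * E + L2) * M + 8 * pi * L1 * M * (8 * L1 * T + 2))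
      * exp (2 * (4 * L1 + L2) * T)
    \<le> (Ci + sqrt 2 * N * (\<eta> * (4 * \<rho> powr \<beta> + \<rho> powr \<gamma>) + 8 * pi * K * \<rho> powr (\<alpha> - 1) * (\<eta> + 2)))
      * \<bar>ln \<epsilon>\<bar> * \<epsilon> powr (1 + \<eta> - \<mu>)"
proof -
  define l where "l = \<bar>ln \<epsilon>\<bar>"
  define x where "x = (\<rho> * \<epsilon>) powr (\<alpha> - 1)"
  have \<rho>: "2 \<le> \<rho>" using N by (simp add: \<rho>_def)
  have e1: "\<epsilon> < 1" using \<epsilon>(2) exp_less_one_iff[of "-1"] by linarith
  have "ln \<epsilon> \<le> - 1" using \<epsilon> by (metis ln_exp ln_le_cancel_iff exp_gt_zero)
  then have l: "1 \<le> l" "l = - ln \<epsilon>" by (auto simp: l_def)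
  have x0: "0 < x" using \<rho> \<epsilon> by (simp add: x_def)
  have xe: "x = \<rho> powr (\<alpha> - 1) * \<epsilon> powr (\<alpha> - 1)" using \<rho> \<epsilon> by (simp add: x_def powr_mult)
  have T0: "0 \<le> T" using \<mu> K by (simp add: T_def)
  have xT: "x * T = \<mu> * l / (10 * K)"
  proof -
    have "\<epsilon> powr (\<alpha> - 1) * \<epsilon> powr (1 - \<alpha>) = 1" using \<epsilon> by (simp flip: powr_add)
    moreover have "x * T = (\<rho> powr (\<alpha> - 1) / \<rho> powr (\<alpha> - 1)) * (\<mu> * l / (10 * K)) * (\<epsilon> powr (\<alpha> - 1) * \<epsilon> powr (1 - \<alpha>))"
      by (simp add: xe T_def l_def mult_ac)
    ultimately show ?thesis using \<rho> by simp
  qed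
  have L1: "L1 = K * x" by (simp add: L1_def x_def)
  have split: "(\<rho> * \<epsilon>) powr (\<alpha> - 1 + s) = x * (\<rho> powr s * \<epsilon> powr s)" for s
    using \<rho> \<epsilon> by (simp add: x_def powr_add powr_mult)
  have mono: "\<epsilon> powr s \<le> \<epsilon> powr \<eta>" if "\<eta> \<le> s" for s
    using that \<epsilon> e1 by (intro powr_mono') auto
  have e\<eta>: "\<epsilon> powr (1 + \<eta>) = \<epsilon> * \<epsilon> powr \<eta>" using \<epsilon> by (simp add: powr_add)
  \<comment> \<open>The factor 10 in T is twice the 5 in \<open>4 * L1 + L2 \<le> 5 * K * x\<close>.\<close>
  have "L2 \<le> K * x"
    unfolding L2_def x_def using K \<rho> \<epsilon> R1 \<eta> \<mu> by (intro mult_left_mono powr_mono') auto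
  then have "2 * (4 * L1 + L2) * T \<le> 10 * K * (x * T)"
    using mult_right_mono[OF _ T0, of "2 * (4 * L1 + L2)" "10 * K * x"] by (simp add: L1 mult_ac)
  also have "\<dots> = \<mu> * l" using K by (simp add: xT)
  finally have "exp (2 * (4 * L1 + L2) * T) \<le> exp (\<mu> * l)" by simp
  also have "exp (\<mu> * l) = \<epsilon> powr (- \<mu>)" using \<epsilon> l by (simp add: powr_def)
  finally have ex: "exp (2 * (4 * L1 + L2) * T) \<le> \<epsilon> powr (- \<mu>)" .
  have t1: "T * (4 * E + L2) * M \<le> sqrt 2 * N * (\<eta> * (4 * \<rho> powr \<beta> + \<rho> powr \<gamma>)) * l * \<epsilon> powr (1 + \<eta>)"
  proof -
    have "T * (4 * E + L2) * M = (K * (x * T)) * (4 * (\<rho> powr \<beta> * \<epsilon> powr \<beta>) + \<rho> powr \<gamma> * \<epsilon> powr \<gamma>) * M"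
      unfolding E_def L2_def split by (simp add: algebra_simps)
    also have "\<dots> \<le> (\<eta> * l) * (4 * (\<rho> powr \<beta> * \<epsilon> powr \<eta>) + \<rho> powr \<gamma> * \<epsilon> powr \<eta>) * M"
    proof -
      have "\<mu> * l \<le> \<eta> * l" "0 \<le> \<mu> * l" using \<mu> l(1) by (auto intro: mult_right_mono)
      moreover have "K * (x * T) = \<mu> * l / 10" using K by (simp add: xT)
      ultimately have le: "K * (x * T) \<le> \<eta> * l" and nn: "0 \<le> \<eta> * l" by linarith+
      have "4 * (\<rho> powr \<beta> * \<epsilon> powr \<beta>) + \<rho> powr \<gamma> * \<epsilon> powr \<gamma> \<le> 4 * (\<rho> powr \<beta> * \<epsilon> powr \<eta>) + \<rho> powr \<gamma> * \<epsilon> powr \<eta>"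
        by (intro add_mono mult_left_mono mono \<eta>) auto
      from mult_mono[OF le this nn] show ?thesis
        using \<epsilon> N by (intro mult_right_mono) (auto simp: M_def)
    qed
    also have "\<dots> = sqrt 2 * N * (\<eta> * (4 * \<rho> powr \<beta> + \<rho> powr \<gamma>)) * l * \<epsilon> powr (1 + \<eta>)"
      unfolding e\<eta> M_def by (simp add: algebra_simps)
    finally show ?thesis .
  qed
  have t2: "8 * pi * L1 * M * (8 * L1 * T + 2) \<le> sqrt 2 * N * (8 * pi * K * \<rho> powr (\<alpha> - 1) * (\<eta> + 2)) * l * \<epsilon> powr (1 + \<eta>)"
  proof -
    have "8 * L1 * T + 2 = 8 * (K * (x * T)) + 2" by (simp add: L1 mult_ac)
    also have "8 * (K * (x * T)) = 8 * \<mu> * l / 10" using K by (simp add: xT)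
    also have "8 * \<mu> * l / 10 + 2 \<le> (\<eta> + 2) * l"
    proof -
      have "\<mu> * l \<le> \<eta> * l" "0 \<le> \<mu> * l" using \<mu> l(1) by (auto intro: mult_right_mono)
      then have "8 * (\<mu> * l) / 10 + 2 \<le> \<eta> * l + 2 * l" using l(1) by linarith
      then show ?thesis by (simp only: mult.assoc distrib_right)
    qed
    finally have a: "8 * L1 * T + 2 \<le> (\<eta> + 2) * l" .
    have "8 * pi * L1 * M = 8 * pi * K * \<rho> powr (\<alpha> - 1) * \<epsilon> powr (\<alpha> - 1) * M" by (simp add: L1 xe mult_ac)
    also have "\<dots> \<le> 8 * pi * K * \<rho> powr (\<alpha> - 1) * \<epsilon> powr \<eta> * M"
      using K \<epsilon> N by (intro mult_right_mono mult_left_mono mono \<eta>) (auto simp: M_def)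
    finally have b: "8 * pi * L1 * M \<le> 8 * pi * K * \<rho> powr (\<alpha> - 1) * \<epsilon> powr \<eta> * M" .
    have "8 * pi * L1 * M * (8 * L1 * T + 2) \<le> 8 * pi * K * \<rho> powr (\<alpha> - 1) * \<epsilon> powr \<eta> * M * ((\<eta> + 2) * l)"
      using K x0 T0 \<epsilon> N by (intro mult_mono[OF b a]) (auto simp: L1 M_def)
    also have "\<dots> = sqrt 2 * N * (8 * pi * K * \<rho> powr (\<alpha> - 1) * (\<eta> + 2)) * l * \<epsilon> powr (1 + \<eta>)"
      unfolding e\<eta> M_def by (simp add: mult_ac)
    finally show ?thesis .
  qed
  let ?C = "Ci + sqrt 2 * N * (\<eta> * (4 * \<rho> powr \<beta> + \<rho> powr \<gamma>) + 8 * pi * K * \<rho> powr (\<alpha> - 1) * (\<eta> + 2))"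
  have "Ci * \<bar>ln \<epsilon>\<bar> * \<epsilon> powr (1 + \<eta>) + T * (4 * E + L2) * M + 8 * pi * L1 * M * (8 * L1 * T + 2)
      \<le> ?C * l * \<epsilon> powr (1 + \<eta>)"
    using t1 t2 by (simp add: l_def[symmetric] distrib_left distrib_right)
  moreover have C0: "0 \<le> ?C" using Ci N \<mu> K by (intro add_nonneg_nonneg mult_nonneg_nonneg) auto
  ultimately have "(Ci * \<bar>ln \<epsilon>\<bar> * \<epsilon> powr (1 + \<eta>) + T * (4 * E + L2) * M + 8 * pi * L1 * M * (8 * L1 * T + 2))
      * exp (2 * (4 * L1 + L2) * T) \<le> ?C * l * \<epsilon> powr (1 + \<eta>) * \<epsilon> powr (- \<mu>)"
    using l(1) ex by (intro mult_mono mult_nonneg_nonneg[OF mult_nonneg_nonneg[OF C0]]) auto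
  also have "\<dots> = ?C * l * \<epsilon> powr (1 + \<eta> - \<mu>)"
    using powr_add[of \<epsilon> "1 + \<eta>" "- \<mu>"] by simp
  finally show ?thesis by (simp only: l_def)
qed

theorem theorem2p20:
  fixes \<alpha> km kp \<beta> \<gamma> \<eta> :: real and V W \<phi> :: "real \<Rightarrow> real" and p :: ereal
  assumes "\<alpha> > 1" and "(km, kp) \<noteq> (0, 0)" and "\<beta> > 0" and "\<gamma> > 0"
    and "C2 V" and "\<And>r. V r = V_hom \<alpha> km kp r + W r"
    and "deriv W 0 = 0" and "deriv (deriv W) \<in> O[at 0](\<lambda>r. \<bar>r\<bar> powr (\<alpha> - 1 + \<beta>))"
    and "C2 \<phi>" and "deriv \<phi> 0 = 0"
    and "deriv (deriv \<phi>) \<in> O[at 0](\<lambda>x. \<bar>x\<bar> powr (\<alpha> - 1 + \<gamma>))"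
    and "1 \<le> p" and "\<eta> = Min {\<alpha> - 1, \<beta>, \<gamma>}"
  shows "\<exists>(\<epsilon>0 :: real \<Rightarrow> real \<Rightarrow> real \<Rightarrow> real) (Cl :: real \<Rightarrow> real \<Rightarrow> real) (\<nu> :: real \<Rightarrow> real).
    continuous_on {0..} \<nu> \<and> antimono_on {0..} \<nu> \<and> (\<forall>N\<ge>0. \<nu> N > 0) \<and>
    (\<forall>Ci>0. \<forall>N\<ge>0. Cl Ci N > 0) \<and>
    (\<forall>\<mu>\<in>{0<..<\<eta>}. \<forall>Ci>0. \<forall>N\<ge>0. \<epsilon>0 \<mu> Ci N > 0) \<and>
    (\<forall>\<mu>\<in>{0<..<\<eta>}. \<forall>Ci>0. \<forall>N\<ge>0. \<forall>a.
       amplitude_solution \<alpha> km kp p a \<and> Linfty_norm_lp p a = ereal N \<longrightarrow>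
       (\<forall>\<epsilon>\<in>{0<..\<epsilon>0 \<mu> Ci N}. \<forall>X0\<in>lp p.
          lp_norm p (X0 - X_approx \<alpha> a \<epsilon> 0) \<le> Ci * \<bar>ln \<epsilon>\<bar> * \<epsilon> powr (1 + \<eta>) \<longrightarrow>
          (let T = \<mu> * \<nu> N * \<bar>ln \<epsilon>\<bar> * \<epsilon> powr (1 - \<alpha>) in
           \<exists>X. lattice_solution V \<phi> p T X0 X \<and>
             (\<forall>T'\<in>{0..T}. \<forall>Y. lattice_solution V \<phi> p T' X0 Y \<longrightarrow> (\<forall>t\<in>{0..T'}. Y t = X t)) \<and>
             (\<forall>t\<in>{0..T}. lp_norm p (X t - X_approx \<alpha> a \<epsilon> t)
                \<le> Cl Ci N * \<bar>ln \<epsilon>\<bar> * \<epsilon> powr (1 + \<eta> - \<mu>)))))"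
proof -
  note \<alpha> = \<open>\<alpha> > 1\<close> and p = \<open>1 \<le> p\<close>
  have \<eta>: "0 < \<eta>" "\<eta> \<le> \<alpha> - 1" "\<eta> \<le> \<beta>" "\<eta> \<le> \<gamma>"
    using \<open>\<eta> = Min {\<alpha> - 1, \<beta>, \<gamma>}\<close> \<alpha> \<open>\<beta> > 0\<close> \<open>\<gamma> > 0\<close> by auto
  obtain K r0 where K: "K > 0" and r0: "0 < r0" "r0 \<le> 1"
    and bV: "\<And>R r r'. R \<le> r0 \<Longrightarrow> \<bar>r\<bar> \<le> R \<Longrightarrow> \<bar>r'\<bar> \<le> R \<Longrightarrow> \<bar>deriv V r - deriv V r'\<bar> \<le> K * R powr (\<alpha> - 1) * \<bar>r - r'\<bar>"
    and b\<phi>: "\<And>R r r'. R \<le> r0 \<Longrightarrow> \<bar>r\<bar> \<le> R \<Longrightarrow> \<bar>r'\<bar> \<le> R \<Longrightarrow> \<bar>deriv \<phi> r - deriv \<phi> r'\<bar> \<le> K * R powr (\<alpha> - 1 + \<gamma>) * \<bar>r - r'\<bar>"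
    and bW: "\<And>R r. R \<le> r0 \<Longrightarrow> \<bar>r\<bar> \<le> R \<Longrightarrow> \<bar>deriv V r - hom_force \<alpha> km kp r\<bar> \<le> K * R powr (\<alpha> - 1 + \<beta>) * \<bar>r\<bar>"
    and bh: "\<And>R r r'. \<bar>r\<bar> \<le> R \<Longrightarrow> \<bar>r'\<bar> \<le> R \<Longrightarrow> \<bar>hom_force \<alpha> km kp r - hom_force \<alpha> km kp r'\<bar> \<le> K * R powr (\<alpha> - 1) * \<bar>r - r'\<bar>"
    and V0: "deriv V 0 = 0"
    using lattice_force_bounds[OF assms(1,3-9,11)] by blast
  \<comment> \<open>The truncation level is \<open>\<rho> N * \<epsilon>\<close>: twice the size \<open>sqrt 2 * \<epsilon> * N\<close> of the approximation, with
    room for an error \<open>\<epsilon>\<close>.\<close>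
  define \<rho> where "\<rho> N = 2 * (sqrt 2 * N + 1)" for N :: real
  define \<nu> where "\<nu> N = 1 / (10 * K * \<rho> N powr (\<alpha> - 1))" for N
  define Cl where "Cl Ci N = Ci + sqrt 2 * N * (\<eta> * (4 * \<rho> N powr \<beta> + \<rho> N powr \<gamma>) + 8 * pi * K * \<rho> N powr (\<alpha> - 1) * (\<eta> + 2))"
    for Ci N :: real
  have \<rho>: "2 \<le> \<rho> N" if "0 \<le> N" for N using that by (simp add: \<rho>_def)
  have Cl: "0 < Cl Ci N" if "0 < Ci" "0 \<le> N" for Ci N
    unfolding Cl_def using that \<eta> K by (intro add_pos_nonneg mult_nonneg_nonneg add_nonneg_nonneg) auto
  \<comment> \<open>The second condition keeps the truncation level in the range of the force bounds; the third one
    makes the final error at most \<open>\<epsilon>\<close>, as the truncation argument requires.\<close>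
  define small where "small \<mu> Ci N e \<longleftrightarrow> 0 < e \<and> (\<forall>\<epsilon>. 0 < \<epsilon> \<and> \<epsilon> \<le> e \<longrightarrow>
      \<epsilon> \<le> exp (- 1) \<and> \<rho> N * \<epsilon> \<le> r0 \<and> Cl Ci N * (\<bar>ln \<epsilon>\<bar> * \<epsilon> powr (\<eta> - \<mu>)) \<le> 1)" for \<mu> Ci N e
  have ex_small: "\<exists>e. small \<mu> Ci N e"
    if "\<mu> < \<eta>" for \<mu> Ci N
  proof -
    have "((\<lambda>\<epsilon>. Cl Ci N * (\<bar>ln \<epsilon>\<bar> * \<epsilon> powr (\<eta> - \<mu>))) \<longlongrightarrow> 0) (at_right 0)"
      using that by (intro tendsto_mult_right_zero ln_times_powr_tendsto_0) simp
    then have "\<forall>\<^sub>F \<epsilon> in at_right 0. Cl Ci N * (\<bar>ln \<epsilon>\<bar> * \<epsilon> powr (\<eta> - \<mu>)) < 1"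
      by (rule order_tendstoD) simp
    moreover have "((\<lambda>\<epsilon>. \<rho> N * \<epsilon>) \<longlongrightarrow> \<rho> N * 0) (at_right 0)" by (intro tendsto_intros)
    then have "\<forall>\<^sub>F \<epsilon> in at_right 0. \<rho> N * \<epsilon> < r0" by (rule order_tendstoD) (use r0 in simp)
    moreover have "\<forall>\<^sub>F \<epsilon>::real in at_right 0. \<epsilon> < exp (- 1)"
      unfolding eventually_at_right_field by (intro exI[of _ "exp (- 1)"]) auto
    ultimately have "\<forall>\<^sub>F \<epsilon> in at_right 0. \<epsilon> < exp (- 1) \<and> \<rho> N * \<epsilon> < r0 \<and> Cl Ci N * (\<bar>ln \<epsilon>\<bar> * \<epsilon> powr (\<eta> - \<mu>)) < 1"
      by eventually_elim blast
    then obtain b where "0 < b" "\<And>\<epsilon>. 0 < \<epsilon> \<Longrightarrow> \<epsilon> < b \<Longrightarrow> \<epsilon> < exp (- 1) \<and> \<rho> N * \<epsilon> < r0 \<and> Cl Ci N * (\<bar>ln \<epsilon>\<bar> * \<epsilon> powr (\<eta> - \<mu>)) < 1"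
      unfolding eventually_at_right_field by blast
    then have "small \<mu> Ci N (b / 2)" unfolding small_def by (auto intro: less_imp_le)
    then show ?thesis ..
  qed
  define \<epsilon>0 where "\<epsilon>0 \<mu> Ci N = (SOME e. small \<mu> Ci N e)" for \<mu> Ci N
  have \<epsilon>0: "small \<mu> Ci N (\<epsilon>0 \<mu> Ci N)" if "\<mu> < \<eta>" for \<mu> Ci N
    unfolding \<epsilon>0_def by (rule someI_ex[OF ex_small[OF that]])
  have \<nu>0: "0 < \<nu> N" if "0 \<le> N" for N
    using K \<rho>[OF that] by (simp add: \<nu>_def)
  have \<nu>c: "continuous_on {0..} \<nu>"
    unfolding \<nu>_def \<rho>_def using K by (intro continuous_intros) (auto simp: add_nonneg_eq_0_iff)
  have \<nu>a: "antimono_on {0..} \<nu>"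
  proof (rule monotone_onI)
    fix N N' :: real assume N: "N \<in> {0..}" "N' \<in> {0..}" "N \<le> N'"
    have "\<rho> N powr (\<alpha> - 1) \<le> \<rho> N' powr (\<alpha> - 1)"
      using N \<alpha> by (intro powr_mono2) (auto simp: \<rho>_def)
    then show "\<nu> N' \<le> \<nu> N"
      unfolding \<nu>_def using K \<rho>[of N] N by (intro divide_left_mono mult_left_mono mult_pos_pos) auto
  qed
  have main: "let T = \<mu> * \<nu> N * \<bar>ln \<epsilon>\<bar> * \<epsilon> powr (1 - \<alpha>) in
           \<exists>X. lattice_solution V \<phi> p T X0 X \<and>
             (\<forall>T'\<in>{0..T}. \<forall>Y. lattice_solution V \<phi> p T' X0 Y \<longrightarrow> (\<forall>t\<in>{0..T'}. Y t = X t)) \<and>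
             (\<forall>t\<in>{0..T}. lp_norm p (X t - X_approx \<alpha> a \<epsilon> t)
                \<le> Cl Ci N * \<bar>ln \<epsilon>\<bar> * \<epsilon> powr (1 + \<eta> - \<mu>))"
    if \<mu>: "\<mu> \<in> {0<..<\<eta>}" and Ci: "0 < Ci" and N: "0 \<le> N"
      and sol: "amplitude_solution \<alpha> km kp p a" and aN: "Linfty_norm_lp p a = ereal N"
      and e: "\<epsilon> \<in> {0<..\<epsilon>0 \<mu> Ci N}" and X0: "X0 \<in> lp p"
      and D: "lp_norm p (X0 - X_approx \<alpha> a \<epsilon> 0) \<le> Ci * \<bar>ln \<epsilon>\<bar> * \<epsilon> powr (1 + \<eta>)"
    for \<mu> Ci N a \<epsilon> X0
  proof -
    define T where "T = \<mu> * \<nu> N * \<bar>ln \<epsilon>\<bar> * \<epsilon> powr (1 - \<alpha>)"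
    define R where "R = \<rho> N * \<epsilon>"
    define M where "M = sqrt 2 * \<epsilon> * N"
    define L1 where "L1 = K * R powr (\<alpha> - 1)"
    define L2 where "L2 = K * R powr (\<alpha> - 1 + \<gamma>)"
    define E where "E = K * R powr (\<alpha> - 1 + \<beta>)"
    define A where "A = (Ci * \<bar>ln \<epsilon>\<bar> * \<epsilon> powr (1 + \<eta>) + T * (4 * E + L2) * M + 8 * pi * L1 * M * (8 * L1 * T + 2))
      * exp (2 * (4 * L1 + L2) * T)"
    have \<epsilon>: "0 < \<epsilon>" "\<epsilon> \<le> exp (- 1)" "R \<le> r0" "Cl Ci N * (\<bar>ln \<epsilon>\<bar> * \<epsilon> powr (\<eta> - \<mu>)) \<le> 1"
      using e \<mu> \<epsilon>0[of \<mu> Ci N] by (auto simp: R_def small_def)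
    have R1: "\<rho> N * \<epsilon> \<le> 1" using \<epsilon>(3) r0 by (simp add: R_def)
    have T0: "0 \<le> T" using \<mu> \<nu>0[OF N] by (simp add: T_def)
    have AC: "A \<le> Cl Ci N * \<bar>ln \<epsilon>\<bar> * \<epsilon> powr (1 + \<eta> - \<mu>)"
      unfolding A_def T_def M_def L1_def L2_def E_def R_def \<nu>_def Cl_def \<rho>_def
      by (rule error_budget) (use \<alpha> \<eta> \<mu> K N Ci \<epsilon> R1 in \<open>auto simp: \<rho>_def\<close>)
    also have "\<dots> = \<epsilon> * (Cl Ci N * (\<bar>ln \<epsilon>\<bar> * \<epsilon> powr (\<eta> - \<mu>)))"
      using \<epsilon>(1) powr_add[of \<epsilon> 1 "\<eta> - \<mu>"] by (simp add: algebra_simps)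
    also have "\<dots> \<le> \<epsilon> * 1" using \<epsilon> by (intro mult_left_mono) auto
    finally have small: "A \<le> \<epsilon>" by simp
    obtain a' where a: "has_lp_derivative p {0..} a a'"
      and eq: "\<And>\<tau> n. 0 \<le> \<tau> \<Longrightarrow> \<i> * a' \<tau> n = delta_plus (amp_f \<alpha> km kp (delta_minus (a \<tau>))) n"
      using sol unfolding amplitude_solution_def by blast
    have bound: "lp_le p (a \<tau>) N" if "0 \<le> \<tau>" for \<tau>
      using lp_norm_le_of_Linfty_norm[OF p a aN that] a that by (auto simp: lp_le_def has_lp_derivative_def)
    have Rpos: "0 < R" using \<rho>[OF N] \<epsilon> by (simp add: R_def)
    have "\<exists>X. lattice_solution V \<phi> p T X0 X \<and> (\<forall>t\<in>{0..T}. lp_norm p (X t - X_approx \<alpha> a \<epsilon> t) \<le> A)"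
    proof (rule lattice_follows_amplitude[OF p \<alpha> _ _ _ _ _ _ _ V0 \<open>deriv \<phi> 0 = 0\<close> a eq bound \<epsilon>(1) M_def _ T0 X0 D A_def small, where R = R])
      show "0 \<le> L2" "0 \<le> E" "0 < L1" using K Rpos by (auto simp: L2_def E_def L1_def)
      show "R = 2 * (M + \<epsilon>)" by (simp add: R_def M_def \<rho>_def algebra_simps)
    qed (use bV b\<phi> bW bh \<epsilon>(3) in \<open>auto simp: L1_def L2_def E_def\<close>)
    then obtain X where X: "lattice_solution V \<phi> p T X0 X"
      and XA: "\<And>t. t \<in> {0..T} \<Longrightarrow> lp_norm p (X t - X_approx \<alpha> a \<epsilon> t) \<le> A" by blast
    have "Y t = X t" if "T' \<in> {0..T}" "lattice_solution V \<phi> p T' X0 Y" "t \<in> {0..T'}" for T' Y t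
    proof (rule lattice_solution_unique[OF p \<open>C2 V\<close> \<open>C2 \<phi>\<close> _ that(2,3)])
      show "lattice_solution V \<phi> p T' X0 X"
        using X that(1) unfolding lattice_solution_def by (auto elim: has_lp_derivative_subset)
    qed
    moreover have "lp_norm p (X t - X_approx \<alpha> a \<epsilon> t) \<le> Cl Ci N * \<bar>ln \<epsilon>\<bar> * \<epsilon> powr (1 + \<eta> - \<mu>)" if "t \<in> {0..T}" for t
      using XA[OF that] AC by (rule order_trans)
    ultimately show ?thesis using X unfolding T_def[symmetric] Let_def by blast
  qed
  have \<epsilon>0_pos: "0 < \<epsilon>0 \<mu> Ci N" if "\<mu> \<in> {0<..<\<eta>}" for \<mu> Ci N
    using \<epsilon>0[of \<mu> Ci N] that by (simp add: small_def)
  show ?thesis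
    by (intro exI[of _ \<epsilon>0] exI[of _ Cl] exI[of _ \<nu>] conjI \<nu>c \<nu>a allI impI ballI \<nu>0 Cl \<epsilon>0_pos main)
      (assumption | erule conjunct1 conjunct2)+
qed

end
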